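(* Let $\mathscr C$ be a small category with all pullbacks and with pushouts along regular monomorphisms. Then $\mathscr C$ is rm-adhesive if and only if there is a full embedding of $\mathscr C$ into a topos which preserves pullbacks and pushouts along regular monomorphisms.
   Context: A pushout along a regular monomorphism is a pushout square $gm=nf$ (with $m\colon C\to A$, $f\colon C\to B$, $g\colon A\to D$, $n\colon B\to D$) in which $m$ is a regular monomorphism and $f$ is arbitrary. "Has pushouts along regular monomorphisms" means that such a pushout exists for all such $m,f$. The pushout square $gm=nf$ is van Kampen if for every commutative cube having this square as bottom face, with top face $g'm'=n'f'$ ($m'\colon C'\to A'$, $f'\colon C'\to B'$, $g'\colon A'\to D'$, $n'\colon B'\to D'$) and vertical maps $a\colon A'\to A$, $b\colon B'\to B$, $c\colon C'\to C$, $d\colon D'\to D$, such that the left face ($am'=mc$) and back face ($bf'=fc$) are pullbacks, the following holds: the top face is a pushout if and only if the front face ($dg'=ga$) and right face ($dn'=nb$) are pullbacks. A category with pullbacks is rm-adhesive if it has pushouts along regular monomorphisms and these are van Kampen. *)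

theory Defs
  imports Main "HOL-Library.Equipollence"
begin

text \<open>
  No HOL type can be proved to be closed under power sets and to contain an infinite set, so none can
  be proved to carry the (large) category of sets, or a topos of sheaves over an arbitrary small
  category.  The ambient set theory is therefore made explicit: \<open>elts\<close> sends a code to the set
  of codes it stands for, and the sets of the universe are the members of \<open>range elts\<close>.  Neither
  infinity nor foundation is required; a set theory satisfying these is a special case.
\<close>

locale set_universe =
  fixes elts :: "'u \<Rightarrow> 'u set"
  assumes extensionality: "inj elts"
    and subset_closed: "X \<subseteq> elts u \<Longrightarrow> X \<in> range elts"
    and replacement: "F ` elts u \<in> range elts"
    and union_closed: "(\<Union>x\<in>elts u. elts x) \<in> range elts"
    and power_closed: "{x. elts x \<subseteq> elts u} \<in> range elts"

definition small :: "('u \<Rightarrow> 'u set) \<Rightarrow> 'x set \<Rightarrow> bool" where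
  "small elts X \<longleftrightarrow> (\<exists>u. X \<approx> elts u)"


section \<open>Categories\<close>

text \<open>\<open>Comp C g f\<close>, written \<open>g \<cdot>\<^bsub>C\<^esub> f\<close>, is ``\<open>g\<close> after \<open>f\<close>''; its value is
  unspecified when \<open>Cod C f \<noteq> Dom C g\<close>.\<close>

record ('o, 'a) cat =
  Obj :: "'o set"
  Arr :: "'a set"
  Dom :: "'a \<Rightarrow> 'o"
  Cod :: "'a \<Rightarrow> 'o"
  Id :: "'o \<Rightarrow> 'a"
  Comp :: "'a \<Rightarrow> 'a \<Rightarrow> 'a" (infixr "\<cdot>\<index>" 70)

definition Hom :: "('o, 'a) cat \<Rightarrow> 'o \<Rightarrow> 'o \<Rightarrow> 'a set" where
  "Hom C A B = {f \<in> Arr C. Dom C f = A \<and> Cod C f = B}"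

locale category =
  fixes C :: "('o, 'a) cat" (structure)
  assumes Dom_Obj: "f \<in> Arr C \<Longrightarrow> Dom C f \<in> Obj C"
    and Cod_Obj: "f \<in> Arr C \<Longrightarrow> Cod C f \<in> Obj C"
    and Id_Hom: "A \<in> Obj C \<Longrightarrow> Id C A \<in> Hom C A A"
    and Comp_Hom: "f \<in> Hom C A B \<Longrightarrow> g \<in> Hom C B D \<Longrightarrow> g \<cdot> f \<in> Hom C A D"
    and Id_left: "f \<in> Hom C A B \<Longrightarrow> Id C B \<cdot> f = f"
    and Id_right: "f \<in> Hom C A B \<Longrightarrow> f \<cdot> Id C A = f"
    and Comp_assoc: "f \<in> Hom C A B \<Longrightarrow> g \<in> Hom C B D \<Longrightarrow> h \<in> Hom C D E \<Longrightarrow>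
          (h \<cdot> g) \<cdot> f = h \<cdot> (g \<cdot> f)"

definition small_category :: "('u \<Rightarrow> 'u set) \<Rightarrow> ('o, 'a) cat \<Rightarrow> bool" where
  "small_category elts C \<longleftrightarrow> category C \<and> small elts (Obj C) \<and> small elts (Arr C)"


section \<open>Limits and colimits\<close>

text \<open>
  A square \<open>g \<cdot> m = n \<cdot> f\<close> is always given by its four sides in the order \<open>m f g n\<close>: first the
  two arrows out of the initial corner, then the two arrows into the final corner.
\<close>

definition comm_square :: "('o, 'a) cat \<Rightarrow> 'a \<Rightarrow> 'a \<Rightarrow> 'a \<Rightarrow> 'a \<Rightarrow> bool" where
  "comm_square C m f g n \<longleftrightarrow>
     m \<in> Arr C \<and> f \<in> Arr C \<and> g \<in> Arr C \<and> n \<in> Arr C \<and>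
     Dom C m = Dom C f \<and> Cod C m = Dom C g \<and> Cod C f = Dom C n \<and> Cod C g = Cod C n \<and>
     g \<cdot>\<^bsub>C\<^esub> m = n \<cdot>\<^bsub>C\<^esub> f"

definition is_pullback :: "('o, 'a) cat \<Rightarrow> 'a \<Rightarrow> 'a \<Rightarrow> 'a \<Rightarrow> 'a \<Rightarrow> bool" where
  "is_pullback C m f g n \<longleftrightarrow> comm_square C m f g n \<and>
     (\<forall>x y. comm_square C x y g n \<longrightarrow>
        (\<exists>!k. k \<in> Hom C (Dom C x) (Dom C m) \<and> m \<cdot>\<^bsub>C\<^esub> k = x \<and> f \<cdot>\<^bsub>C\<^esub> k = y))"

definition is_pushout :: "('o, 'a) cat \<Rightarrow> 'a \<Rightarrow> 'a \<Rightarrow> 'a \<Rightarrow> 'a \<Rightarrow> bool" where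
  "is_pushout C m f g n \<longleftrightarrow> comm_square C m f g n \<and>
     (\<forall>x y. comm_square C m f x y \<longrightarrow>
        (\<exists>!k. k \<in> Hom C (Cod C g) (Cod C x) \<and> k \<cdot>\<^bsub>C\<^esub> g = x \<and> k \<cdot>\<^bsub>C\<^esub> n = y))"

definition is_equalizer :: "('o, 'a) cat \<Rightarrow> 'a \<Rightarrow> 'a \<Rightarrow> 'a \<Rightarrow> bool" where
  "is_equalizer C u v m \<longleftrightarrow>
     u \<in> Arr C \<and> v \<in> Hom C (Dom C u) (Cod C u) \<and> m \<in> Arr C \<and> Cod C m = Dom C u \<and>
     u \<cdot>\<^bsub>C\<^esub> m = v \<cdot>\<^bsub>C\<^esub> m \<and>
     (\<forall>h \<in> Arr C. Cod C h = Dom C u \<and> u \<cdot>\<^bsub>C\<^esub> h = v \<cdot>\<^bsub>C\<^esub> h \<longrightarrow>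
        (\<exists>!k. k \<in> Hom C (Dom C h) (Dom C m) \<and> m \<cdot>\<^bsub>C\<^esub> k = h))"

definition mono_arrow :: "('o, 'a) cat \<Rightarrow> 'a \<Rightarrow> bool" where
  "mono_arrow C m \<longleftrightarrow> m \<in> Arr C \<and>
     (\<forall>X. \<forall>h \<in> Hom C X (Dom C m). \<forall>k \<in> Hom C X (Dom C m). m \<cdot>\<^bsub>C\<^esub> h = m \<cdot>\<^bsub>C\<^esub> k \<longrightarrow> h = k)"

definition regular_mono :: "('o, 'a) cat \<Rightarrow> 'a \<Rightarrow> bool" where
  "regular_mono C m \<longleftrightarrow> (\<exists>u v. is_equalizer C u v m)"

definition has_pullbacks :: "('o, 'a) cat \<Rightarrow> bool" where
  "has_pullbacks C \<longleftrightarrow>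
     (\<forall>g \<in> Arr C. \<forall>n \<in> Arr C. Cod C g = Cod C n \<longrightarrow> (\<exists>m f. is_pullback C m f g n))"

definition has_rm_pushouts :: "('o, 'a) cat \<Rightarrow> bool" where
  "has_rm_pushouts C \<longleftrightarrow>
     (\<forall>m f. regular_mono C m \<and> f \<in> Arr C \<and> Dom C f = Dom C m \<longrightarrow> (\<exists>g n. is_pushout C m f g n))"


section \<open>Rm-adhesive categories\<close>

definition van_kampen :: "('o, 'a) cat \<Rightarrow> 'a \<Rightarrow> 'a \<Rightarrow> 'a \<Rightarrow> 'a \<Rightarrow> bool" where
  "van_kampen C m f g n \<longleftrightarrow>
     (\<forall>m' f' g' n' a b c d.
        comm_square C m' f' g' n' \<and>
        comm_square C m' c a m \<and> comm_square C f' c b f \<and>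
        comm_square C g' a d g \<and> comm_square C n' b d n \<and>
        is_pullback C m' c a m \<and> is_pullback C f' c b f \<longrightarrow>
        (is_pushout C m' f' g' n' \<longleftrightarrow> is_pullback C g' a d g \<and> is_pullback C n' b d n))"

definition rm_adhesive :: "('o, 'a) cat \<Rightarrow> bool" where
  "rm_adhesive C \<longleftrightarrow> category C \<and> has_pullbacks C \<and> has_rm_pushouts C \<and>
     (\<forall>m f g n. regular_mono C m \<and> is_pushout C m f g n \<longrightarrow> van_kampen C m f g n)"


section \<open>Elementary toposes\<close>

definition is_terminal :: "('o, 'a) cat \<Rightarrow> 'o \<Rightarrow> bool" where
  "is_terminal C T \<longleftrightarrow> T \<in> Obj C \<and> (\<forall>X \<in> Obj C. \<exists>!k. k \<in> Hom C X T)"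

definition is_product :: "('o, 'a) cat \<Rightarrow> 'o \<Rightarrow> 'o \<Rightarrow> 'o \<Rightarrow> 'a \<Rightarrow> 'a \<Rightarrow> bool" where
  "is_product C A B P p q \<longleftrightarrow> p \<in> Hom C P A \<and> q \<in> Hom C P B \<and>
     (\<forall>X. \<forall>x \<in> Hom C X A. \<forall>y \<in> Hom C X B.
        \<exists>!k. k \<in> Hom C X P \<and> p \<cdot>\<^bsub>C\<^esub> k = x \<and> q \<cdot>\<^bsub>C\<^esub> k = y)"

text \<open>
  \<open>E\<close> is an exponential of \<open>B\<close> by \<open>A\<close>, with evaluation \<open>ev\<close> defined on the product \<open>P\<close> of \<open>E\<close> and
  \<open>A\<close>.  Below, \<open>l\<close> is the arrow \<open>k \<times> A\<close> from the product \<open>Q\<close> of \<open>X\<close> and \<open>A\<close> to \<open>P\<close>.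
\<close>

definition is_exponential ::
    "('o, 'a) cat \<Rightarrow> 'o \<Rightarrow> 'o \<Rightarrow> 'o \<Rightarrow> 'o \<Rightarrow> 'a \<Rightarrow> 'a \<Rightarrow> 'a \<Rightarrow> bool" where
  "is_exponential C A B E P p q ev \<longleftrightarrow> is_product C E A P p q \<and> ev \<in> Hom C P B \<and>
     (\<forall>X Q r s h. is_product C X A Q r s \<and> h \<in> Hom C Q B \<longrightarrow>
        (\<exists>!k. k \<in> Hom C X E \<and>
           (\<exists>l. l \<in> Hom C Q P \<and> p \<cdot>\<^bsub>C\<^esub> l = k \<cdot>\<^bsub>C\<^esub> r \<and> q \<cdot>\<^bsub>C\<^esub> l = s \<and> ev \<cdot>\<^bsub>C\<^esub> l = h)))"

definition is_subobject_classifier :: "('o, 'a) cat \<Rightarrow> 'a \<Rightarrow> bool" where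
  "is_subobject_classifier C t \<longleftrightarrow> t \<in> Arr C \<and> is_terminal C (Dom C t) \<and>
     (\<forall>m. mono_arrow C m \<longrightarrow> (\<exists>!\<chi>. \<exists>k. is_pullback C m k \<chi> t))"

text \<open>Finite limits are given by a terminal object, binary products and pullbacks.\<close>

definition topos :: "('o, 'a) cat \<Rightarrow> bool" where
  "topos C \<longleftrightarrow> category C \<and>
     (\<exists>T. is_terminal C T) \<and>
     (\<forall>A \<in> Obj C. \<forall>B \<in> Obj C. \<exists>P p q. is_product C A B P p q) \<and>
     has_pullbacks C \<and>
     (\<forall>A \<in> Obj C. \<forall>B \<in> Obj C. \<exists>E P p q ev. is_exponential C A B E P p q ev) \<and>
     (\<exists>t. is_subobject_classifier C t)"


section \<open>Functors\<close>

definition is_functor ::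
    "('o, 'a) cat \<Rightarrow> ('p, 'b) cat \<Rightarrow> ('o \<Rightarrow> 'p) \<Rightarrow> ('a \<Rightarrow> 'b) \<Rightarrow> bool" where
  "is_functor C D Fo Fa \<longleftrightarrow> category C \<and> category D \<and>
     (\<forall>A \<in> Obj C. Fo A \<in> Obj D) \<and>
     (\<forall>f \<in> Arr C. Fa f \<in> Hom D (Fo (Dom C f)) (Fo (Cod C f))) \<and>
     (\<forall>A \<in> Obj C. Fa (Id C A) = Id D (Fo A)) \<and>
     (\<forall>f \<in> Arr C. \<forall>g \<in> Arr C. Cod C f = Dom C g \<longrightarrow> Fa (g \<cdot>\<^bsub>C\<^esub> f) = Fa g \<cdot>\<^bsub>D\<^esub> Fa f)"

definition full_embedding ::
    "('o, 'a) cat \<Rightarrow> ('p, 'b) cat \<Rightarrow> ('o \<Rightarrow> 'p) \<Rightarrow> ('a \<Rightarrow> 'b) \<Rightarrow> bool" where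
  "full_embedding C D Fo Fa \<longleftrightarrow> is_functor C D Fo Fa \<and> inj_on Fo (Obj C) \<and>
     (\<forall>A \<in> Obj C. \<forall>B \<in> Obj C. bij_betw Fa (Hom C A B) (Hom D (Fo A) (Fo B)))"

definition preserves_pullbacks ::
    "('o, 'a) cat \<Rightarrow> ('p, 'b) cat \<Rightarrow> ('a \<Rightarrow> 'b) \<Rightarrow> bool" where
  "preserves_pullbacks C D Fa \<longleftrightarrow>
     (\<forall>m f g n. is_pullback C m f g n \<longrightarrow> is_pullback D (Fa m) (Fa f) (Fa g) (Fa n))"

definition preserves_rm_pushouts ::
    "('o, 'a) cat \<Rightarrow> ('p, 'b) cat \<Rightarrow> ('a \<Rightarrow> 'b) \<Rightarrow> bool" where
  "preserves_rm_pushouts C D Fa \<longleftrightarrow>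
     (\<forall>m f g n. regular_mono C m \<and> is_pushout C m f g n \<longrightarrow>
        is_pushout D (Fa m) (Fa f) (Fa g) (Fa n))"

end

theory Submission
  imports Defs
begin

text \<open>
  A small rm-adhesive category embeds into the topos of those presheaves \<open>F\<close> that send every pushout
  along a regular monomorphism to a pullback.  The van Kampen property makes these pushouts stable
  under pullback, and such sheaves are then closed under finite limits and exponentials; representables
  are sheaves because the squares are pushouts, and the squares stay pushouts among sheaves by the
  Yoneda lemma.  The subobject classifier consists of the sieves that contain an arrow \<open>h\<close> as soon as
  they contain its restrictions along both legs of such a square.  Here stability is not enough: the
  kernel pair of a leg must itself be covered, and it is, being again a pushout along a regular
  monomorphism.

  Conversely, the van Kampen property is inherited along full embeddings, so it suffices to prove it
  for pushouts along monomorphisms in a topos.  Maps into power objects show that relations with a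
  fixed object can be glued uniquely along a pushout; stability, and the fact that the square is a
  pullback, follow by gluing suitable graphs.
\<close>

section \<open>Pullbacks and pushouts\<close>

text \<open>The squares are not closed up into a Grothendieck topology and no sheafification is
  formed: a sheaf is handled through the two legs of a square, and gluing asks only for agreement
  over the initial corner. For sieves this agreement is too weak a datum. A sieve on the domain of
  \<open>g\<close> may contain \<open>u\<close> and miss \<open>v\<close> although
  \<open>g \<cdot> u = g \<cdot> v\<close>, and such a sieve is not a restriction along
  \<open>g\<close>. A cover of the kernel pair of \<open>g\<close> on which \<open>u\<close> and
  \<open>v\<close> are either equal or come from the corner is exactly what excludes this. In the
  topos, stability of pushouts is commonly derived from right adjoints to pullback between slices.
  Relations replace the slices: arrows from \<open>A\<close> to the power object of \<open>W\<close>
  are the relations from \<open>A\<close> to \<open>W\<close>, so the universal property of a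
  pushout is itself a statement about gluing relations, and everything else is checked on
  generalised elements. Regularity of the mono is a matter of \<open>C\<close> only: it provides the
  pushouts and passes to the top face of a cube by pullback, whereas in the topos all monos are
  treated alike.\<close>

context category
begin

lemma comp_simps [simp]:
  assumes "f \<in> Arr C" "g \<in> Arr C" "Cod C f = Dom C g"
  shows "g \<cdot> f \<in> Arr C" "Dom C (g \<cdot> f) = Dom C f" "Cod C (g \<cdot> f) = Cod C g"
  using Comp_Hom[of f "Dom C f" "Cod C f" g "Cod C g"] assms by (auto simp: Hom_def)

lemma assoc [simp]:
  assumes "f \<in> Arr C" "g \<in> Arr C" "h \<in> Arr C" "Cod C f = Dom C g" "Cod C g = Dom C h"
  shows "(h \<cdot> g) \<cdot> f = h \<cdot> (g \<cdot> f)"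
  using Comp_assoc[of f _ _ g _ h] assms by (auto simp: Hom_def)

lemma Id_simps [simp]:
  assumes "A \<in> Obj C"
  shows "Id C A \<in> Arr C" "Dom C (Id C A) = A" "Cod C (Id C A) = A"
  using Id_Hom[OF assms] by (auto simp: Hom_def)

lemma Dom_in_Obj [simp]: "f \<in> Arr C \<Longrightarrow> Dom C f \<in> Obj C"
  and Cod_in_Obj [simp]: "f \<in> Arr C \<Longrightarrow> Cod C f \<in> Obj C"
  by (simp_all add: Dom_Obj Cod_Obj)

lemma Id_comp [simp]: "f \<in> Arr C \<Longrightarrow> Cod C f = A \<Longrightarrow> Id C A \<cdot> f = f"
  and comp_Id [simp]: "f \<in> Arr C \<Longrightarrow> Dom C f = A \<Longrightarrow> f \<cdot> Id C A = f"
  using Id_left Id_right by (auto simp: Hom_def)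

text \<open>Composites are normalised to the right by \<open>assoc\<close>, so an equation for
  \<open>u \<cdot> v\<close> no longer matches inside \<open>u \<cdot> (v \<cdot> x)\<close>. This
  supplies the extended equation; \<open>comm_square_ext\<close> does the same for a commuting
  square.\<close>

lemma comp_eq_comp:
  assumes "u \<cdot> v = w" "u \<in> Arr C" "v \<in> Arr C" "Cod C v = Dom C u" "x \<in> Arr C" "Cod C x = Dom C v"
  shows "u \<cdot> (v \<cdot> x) = w \<cdot> x"
  using assms assoc by metis

lemma comm_squareD:
  assumes "comm_square C m f g n"
  shows "m \<in> Arr C" "f \<in> Arr C" "g \<in> Arr C" "n \<in> Arr C"
    "Dom C f = Dom C m" "Cod C m = Dom C g" "Cod C f = Dom C n" "Cod C n = Cod C g"
    "g \<cdot> m = n \<cdot> f"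
  using assms by (auto simp: comm_square_def)

lemma comm_square_ext:
  assumes "comm_square C m f g n" "x \<in> Arr C" "Cod C x = Dom C m"
  shows "g \<cdot> (m \<cdot> x) = n \<cdot> (f \<cdot> x)"
  using assms(2,3) comm_squareD[OF assms(1)] assoc[of x m g] assoc[of x f n] by simp

lemma comm_square_swap: "comm_square C m f g n \<Longrightarrow> comm_square C f m n g"
  by (auto simp: comm_square_def)

lemma monoI:
  assumes "m \<in> Arr C"
    and "\<And>h k. h \<in> Arr C \<Longrightarrow> k \<in> Arr C \<Longrightarrow> Dom C h = Dom C k \<Longrightarrow> Cod C h = Dom C m \<Longrightarrow>
      Cod C k = Dom C m \<Longrightarrow> m \<cdot> h = m \<cdot> k \<Longrightarrow> h = k"
  shows "mono_arrow C m"
  using assms by (auto simp: mono_arrow_def Hom_def)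

lemma monoD:
  assumes "mono_arrow C m" "m \<cdot> h = m \<cdot> k" "h \<in> Arr C" "k \<in> Arr C" "Dom C h = Dom C k"
    "Cod C h = Dom C m" "Cod C k = Dom C m"
  shows "h = k"
  using assms by (auto simp: mono_arrow_def Hom_def)

lemma mono_arr [simp]: "mono_arrow C m \<Longrightarrow> m \<in> Arr C"
  by (simp add: mono_arrow_def)

lemma pullback_square: "is_pullback C m f g n \<Longrightarrow> comm_square C m f g n"
  by (simp add: is_pullback_def)

lemma pullback_factor:
  assumes "is_pullback C m f g n" "comm_square C x y g n"
  obtains k where "k \<in> Arr C" "Dom C k = Dom C x" "Cod C k = Dom C m" "m \<cdot> k = x" "f \<cdot> k = y"
  using assms unfolding is_pullback_def Hom_def by blast

lemma pullback_eq:
  assumes p: "is_pullback C m f g n" and "m \<cdot> h = m \<cdot> k" "f \<cdot> h = f \<cdot> k" and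
    a: "h \<in> Arr C" "k \<in> Arr C" "Dom C h = Dom C k" "Cod C h = Dom C m" "Cod C k = Dom C m"
  shows "h = k"
proof -
  note s = comm_squareD[OF pullback_square[OF p]]
  have "comm_square C (m \<cdot> k) (f \<cdot> k) g n"
    unfolding comm_square_def using s a comm_square_ext[OF pullback_square[OF p], of k] by simp
  then have "\<exists>!l. l \<in> Hom C (Dom C (m \<cdot> k)) (Dom C m) \<and> m \<cdot> l = m \<cdot> k \<and> f \<cdot> l = f \<cdot> k"
    using p unfolding is_pullback_def by blast
  moreover have "Dom C (m \<cdot> k) = Dom C k" using s a by simp
  ultimately show ?thesis using assms unfolding Hom_def by auto
qed

lemma pullbackI:
  assumes s: "comm_square C m f g n"
    and ex: "\<And>x y. comm_square C x y g n \<Longrightarrow>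
      \<exists>k. k \<in> Arr C \<and> Dom C k = Dom C x \<and> Cod C k = Dom C m \<and> m \<cdot> k = x \<and> f \<cdot> k = y"
    and un: "\<And>h k. h \<in> Arr C \<Longrightarrow> k \<in> Arr C \<Longrightarrow> Dom C h = Dom C k \<Longrightarrow> Cod C h = Dom C m \<Longrightarrow>
      Cod C k = Dom C m \<Longrightarrow> m \<cdot> h = m \<cdot> k \<Longrightarrow> f \<cdot> h = f \<cdot> k \<Longrightarrow> h = k"
  shows "is_pullback C m f g n"
  unfolding is_pullback_def
proof (intro conjI allI impI)
  fix x y assume "comm_square C x y g n"
  from ex[OF this] obtain k where k: "k \<in> Arr C" "Dom C k = Dom C x" "Cod C k = Dom C m"
    "m \<cdot> k = x" "f \<cdot> k = y" by blast
  show "\<exists>!k. k \<in> Hom C (Dom C x) (Dom C m) \<and> m \<cdot> k = x \<and> f \<cdot> k = y"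
    by (rule ex1I[of _ k]) (use k un in \<open>auto simp: Hom_def\<close>)
qed (fact s)

lemma pullback_swap:
  assumes p: "is_pullback C m f g n"
  shows "is_pullback C f m n g"
proof (rule pullbackI)
  note s = comm_squareD[OF pullback_square[OF p]]
  show "comm_square C f m n g" using comm_square_swap[OF pullback_square[OF p]] .
  show "\<exists>k. k \<in> Arr C \<and> Dom C k = Dom C x \<and> Cod C k = Dom C f \<and> f \<cdot> k = x \<and> m \<cdot> k = y"
    if xy: "comm_square C x y n g" for x y
  proof -
    obtain k where "k \<in> Arr C" "Dom C k = Dom C y" "Cod C k = Dom C m" "m \<cdot> k = y" "f \<cdot> k = x"
      by (rule pullback_factor[OF p comm_square_swap[OF xy]])
    then show ?thesis using s(5) comm_squareD(5)[OF xy] by auto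
  qed
  show "h = k" if "h \<in> Arr C" "k \<in> Arr C" "Dom C h = Dom C k" "Cod C h = Dom C f"
      "Cod C k = Dom C f" "f \<cdot> h = f \<cdot> k" "m \<cdot> h = m \<cdot> k" for h k
    by (rule pullback_eq[OF p that(7,6)]) (use that s in simp_all)
qed

lemma pullback_paste:
  assumes l: "is_pullback C m' c a m" and r: "is_pullback C g' a d g"
  shows "is_pullback C (g' \<cdot> m') c d (g \<cdot> m)"
proof (rule pullbackI)
  note L = pullback_square[OF l] and R = pullback_square[OF r]
  note [simp] = comm_squareD(1-8)[OF L] comm_squareD(1-8)[OF R]
  have m [simp]: "Cod C g' = Dom C d" "Cod C m = Dom C g" "Cod C m' = Dom C g'"
    using comm_squareD[OF L] comm_squareD[OF R] by auto
  show sq: "comm_square C (g' \<cdot> m') c d (g \<cdot> m)"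
    unfolding comm_square_def
    using comm_squareD(9)[OF L] comm_square_ext[OF R, of m'] by simp
  show "\<exists>k. k \<in> Arr C \<and> Dom C k = Dom C x \<and> Cod C k = Dom C (g' \<cdot> m') \<and> (g' \<cdot> m') \<cdot> k = x \<and> c \<cdot> k = y"
    if xy: "comm_square C x y d (g \<cdot> m)" for x y
  proof -
    note [simp] = comm_squareD(1-8)[OF xy]
    have "Cod C y = Dom C m" using comm_squareD(7)[OF xy] by simp
    note [simp] = this
    have "comm_square C x (m \<cdot> y) d g"
      unfolding comm_square_def using comm_squareD(9)[OF xy] by simp
    then obtain k where k: "k \<in> Arr C" "Dom C k = Dom C x" "Cod C k = Dom C g'" "g' \<cdot> k = x" "a \<cdot> k = m \<cdot> y"
      by (rule pullback_factor[OF r])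
    have "comm_square C k y a m" unfolding comm_square_def using k by simp
    then obtain l where l: "l \<in> Arr C" "Dom C l = Dom C k" "Cod C l = Dom C m'" "m' \<cdot> l = k" "c \<cdot> l = y"
      by (rule pullback_factor[OF l])
    show ?thesis by (rule exI[of _ l]) (use k l in simp)
  qed
  show "h = k" if h: "h \<in> Arr C" "k \<in> Arr C" "Dom C h = Dom C k" "Cod C h = Dom C (g' \<cdot> m')"
      "Cod C k = Dom C (g' \<cdot> m')" "(g' \<cdot> m') \<cdot> h = (g' \<cdot> m') \<cdot> k" "c \<cdot> h = c \<cdot> k" for h k
  proof -
    have [simp]: "Cod C h = Dom C m'" "Cod C k = Dom C m'" using h by auto
    have "m' \<cdot> h = m' \<cdot> k"
    proof (rule pullback_eq[OF r])
      show "g' \<cdot> (m' \<cdot> h) = g' \<cdot> (m' \<cdot> k)" using h by simp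
      show "a \<cdot> (m' \<cdot> h) = a \<cdot> (m' \<cdot> k)"
        using h comm_square_ext[OF L, of h] comm_square_ext[OF L, of k] by simp
    qed (use h in simp_all)
    then show ?thesis by (rule pullback_eq[OF l]) (use h in simp_all)
  qed
qed

lemma pullback_cancel:
  assumes o: "is_pullback C (g' \<cdot> m') c d (g \<cdot> m)" and r: "is_pullback C g' a d g"
    and L: "comm_square C m' c a m"
  shows "is_pullback C m' c a m"
proof (rule pullbackI[OF L])
  note R = pullback_square[OF r]
  note [simp] = comm_squareD(1-8)[OF L] comm_squareD(1-8)[OF R]
  have m [simp]: "Cod C g' = Dom C d" "Cod C m = Dom C g" "Cod C m' = Dom C g'"
    using comm_squareD[OF L] comm_squareD[OF R] by auto
  show "\<exists>k. k \<in> Arr C \<and> Dom C k = Dom C x \<and> Cod C k = Dom C m' \<and> m' \<cdot> k = x \<and> c \<cdot> k = y"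
    if xy: "comm_square C x y a m" for x y
  proof -
    note [simp] = comm_squareD(1-8)[OF xy]
    have [simp]: "Cod C x = Dom C g'" using comm_squareD(6)[OF xy] comm_squareD(6)[OF R] by simp
    have "comm_square C (g' \<cdot> x) y d (g \<cdot> m)"
      unfolding comm_square_def using comm_squareD(9)[OF xy] comm_square_ext[OF R, of x] by simp
    then obtain k where k: "k \<in> Arr C" "Dom C k = Dom C (g' \<cdot> x)" "Cod C k = Dom C (g' \<cdot> m')"
      "(g' \<cdot> m') \<cdot> k = g' \<cdot> x" "c \<cdot> k = y"
      by (rule pullback_factor[OF o])
    have [simp]: "Cod C k = Dom C m'" "Dom C k = Dom C x" using k by auto
    have "m' \<cdot> k = x"
    proof (rule pullback_eq[OF r])
      show "g' \<cdot> (m' \<cdot> k) = g' \<cdot> x" using k by simp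
      show "a \<cdot> (m' \<cdot> k) = a \<cdot> x"
        using k comm_square_ext[OF L, of k] comm_squareD(9)[OF xy] by simp
    qed (use k in simp_all)
    then show ?thesis by (intro exI[of _ k]) (use k in simp)
  qed
  show "h = k" if h: "h \<in> Arr C" "k \<in> Arr C" "Dom C h = Dom C k" "Cod C h = Dom C m'"
      "Cod C k = Dom C m'" "m' \<cdot> h = m' \<cdot> k" "c \<cdot> h = c \<cdot> k" for h k
    by (rule pullback_eq[OF o]) (use h in simp_all)
qed

lemma pullback_mono:
  assumes p: "is_pullback C m' c a m" and m: "mono_arrow C m"
  shows "mono_arrow C m'"
proof (rule monoI)
  note S = pullback_square[OF p]
  note [simp] = comm_squareD(1-8)[OF S]
  have [simp]: "Cod C c = Dom C m" "Cod C m' = Dom C a" using comm_squareD[OF S] by auto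
  show "m' \<in> Arr C" by simp
  fix h k assume h [simp]: "h \<in> Arr C" "k \<in> Arr C" "Dom C h = Dom C k" "Cod C h = Dom C m'"
      "Cod C k = Dom C m'" and e: "m' \<cdot> h = m' \<cdot> k"
  have "c \<cdot> h = c \<cdot> k"
    by (rule monoD[OF m])
      (use comm_square_ext[OF S, of h] comm_square_ext[OF S, of k] e in simp_all)
  then show "h = k" by (intro pullback_eq[OF p e]) simp_all
qed

lemma regular_mono_mono:
  assumes "regular_mono C m" shows "mono_arrow C m"
proof -
  obtain u v where e: "is_equalizer C u v m" using assms by (auto simp: regular_mono_def)
  have a: "m \<in> Arr C" "u \<in> Arr C" "v \<in> Arr C" "Dom C v = Dom C u" "Cod C v = Cod C u" "Cod C m = Dom C u"
    "u \<cdot> m = v \<cdot> m"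
    and un: "\<And>h. h \<in> Arr C \<Longrightarrow> Cod C h = Dom C u \<Longrightarrow> u \<cdot> h = v \<cdot> h \<Longrightarrow>
        \<exists>!k. k \<in> Hom C (Dom C h) (Dom C m) \<and> m \<cdot> k = h"
    using e by (auto simp: is_equalizer_def Hom_def)
  show ?thesis
  proof (rule monoI)
    fix h k assume h: "h \<in> Arr C" "k \<in> Arr C" "Dom C h = Dom C k" "Cod C h = Dom C m"
      "Cod C k = Dom C m" "m \<cdot> h = m \<cdot> k"
    have "u \<cdot> (m \<cdot> k) = v \<cdot> (m \<cdot> k)" using a h comp_eq_comp[of u m "v \<cdot> m" k] by simp
    then have "\<exists>!l. l \<in> Hom C (Dom C (m \<cdot> k)) (Dom C m) \<and> m \<cdot> l = m \<cdot> k"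
      using a h by (intro un) simp_all
    then show "h = k" using a h by (auto simp: Hom_def)
  qed (use a in simp)
qed

text \<open>If \<open>m\<close> equalizes \<open>u\<close> and \<open>v\<close>, then its pullback
  along \<open>a\<close> equalizes \<open>u \<cdot> a\<close> and
  \<open>v \<cdot> a\<close>.\<close>

lemma pullback_regular_mono:
  assumes p: "is_pullback C m' c a m" and m: "regular_mono C m"
  shows "regular_mono C m'"
proof -
  obtain u v where e: "is_equalizer C u v m" using m by (auto simp: regular_mono_def)
  have [simp]: "m \<in> Arr C" "u \<in> Arr C" "v \<in> Arr C" "Dom C v = Dom C u" "Cod C v = Cod C u" "Cod C m = Dom C u"
    and uv: "u \<cdot> m = v \<cdot> m"
    and un: "\<And>h. h \<in> Arr C \<Longrightarrow> Cod C h = Dom C u \<Longrightarrow> u \<cdot> h = v \<cdot> h \<Longrightarrow>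
        \<exists>!k. k \<in> Hom C (Dom C h) (Dom C m) \<and> m \<cdot> k = h"
    using e by (auto simp: is_equalizer_def Hom_def)
  note S = pullback_square[OF p]
  have [simp]: "m' \<in> Arr C" "c \<in> Arr C" "a \<in> Arr C" "Cod C c = Dom C m" "Cod C m' = Dom C a"
    "Dom C c = Dom C m'" "Cod C a = Dom C u"
    using comm_squareD[OF S] by auto
  have eq: "a \<cdot> m' = m \<cdot> c" using comm_squareD[OF S] by simp
  have "is_equalizer C (u \<cdot> a) (v \<cdot> a) m'"
    unfolding is_equalizer_def Hom_def
  proof (intro conjI ballI impI)
    show "(u \<cdot> a) \<cdot> m' = (v \<cdot> a) \<cdot> m'"
      using eq uv comp_eq_comp[of u m "v \<cdot> m" c] by simp
    fix h assume h [simp]: "h \<in> Arr C" and hh: "Cod C h = Dom C (u \<cdot> a) \<and> (u \<cdot> a) \<cdot> h = (v \<cdot> a) \<cdot> h"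
    have [simp]: "Cod C h = Dom C a" using hh by simp
    have "u \<cdot> (a \<cdot> h) = v \<cdot> (a \<cdot> h)" using hh by simp
    then have "\<exists>!k. k \<in> Hom C (Dom C (a \<cdot> h)) (Dom C m) \<and> m \<cdot> k = a \<cdot> h"
      by (intro un) simp_all
    then obtain k where k: "k \<in> Arr C" "Dom C k = Dom C h" "Cod C k = Dom C m" "m \<cdot> k = a \<cdot> h"
      by (auto simp: Hom_def)
    have "comm_square C h k a m" unfolding comm_square_def using k by simp
    then obtain l where l: "l \<in> Arr C" "Dom C l = Dom C h" "Cod C l = Dom C m'" "m' \<cdot> l = h"
      by (rule pullback_factor[OF p])
    have mm: "mono_arrow C m'" using pullback_mono[OF p regular_mono_mono[OF m]] .
    show "\<exists>!k. k \<in> {f \<in> Arr C. Dom C f = Dom C h \<and> Cod C f = Dom C m'} \<and> m' \<cdot> k = h"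
    proof (rule ex1I[of _ l])
      fix k assume k: "k \<in> {f \<in> Arr C. Dom C f = Dom C h \<and> Cod C f = Dom C m'} \<and> m' \<cdot> k = h"
      show "k = l" by (rule monoD[OF mm]) (use k l in simp_all)
    qed (use l in simp)
  qed simp_all
  then show ?thesis by (auto simp: regular_mono_def)
qed

section \<open>Pushouts, dual to the preceding facts\<close>

lemma pushout_square: "is_pushout C m f g n \<Longrightarrow> comm_square C m f g n"
  by (simp add: is_pushout_def)

lemma pushout_factor:
  assumes "is_pushout C m f g n" "comm_square C m f x y"
  obtains k where "k \<in> Arr C" "Dom C k = Cod C g" "Cod C k = Cod C x" "k \<cdot> g = x" "k \<cdot> n = y"
  using assms unfolding is_pushout_def Hom_def by blast

lemma pushout_eq:
  assumes p: "is_pushout C m f g n" and "h \<cdot> g = k \<cdot> g" "h \<cdot> n = k \<cdot> n" and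
    a: "h \<in> Arr C" "k \<in> Arr C" "Cod C h = Cod C k" "Dom C h = Cod C g" "Dom C k = Cod C g"
  shows "h = k"
proof -
  note s = comm_squareD[OF pushout_square[OF p]]
  have "comm_square C m f (k \<cdot> g) (k \<cdot> n)"
    unfolding comm_square_def using s a by simp
  then have "\<exists>!l. l \<in> Hom C (Cod C g) (Cod C (k \<cdot> g)) \<and> l \<cdot> g = k \<cdot> g \<and> l \<cdot> n = k \<cdot> n"
    using p unfolding is_pushout_def by blast
  moreover have "Cod C (k \<cdot> g) = Cod C k" using s a by simp
  ultimately show ?thesis using assms unfolding Hom_def by auto
qed

lemma pushoutI:
  assumes s: "comm_square C m f g n"
    and ex: "\<And>x y. comm_square C m f x y \<Longrightarrow>
      \<exists>k. k \<in> Arr C \<and> Dom C k = Cod C g \<and> Cod C k = Cod C x \<and> k \<cdot> g = x \<and> k \<cdot> n = y"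
    and un: "\<And>h k. h \<in> Arr C \<Longrightarrow> k \<in> Arr C \<Longrightarrow> Cod C h = Cod C k \<Longrightarrow> Dom C h = Cod C g \<Longrightarrow>
      Dom C k = Cod C g \<Longrightarrow> h \<cdot> g = k \<cdot> g \<Longrightarrow> h \<cdot> n = k \<cdot> n \<Longrightarrow> h = k"
  shows "is_pushout C m f g n"
  unfolding is_pushout_def
proof (intro conjI allI impI)
  fix x y assume "comm_square C m f x y"
  from ex[OF this] obtain k where k: "k \<in> Arr C" "Dom C k = Cod C g" "Cod C k = Cod C x"
    "k \<cdot> g = x" "k \<cdot> n = y" by blast
  show "\<exists>!k. k \<in> Hom C (Cod C g) (Cod C x) \<and> k \<cdot> g = x \<and> k \<cdot> n = y"
    by (rule ex1I[of _ k]) (use k un in \<open>auto simp: Hom_def\<close>)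
qed (fact s)

lemma pushout_swap:
  assumes p: "is_pushout C m f g n"
  shows "is_pushout C f m n g"
proof (rule pushoutI)
  note s = comm_squareD[OF pushout_square[OF p]]
  show "comm_square C f m n g" using comm_square_swap[OF pushout_square[OF p]] .
  show "\<exists>k. k \<in> Arr C \<and> Dom C k = Cod C n \<and> Cod C k = Cod C x \<and> k \<cdot> n = x \<and> k \<cdot> g = y"
    if xy: "comm_square C f m x y" for x y
  proof -
    obtain k where "k \<in> Arr C" "Dom C k = Cod C g" "Cod C k = Cod C y" "k \<cdot> g = y" "k \<cdot> n = x"
      by (rule pushout_factor[OF p comm_square_swap[OF xy]])
    then show ?thesis using s(8) comm_squareD(8)[OF xy] by auto
  qed
  show "h = k" if "h \<in> Arr C" "k \<in> Arr C" "Cod C h = Cod C k" "Dom C h = Cod C n"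
      "Dom C k = Cod C n" "h \<cdot> n = k \<cdot> n" "h \<cdot> g = k \<cdot> g" for h k
    by (rule pushout_eq[OF p that(7,6)]) (use that s in simp_all)
qed

text \<open>The dual pasting law: the inner pushout lets a cocone on the second square be extended
  to one on the outer square, and also shows that the resulting arrow has the right restriction
  along \<open>h\<close>.\<close>

lemma pushout_cancel:
  assumes o: "is_pushout C m (k \<cdot> f) (h \<cdot> g) l" and p: "is_pushout C m f g n"
    and S: "comm_square C n k h l"
  shows "is_pushout C n k h l"
proof (rule pushoutI[OF S])
  note P = pushout_square[OF p]
  note [simp] = comm_squareD(1-4)[OF P] comm_squareD(1-4)[OF S]
  have [simp]: "Dom C f = Dom C m" "Dom C g = Cod C m" "Cod C n = Cod C g" "Dom C n = Cod C f"
    "Dom C k = Cod C f" "Dom C h = Cod C g" "Cod C l = Cod C h" "Dom C l = Cod C k"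
    using comm_squareD[OF P] comm_squareD[OF S] by auto
  show "\<exists>w. w \<in> Arr C \<and> Dom C w = Cod C h \<and> Cod C w = Cod C x \<and> w \<cdot> h = x \<and> w \<cdot> l = y"
    if xy: "comm_square C n k x y" for x y
  proof -
    have [simp]: "x \<in> Arr C" "y \<in> Arr C" "Dom C x = Cod C g" "Cod C y = Cod C x" "Dom C y = Cod C k"
      and e: "x \<cdot> n = y \<cdot> k"
      using comm_squareD[OF xy] by auto
    have "x \<cdot> (g \<cdot> m) = y \<cdot> (k \<cdot> f)"
      using comm_squareD(9)[OF P] comp_eq_comp[OF e, of f] by simp
    then have "comm_square C m (k \<cdot> f) (x \<cdot> g) y"
      unfolding comm_square_def by simp
    then obtain w where w: "w \<in> Arr C" "Dom C w = Cod C (h \<cdot> g)" "Cod C w = Cod C (x \<cdot> g)"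
      "w \<cdot> (h \<cdot> g) = x \<cdot> g" "w \<cdot> l = y"
      by (rule pushout_factor[OF o])
    then have [simp]: "Dom C w = Cod C h" "Cod C w = Cod C x" by simp_all
    have "w \<cdot> h = x"
    proof (rule pushout_eq[OF p])
      have "(w \<cdot> h) \<cdot> n = w \<cdot> (l \<cdot> k)" using w comm_squareD(9)[OF S] by simp
      also have "\<dots> = x \<cdot> n" using w e comp_eq_comp[of w l y k] by simp
      finally show "(w \<cdot> h) \<cdot> n = x \<cdot> n" .
    qed (use w in simp_all)
    then show ?thesis by (intro exI[of _ w]) (use w in simp)
  qed
  show "u = v" if u: "u \<in> Arr C" "v \<in> Arr C" "Cod C u = Cod C v" "Dom C u = Cod C h"
      "Dom C v = Cod C h" "u \<cdot> h = v \<cdot> h" "u \<cdot> l = v \<cdot> l" for u v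
    by (rule pushout_eq[OF o]) (use u comp_eq_comp[OF u(6), of g] in simp_all)
qed

lemma pushout_Id:
  assumes [simp]: "f \<in> Arr C" "Dom C f = A" "Cod C f = B"
  shows "is_pushout C (Id C A) f f (Id C B)" "is_pushout C f (Id C A) (Id C B) f"
proof -
  have [simp]: "A \<in> Obj C" "B \<in> Obj C" using Dom_in_Obj[of f] Cod_in_Obj[of f] by simp_all
  show "is_pushout C (Id C A) f f (Id C B)"
    by (rule pushoutI) (auto simp: comm_square_def)
  show "is_pushout C f (Id C A) (Id C B) f"
    by (rule pushoutI) (auto simp: comm_square_def)
qed

lemma pullback_Id:
  assumes [simp]: "f \<in> Arr C" "Dom C f = A" "Cod C f = B"
  shows "is_pullback C (Id C A) f f (Id C B)" "is_pullback C f (Id C A) (Id C B) f"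
proof -
  have [simp]: "A \<in> Obj C" "B \<in> Obj C" using Dom_in_Obj[of f] Cod_in_Obj[of f] by simp_all
  show "is_pullback C (Id C A) f f (Id C B)"
    by (rule pullbackI) (auto simp: comm_square_def)
  show "is_pullback C f (Id C A) (Id C B) f"
    by (rule pullbackI) (auto simp: comm_square_def)
qed

text \<open>For \<open>f\<close> an identity this is the trivial kernel pair of a mono; the general
  case serves as the left face of a cube whose map is already known to factor through
  \<open>m\<close>.\<close>

lemma pullback_mono_comp:
  assumes m: "mono_arrow C m" and [simp]: "f \<in> Arr C" "Cod C f = Dom C m" "Dom C f = A"
  shows "is_pullback C f (Id C A) m (m \<cdot> f)"
proof -
  have [simp]: "A \<in> Obj C" using Dom_in_Obj[of f] by simp
  note [simp] = mono_arr[OF m]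
  show ?thesis
  proof (rule pullbackI)
    show "\<exists>k. k \<in> Arr C \<and> Dom C k = Dom C x \<and> Cod C k = Dom C f \<and> f \<cdot> k = x \<and> Id C A \<cdot> k = y"
      if xy: "comm_square C x y m (m \<cdot> f)" for x y
    proof (rule exI[of _ y])
      note [simp] = comm_squareD(1-5)[OF xy]
      have [simp]: "Cod C y = A" "Cod C x = Dom C m" using comm_squareD[OF xy] by auto
      have "f \<cdot> y = x" by (rule monoD[OF m]) (use comm_squareD(9)[OF xy] in simp_all)
      then show "y \<in> Arr C \<and> Dom C y = Dom C x \<and> Cod C y = Dom C f \<and> f \<cdot> y = x \<and> Id C A \<cdot> y = y"
        by simp
    qed
  qed (auto simp: comm_square_def)
qed

lemma mono_iff_pullback:
  assumes p: "is_pullback C (Id C B) (Id C B) n n" and B: "B \<in> Obj C"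
  shows "mono_arrow C n"
proof (rule monoI)
  note S = comm_squareD[OF pullback_square[OF p]]
  show n: "n \<in> Arr C" using S by simp
  fix h k assume h: "h \<in> Arr C" "k \<in> Arr C" "Dom C h = Dom C k" "Cod C h = Dom C n"
      "Cod C k = Dom C n" and e: "n \<cdot> h = n \<cdot> k"
  have "comm_square C h k n n" using h e n by (simp add: comm_square_def)
  then obtain w where "w \<in> Arr C" "Cod C w = Dom C (Id C B)" "Id C B \<cdot> w = h" "Id C B \<cdot> w = k"
    by (rule pullback_factor[OF p])
  then show "h = k" by simp
qed

end

section \<open>Coding in a universe of sets\<close>

context set_universe
begin

definition is_set :: "'u set \<Rightarrow> bool" where
  "is_set X \<longleftrightarrow> X \<in> range elts"

definition code :: "'u set \<Rightarrow> 'u" where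
  "code X = inv elts X"

lemma elts_code [simp]: "is_set X \<Longrightarrow> elts (code X) = X"
  by (auto simp: is_set_def code_def f_inv_into_f)

lemma is_set_elts [simp]: "is_set (elts u)"
  by (simp add: is_set_def)

lemma code_inject: "is_set X \<Longrightarrow> is_set Y \<Longrightarrow> code X = code Y \<longleftrightarrow> X = Y"
  by (metis elts_code)

lemma is_set_subset: "is_set Y \<Longrightarrow> X \<subseteq> Y \<Longrightarrow> is_set X"
  using subset_closed by (auto simp: is_set_def)

lemma is_set_image [simp]: "is_set X \<Longrightarrow> is_set (F ` X)"
  using replacement by (auto simp: is_set_def)

lemma is_set_Union:
  assumes "is_set X" "\<And>x. x \<in> X \<Longrightarrow> is_set (F x)"
  shows "is_set (\<Union>x\<in>X. F x)"
proof -
  have "(\<Union>x\<in>X. F x) = (\<Union>y\<in>elts (code ((\<lambda>x. code (F x)) ` X)). elts y)"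
    using assms by simp
  then show ?thesis using union_closed by (simp add: is_set_def)
qed

lemma is_set_Pow: "is_set X \<Longrightarrow> is_set {u. elts u \<subseteq> X}"
  using power_closed by (auto simp: is_set_def)

lemma is_set_empty [simp]: "is_set {}"
  using is_set_subset[OF is_set_elts] by blast

lemma is_set_doubleton [simp]: "is_set {a, b}"
proof -
  define z where "z = code {}"
  have z: "elts z = {}" by (simp add: z_def)
  have "{u. elts u \<subseteq> {}} = {z}"
    using extensionality z by (auto simp: inj_def)
  then have one: "is_set {z}" using is_set_Pow[of "{}"] by simp
  \<comment> \<open>Pairing is derived rather than assumed: the power set of a singleton supplies
    two distinct codes, and replacement sends them to \<open>a\<close> and \<open>b\<close>.\<close>
  have "is_set {z, code {z}}"
    by (rule is_set_subset[OF is_set_Pow[OF one]]) (use z one in auto)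
  then have "is_set ((\<lambda>x. if x = z then a else b) ` {z, code {z}})" by (rule is_set_image)
  moreover have "code {z} \<noteq> z" using z one by (metis elts_code insert_not_empty)
  ultimately show ?thesis by (simp add: insert_commute)
qed

lemma is_set_singleton [simp]: "is_set {a}"
  using is_set_doubleton[of a a] by simp

text \<open>The Kuratowski pair.\<close>

definition pr :: "'u \<Rightarrow> 'u \<Rightarrow> 'u" where
  "pr a b = code {code {a}, code {a, b}}"

lemma pr_inject [simp]: "pr a b = pr c d \<longleftrightarrow> a = c \<and> b = d"
  by (auto simp: pr_def code_inject doubleton_eq_iff)

definition fstc :: "'u \<Rightarrow> 'u" where "fstc u = (THE a. \<exists>b. u = pr a b)"
definition sndc :: "'u \<Rightarrow> 'u" where "sndc u = (THE b. \<exists>a. u = pr a b)"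

lemma fstc_pr [simp]: "fstc (pr a b) = a" and sndc_pr [simp]: "sndc (pr a b) = b"
  by (auto simp: fstc_def sndc_def)

definition prods :: "'u set \<Rightarrow> 'u set \<Rightarrow> 'u set" where
  "prods X Y = (\<Union>x\<in>X. pr x ` Y)"

lemma pr_in_prods [simp]: "pr a b \<in> prods X Y \<longleftrightarrow> a \<in> X \<and> b \<in> Y"
  by (auto simp: prods_def)

lemma in_prodsE:
  assumes "z \<in> prods X Y" obtains a b where "z = pr a b" "a \<in> X" "b \<in> Y"
  using assms by (auto simp: prods_def)

lemma is_set_prods [simp]: "is_set X \<Longrightarrow> is_set Y \<Longrightarrow> is_set (prods X Y)"
  unfolding prods_def by (intro is_set_Union) simp_all

text \<open>A function is stored as its graph over \<open>X\<close>, so functions that agree on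
  \<open>X\<close> have equal codes. Equality of arrows between sheaves rests on this.\<close>

definition lam :: "'u set \<Rightarrow> ('u \<Rightarrow> 'u) \<Rightarrow> 'u" where
  "lam X \<phi> = code ((\<lambda>x. pr x (\<phi> x)) ` X)"

definition app :: "'u \<Rightarrow> 'u \<Rightarrow> 'u" where
  "app u x = (THE y. pr x y \<in> elts u)"

lemma app_lam [simp]: "is_set X \<Longrightarrow> x \<in> X \<Longrightarrow> app (lam X \<phi>) x = \<phi> x"
  by (auto simp: app_def lam_def)

lemma lam_cong: "(\<And>x. x \<in> X \<Longrightarrow> \<phi> x = \<psi> x) \<Longrightarrow> lam X \<phi> = lam X \<psi>"
  by (simp add: lam_def cong: image_cong)

lemma is_set_lam:
  assumes X: "is_set X" and Y: "is_set Y"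
  shows "is_set {lam X \<phi> |\<phi>. (\<forall>x\<in>X. \<phi> x \<in> Y) \<and> P \<phi>}"
proof (rule is_set_subset[OF is_set_Pow[OF is_set_prods[OF X Y]]])
  show "{lam X \<phi> |\<phi>. (\<forall>x\<in>X. \<phi> x \<in> Y) \<and> P \<phi>} \<subseteq> {u. elts u \<subseteq> prods X Y}"
    using X by (auto simp: lam_def)
qed

end

section \<open>Sheaves for a stable class of squares\<close>

text \<open>In \<open>cov_stable\<close> the legs pull back to the legs, while the corner of the new
  square need only map compatibly to the old corner. The condition \<open>cov_kernel\<close> says
  that two arrows identified by \<open>g\<close> are, on a cover of their common domain, equal on
  one leg and on the other leg images under \<open>m\<close> of two arrows identified by
  \<open>f\<close>.\<close>

locale square_site = category +
  fixes cov :: "'a \<Rightarrow> 'a \<Rightarrow> 'a \<Rightarrow> 'a \<Rightarrow> bool"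
  assumes cov_pushout: "cov m f g n \<Longrightarrow> is_pushout C m f g n"
    and cov_pullback: "cov m f g n \<Longrightarrow> is_pullback C m f g n"
    and cov_mono: "cov m f g n \<Longrightarrow> mono_arrow C n"
    and cov_stable: "cov m f g n \<Longrightarrow> h \<in> Arr C \<Longrightarrow> Cod C h = Cod C g \<Longrightarrow>
      \<exists>m' f' g' n' a b c. cov m' f' g' n' \<and> is_pullback C g' a h g \<and> is_pullback C n' b h n \<and>
        comm_square C m' c a m \<and> comm_square C f' c b f"
    and cov_kernel: "cov m f g n \<Longrightarrow> u \<in> Arr C \<Longrightarrow> v \<in> Arr C \<Longrightarrow> Dom C u = Dom C v \<Longrightarrow>
      Cod C u = Dom C g \<Longrightarrow> Cod C v = Dom C g \<Longrightarrow> g \<cdot> u = g \<cdot> v \<Longrightarrow>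
      \<exists>m' f' s t c c'. cov m' f' s t \<and> Cod C s = Dom C u \<and> u \<cdot> s = v \<cdot> s \<and>
        c \<in> Arr C \<and> c' \<in> Arr C \<and> Dom C c = Dom C t \<and> Dom C c' = Dom C t \<and>
        Cod C c = Dom C m \<and> Cod C c' = Dom C m \<and> u \<cdot> t = m \<cdot> c \<and> v \<cdot> t = m \<cdot> c' \<and> f \<cdot> c = f \<cdot> c'"
begin

lemmas covD = comm_squareD[OF pushout_square[OF cov_pushout]]

end

locale sheaves = square_site C cov + set_universe elts
  for C :: "('o, 'a) cat" (structure) and cov and elts :: "'u \<Rightarrow> 'u set" +
  fixes \<gamma> :: "'a \<Rightarrow> 'u" and U :: 'u
  assumes \<gamma>: "bij_betw \<gamma> (Arr C) (elts U)"
begin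

definition dec :: "'u \<Rightarrow> 'a" where
  "dec = inv_into (Arr C) \<gamma>"

lemma dec_\<gamma> [simp]: "f \<in> Arr C \<Longrightarrow> dec (\<gamma> f) = f"
  using \<gamma> by (simp add: dec_def bij_betw_def)

lemma \<gamma>_elts [simp]: "f \<in> Arr C \<Longrightarrow> \<gamma> f \<in> elts U"
  using \<gamma> by (auto simp: bij_betw_def)

lemma dec_Arr [simp]: "i \<in> elts U \<Longrightarrow> dec i \<in> Arr C"
  using \<gamma> by (auto simp: dec_def bij_betw_def intro: inv_into_into)

lemma \<gamma>_inject [simp]: "f \<in> Arr C \<Longrightarrow> g \<in> Arr C \<Longrightarrow> \<gamma> f = \<gamma> g \<longleftrightarrow> f = g"
  using dec_\<gamma> by metis

section \<open>Codes for presheaves and natural transformations\<close>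

definition mkP :: "('o \<Rightarrow> 'u set) \<Rightarrow> ('a \<Rightarrow> 'u \<Rightarrow> 'u) \<Rightarrow> 'u" where
  "mkP F0 F1 = pr (lam (elts U) (\<lambda>i. code (F0 (Cod C (dec i)))))
                  (lam (elts U) (\<lambda>i. lam (F0 (Cod C (dec i))) (F1 (dec i))))"

text \<open>An object is looked up at the code of its identity, so the single index set
  \<open>elts U\<close> of arrow codes serves for objects and arrows alike.\<close>

definition el :: "'u \<Rightarrow> 'o \<Rightarrow> 'u set" where
  "el F X = elts (app (fstc F) (\<gamma> (Id C X)))"

definition act :: "'u \<Rightarrow> 'a \<Rightarrow> 'u \<Rightarrow> 'u" where
  "act F f x = app (app (sndc F) (\<gamma> f)) x"

lemma is_set_el [simp]: "is_set (el F X)"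
  by (simp add: el_def)

lemma el_mkP: "(\<And>X. X \<in> Obj C \<Longrightarrow> is_set (F0 X)) \<Longrightarrow> X \<in> Obj C \<Longrightarrow> el (mkP F0 F1) X = F0 X"
  by (simp add: el_def mkP_def)

lemma act_mkP:
  "(\<And>X. X \<in> Obj C \<Longrightarrow> is_set (F0 X)) \<Longrightarrow> f \<in> Arr C \<Longrightarrow> x \<in> F0 (Cod C f) \<Longrightarrow>
    act (mkP F0 F1) f x = F1 f x"
  by (simp add: act_def mkP_def)

text \<open>No canonical form is imposed on the code \<open>F\<close>: several codes may carry the
  same presheaf and then count as different, isomorphic objects. Only arrows need canonical codes.
  The last clause says that the covering square becomes a pullback of sets.\<close>

definition sheaf :: "'u \<Rightarrow> bool" where
  "sheaf F \<longleftrightarrow>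
    (\<forall>f\<in>Arr C. \<forall>x\<in>el F (Cod C f). act F f x \<in> el F (Dom C f)) \<and>
    (\<forall>X\<in>Obj C. \<forall>x\<in>el F X. act F (Id C X) x = x) \<and>
    (\<forall>f\<in>Arr C. \<forall>g\<in>Arr C. Cod C f = Dom C g \<longrightarrow>
       (\<forall>x\<in>el F (Cod C g). act F (g \<cdot> f) x = act F f (act F g x))) \<and>
    (\<forall>m f g n. cov m f g n \<longrightarrow>
       (\<forall>x\<in>el F (Dom C g). \<forall>y\<in>el F (Dom C n). act F m x = act F f y \<longrightarrow>
         (\<exists>z\<in>el F (Cod C g). act F g z = x \<and> act F n z = y)) \<and>
       (\<forall>z\<in>el F (Cod C g). \<forall>z'\<in>el F (Cod C g).
         act F g z = act F g z' \<and> act F n z = act F n z' \<longrightarrow> z = z'))"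

lemma act_el [simp]: "sheaf F \<Longrightarrow> f \<in> Arr C \<Longrightarrow> x \<in> el F (Cod C f) \<Longrightarrow> Dom C f = X \<Longrightarrow> act F f x \<in> el F X"
  by (auto simp: sheaf_def)

lemma act_Id [simp]: "sheaf F \<Longrightarrow> X \<in> Obj C \<Longrightarrow> x \<in> el F X \<Longrightarrow> act F (Id C X) x = x"
  by (auto simp: sheaf_def)

lemma act_comp:
  "sheaf F \<Longrightarrow> f \<in> Arr C \<Longrightarrow> g \<in> Arr C \<Longrightarrow> Cod C f = Dom C g \<Longrightarrow> x \<in> el F (Cod C g) \<Longrightarrow>
    act F (g \<cdot> f) x = act F f (act F g x)"
  by (auto simp: sheaf_def)

lemma sheaf_glue:
  assumes "sheaf F" "cov m f g n" "x \<in> el F (Dom C g)" "y \<in> el F (Dom C n)" "act F m x = act F f y"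
  obtains z where "z \<in> el F (Cod C g)" "act F g z = x" "act F n z = y"
  using assms unfolding sheaf_def by metis

lemma sheaf_eq:
  assumes "sheaf F" "cov m f g n" "act F g z = act F g z'" "act F n z = act F n z'"
    "z \<in> el F (Cod C g)" "z' \<in> el F (Cod C g)"
  shows "z = z'"
  using assms unfolding sheaf_def by blast

lemma sheaf_mkP:
  assumes set: "\<And>X. X \<in> Obj C \<Longrightarrow> is_set (F0 X)"
    and el: "\<And>f x. f \<in> Arr C \<Longrightarrow> x \<in> F0 (Cod C f) \<Longrightarrow> F1 f x \<in> F0 (Dom C f)"
    and id: "\<And>X x. X \<in> Obj C \<Longrightarrow> x \<in> F0 X \<Longrightarrow> F1 (Id C X) x = x"
    and comp: "\<And>f g x. f \<in> Arr C \<Longrightarrow> g \<in> Arr C \<Longrightarrow> Cod C f = Dom C g \<Longrightarrow> x \<in> F0 (Cod C g) \<Longrightarrow>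
      F1 (g \<cdot> f) x = F1 f (F1 g x)"
    and glue: "\<And>m f g n x y. cov m f g n \<Longrightarrow> x \<in> F0 (Dom C g) \<Longrightarrow> y \<in> F0 (Dom C n) \<Longrightarrow>
      F1 m x = F1 f y \<Longrightarrow> \<exists>z\<in>F0 (Cod C g). F1 g z = x \<and> F1 n z = y"
    and eq: "\<And>m f g n z z'. cov m f g n \<Longrightarrow> z \<in> F0 (Cod C g) \<Longrightarrow> z' \<in> F0 (Cod C g) \<Longrightarrow>
      F1 g z = F1 g z' \<Longrightarrow> F1 n z = F1 n z' \<Longrightarrow> z = z'"
  shows "sheaf (mkP F0 F1)"
proof -
  note [simp] = el_mkP[of F0, OF set] act_mkP[of F0, OF set]
  show ?thesis
    unfolding sheaf_def
  proof (intro conjI ballI allI impI)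
    fix m f g n assume c: "cov m f g n"
    note [simp] = covD(1-8)[OF c]
    have [simp]: "Cod C m = Dom C g" "Cod C f = Dom C n" using covD[OF c] by auto
    show "\<exists>z\<in>el (mkP F0 F1) (Cod C g). act (mkP F0 F1) g z = x \<and> act (mkP F0 F1) n z = y"
      if "x \<in> el (mkP F0 F1) (Dom C g)" "y \<in> el (mkP F0 F1) (Dom C n)"
        "act (mkP F0 F1) m x = act (mkP F0 F1) f y" for x y
      using glue[OF c, of x y] that by (auto simp del: covD(8))
    show "z = z'" if "z \<in> el (mkP F0 F1) (Cod C g)" "z' \<in> el (mkP F0 F1) (Cod C g)"
        "act (mkP F0 F1) g z = act (mkP F0 F1) g z' \<and> act (mkP F0 F1) n z = act (mkP F0 F1) n z'" for z z'
      using eq[OF c, of z z'] that by simp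
  qed (use el id comp in auto)
qed

text \<open>Domain and codomain are part of the code, so they can be read off by projections, and
  the components are graphs. Composition in \<open>Sh\<close> recodes its result by
  \<open>mkA\<close>, which keeps arrows in canonical form.\<close>

definition mkA :: "'u \<Rightarrow> 'u \<Rightarrow> ('o \<Rightarrow> 'u \<Rightarrow> 'u) \<Rightarrow> 'u" where
  "mkA F G \<alpha> = pr F (pr G (lam (elts U) (\<lambda>i. lam (el F (Cod C (dec i))) (\<alpha> (Cod C (dec i))))))"

definition ap :: "'u \<Rightarrow> 'o \<Rightarrow> 'u \<Rightarrow> 'u" where
  "ap h X x = app (app (sndc (sndc h)) (\<gamma> (Id C X))) x"

lemma ap_mkA [simp]: "X \<in> Obj C \<Longrightarrow> x \<in> el F X \<Longrightarrow> ap (mkA F G \<alpha>) X x = \<alpha> X x"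
  by (simp add: ap_def mkA_def)

lemma mkA_cong:
  assumes "\<And>X x. X \<in> Obj C \<Longrightarrow> x \<in> el F X \<Longrightarrow> \<alpha> X x = \<beta> X x"
  shows "mkA F G \<alpha> = mkA F G \<beta>"
  unfolding mkA_def using assms by (auto intro!: lam_cong)

definition natural :: "'u \<Rightarrow> 'u \<Rightarrow> ('o \<Rightarrow> 'u \<Rightarrow> 'u) \<Rightarrow> bool" where
  "natural F G \<alpha> \<longleftrightarrow> (\<forall>X\<in>Obj C. \<forall>x\<in>el F X. \<alpha> X x \<in> el G X) \<and>
    (\<forall>f\<in>Arr C. \<forall>x\<in>el F (Cod C f). \<alpha> (Dom C f) (act F f x) = act G f (\<alpha> (Cod C f) x))"

definition Sh :: "('u, 'u) cat" where
  "Sh = \<lparr>Obj = {F. sheaf F},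
    Arr = {h. \<exists>F G \<alpha>. sheaf F \<and> sheaf G \<and> natural F G \<alpha> \<and> h = mkA F G \<alpha>},
    Dom = fstc, Cod = \<lambda>h. fstc (sndc h),
    Id = \<lambda>F. mkA F F (\<lambda>X x. x),
    Comp = \<lambda>k h. mkA (fstc h) (fstc (sndc k)) (\<lambda>X x. ap k X (ap h X x))\<rparr>"

lemma Sh_Obj [simp]: "F \<in> Obj Sh \<longleftrightarrow> sheaf F"
  by (simp add: Sh_def)

lemma mkA_Hom: "sheaf F \<Longrightarrow> sheaf G \<Longrightarrow> natural F G \<alpha> \<Longrightarrow> mkA F G \<alpha> \<in> Hom Sh F G"
  by (auto simp: Sh_def Hom_def mkA_def)

lemma natural_cong:
  assumes sh: "sheaf F" and e: "\<And>X x. X \<in> Obj C \<Longrightarrow> x \<in> el F X \<Longrightarrow> \<alpha> X x = \<beta> X x"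
    and n: "natural F G \<beta>"
  shows "natural F G \<alpha>"
  using n sh by (auto simp: natural_def e)

lemma HomE:
  assumes "h \<in> Hom Sh F G"
  obtains \<alpha> where "sheaf F" "sheaf G" "natural F G \<alpha>" "h = mkA F G \<alpha>"
  using assms by (auto simp: Sh_def Hom_def mkA_def)

lemma Hom_natural:
  assumes "h \<in> Hom Sh F G"
  shows "sheaf F" "sheaf G" "natural F G (ap h)" "h = mkA F G (ap h)"
proof -
  obtain \<alpha> where a: "sheaf F" "sheaf G" "natural F G \<alpha>" "h = mkA F G \<alpha>" using assms by (rule HomE)
  then show "sheaf F" "sheaf G" by simp_all
  show "natural F G (ap h)" using a by (intro natural_cong[OF _ _ a(3)]) simp_all
  show "h = mkA F G (ap h)" using a by (auto intro: mkA_cong)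
qed

text \<open>By \<open>Hom_natural\<close> every arrow is the \<open>mkA\<close> of its own
  components, and \<open>mkA\<close> depends only on their values on elements.\<close>

lemma Sh_ext:
  assumes "h \<in> Hom Sh F G" "k \<in> Hom Sh F G"
    and "\<And>X x. X \<in> Obj C \<Longrightarrow> x \<in> el F X \<Longrightarrow> ap h X x = ap k X x"
  shows "h = k"
  using Hom_natural(4)[OF assms(1)] Hom_natural(4)[OF assms(2)] mkA_cong[of F "ap h" "ap k" G] assms(3)
  by simp

lemma ap_el [simp]: "h \<in> Hom Sh F G \<Longrightarrow> X \<in> Obj C \<Longrightarrow> x \<in> el F X \<Longrightarrow> ap h X x \<in> el G X"
  using Hom_natural(3) by (fastforce simp: natural_def)

lemma ap_act:
  "h \<in> Hom Sh F G \<Longrightarrow> f \<in> Arr C \<Longrightarrow> x \<in> el F (Cod C f) \<Longrightarrow> Dom C f = X \<Longrightarrow> Cod C f = Y \<Longrightarrow>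
    ap h X (act F f x) = act G f (ap h Y x)"
  using Hom_natural(3) by (fastforce simp: natural_def)

lemma Sh_comp:
  assumes "h \<in> Hom Sh F G" "k \<in> Hom Sh G H"
  shows "k \<cdot>\<^bsub>Sh\<^esub> h = mkA F H (\<lambda>X x. ap k X (ap h X x))"
  using assms by (auto simp: Sh_def Hom_def)

lemma Sh_comp_natural:
  assumes "h \<in> Hom Sh F G" "k \<in> Hom Sh G H"
  shows "natural F H (\<lambda>X x. ap k X (ap h X x))"
  using assms Hom_natural(1)[OF assms(1)] by (auto simp: natural_def ap_act[OF assms(1)] ap_act[OF assms(2)])

lemma ap_comp:
  assumes "h \<in> Hom Sh F G" "k \<in> Hom Sh G H" "X \<in> Obj C" "x \<in> el F X"
  shows "ap (k \<cdot>\<^bsub>Sh\<^esub> h) X x = ap k X (ap h X x)"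
  using assms by (simp add: Sh_comp[OF assms(1,2)])

lemma Sh_Id: "Id Sh F = mkA F F (\<lambda>X x. x)"
  by (simp add: Sh_def)

lemma Sh_Id_Hom: "sheaf F \<Longrightarrow> Id Sh F \<in> Hom Sh F F"
  unfolding Sh_Id by (rule mkA_Hom) (auto simp: natural_def)

lemma Sh_comp_Hom: "h \<in> Hom Sh F G \<Longrightarrow> k \<in> Hom Sh G H \<Longrightarrow> k \<cdot>\<^bsub>Sh\<^esub> h \<in> Hom Sh F H"
  unfolding Sh_comp by (rule mkA_Hom) (auto dest: Hom_natural intro: Sh_comp_natural)

lemma ArrHom: "h \<in> Arr K \<Longrightarrow> h \<in> Hom K (Dom K h) (Cod K h)"
  by (simp add: Hom_def)

lemma category_Sh: "category Sh"
proof
  show "Dom Sh f \<in> Obj Sh" "Cod Sh f \<in> Obj Sh" if "f \<in> Arr Sh" for f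
    using Hom_natural[OF ArrHom[OF that]] by simp_all
  show "Id Sh A \<in> Hom Sh A A" if "A \<in> Obj Sh" for A using that Sh_Id_Hom by simp
  show "g \<cdot>\<^bsub>Sh\<^esub> f \<in> Hom Sh A D" if "f \<in> Hom Sh A B" "g \<in> Hom Sh B D" for f g A B D
    using that by (rule Sh_comp_Hom)
  show "Id Sh B \<cdot>\<^bsub>Sh\<^esub> f = f" if f: "f \<in> Hom Sh A B" for f A B
  proof (rule Sh_ext[OF _ f])
    have i: "Id Sh B \<in> Hom Sh B B" using Sh_Id_Hom Hom_natural(2)[OF f] by simp
    show "Id Sh B \<cdot>\<^bsub>Sh\<^esub> f \<in> Hom Sh A B" by (rule Sh_comp_Hom[OF f i])
    show "ap (Id Sh B \<cdot>\<^bsub>Sh\<^esub> f) X x = ap f X x" if "X \<in> Obj C" "x \<in> el A X" for X x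
      using that f by (simp add: ap_comp[OF f i]) (simp add: Sh_Id)
  qed
  show "f \<cdot>\<^bsub>Sh\<^esub> Id Sh A = f" if f: "f \<in> Hom Sh A B" for f A B
  proof (rule Sh_ext[OF _ f])
    have i: "Id Sh A \<in> Hom Sh A A" using Sh_Id_Hom Hom_natural(1)[OF f] by simp
    show "f \<cdot>\<^bsub>Sh\<^esub> Id Sh A \<in> Hom Sh A B" by (rule Sh_comp_Hom[OF i f])
    show "ap (f \<cdot>\<^bsub>Sh\<^esub> Id Sh A) X x = ap f X x" if "X \<in> Obj C" "x \<in> el A X" for X x
      using that f by (simp add: ap_comp[OF i f]) (simp add: Sh_Id)
  qed
  show "(h \<cdot>\<^bsub>Sh\<^esub> g) \<cdot>\<^bsub>Sh\<^esub> f = h \<cdot>\<^bsub>Sh\<^esub> (g \<cdot>\<^bsub>Sh\<^esub> f)"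
    if f: "f \<in> Hom Sh A B" and g: "g \<in> Hom Sh B D" and h: "h \<in> Hom Sh D E" for f g h A B D E
  proof (rule Sh_ext)
    note gf = Sh_comp_Hom[OF f g] and hg = Sh_comp_Hom[OF g h]
    show "(h \<cdot>\<^bsub>Sh\<^esub> g) \<cdot>\<^bsub>Sh\<^esub> f \<in> Hom Sh A E" by (rule Sh_comp_Hom[OF f hg])
    show "h \<cdot>\<^bsub>Sh\<^esub> (g \<cdot>\<^bsub>Sh\<^esub> f) \<in> Hom Sh A E" by (rule Sh_comp_Hom[OF gf h])
    show "ap ((h \<cdot>\<^bsub>Sh\<^esub> g) \<cdot>\<^bsub>Sh\<^esub> f) X x = ap (h \<cdot>\<^bsub>Sh\<^esub> (g \<cdot>\<^bsub>Sh\<^esub> f)) X x"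
      if x: "X \<in> Obj C" "x \<in> el A X" for X x
      using ap_el[OF f x] x by (simp add: ap_comp[OF f hg] ap_comp[OF gf h] ap_comp[OF f g] ap_comp[OF g h])
  qed
qed

end

sublocale sheaves \<subseteq> Sh: category Sh
  by (rule category_Sh)

section \<open>Representable sheaves and finite limits of sheaves\<close>

context sheaves
begin

definition rep :: "'o \<Rightarrow> 'u" where
  "rep X = mkP (\<lambda>Y. \<gamma> ` Hom C Y X) (\<lambda>f i. \<gamma> (dec i \<cdot> f))"

lemma is_set_\<gamma> [simp]: "A \<subseteq> Arr C \<Longrightarrow> is_set (\<gamma> ` A)"
  by (rule is_set_subset[of "elts U"]) auto

lemma Hom_Arr: "Hom C Y X \<subseteq> Arr C"
  by (auto simp: Hom_def)

lemma el_rep [simp]: "Y \<in> Obj C \<Longrightarrow> el (rep X) Y = \<gamma> ` Hom C Y X"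
  unfolding rep_def by (rule el_mkP) (simp_all add: Hom_Arr)

lemma act_rep [simp]:
  "f \<in> Arr C \<Longrightarrow> i \<in> Arr C \<Longrightarrow> Dom C i = Cod C f \<Longrightarrow> Cod C i = X \<Longrightarrow> act (rep X) f (\<gamma> i) = \<gamma> (i \<cdot> f)"
  unfolding rep_def by (subst act_mkP) (auto simp: Hom_Arr Hom_def)

lemma sheaf_rep:
  assumes X: "X \<in> Obj C" shows "sheaf (rep X)"
  unfolding rep_def
proof (rule sheaf_mkP)
  fix m f g n assume c: "cov m f g n"
  note [simp] = covD(1-5)[OF c] covD(8)[OF c]
  have [simp]: "Dom C g = Cod C m" "Dom C n = Cod C f" using covD[OF c] by auto
  show "\<exists>z\<in>\<gamma> ` Hom C (Cod C g) X. \<gamma> (dec z \<cdot> g) = x \<and> \<gamma> (dec z \<cdot> n) = y"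
    if x: "x \<in> \<gamma> ` Hom C (Dom C g) X" and y: "y \<in> \<gamma> ` Hom C (Dom C n) X"
      and e: "\<gamma> (dec x \<cdot> m) = \<gamma> (dec y \<cdot> f)" for x y
  proof -
    obtain u where u: "x = \<gamma> u" "u \<in> Arr C" "Dom C u = Cod C m" "Cod C u = X" using x by (auto simp: Hom_def)
    obtain v where v: "y = \<gamma> v" "v \<in> Arr C" "Dom C v = Cod C f" "Cod C v = X" using y by (auto simp: Hom_def)
    have "comm_square C m f u v" using u v e by (simp add: comm_square_def)
    then obtain k where "k \<in> Arr C" "Dom C k = Cod C g" "Cod C k = Cod C u" "k \<cdot> g = u" "k \<cdot> n = v"
      by (rule pushout_factor[OF cov_pushout[OF c]])
    then show ?thesis using u v by (intro bexI[of _ "\<gamma> k"]) (simp_all add: Hom_def)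
  qed
  show "z = z'" if z: "z \<in> \<gamma> ` Hom C (Cod C g) X" "z' \<in> \<gamma> ` Hom C (Cod C g) X"
      "\<gamma> (dec z \<cdot> g) = \<gamma> (dec z' \<cdot> g)" "\<gamma> (dec z \<cdot> n) = \<gamma> (dec z' \<cdot> n)" for z z'
  proof -
    obtain u where u: "z = \<gamma> u" "u \<in> Arr C" "Dom C u = Cod C g" "Cod C u = X" using z by (auto simp: Hom_def)
    obtain v where v: "z' = \<gamma> v" "v \<in> Arr C" "Dom C v = Cod C g" "Cod C v = X" using z by (auto simp: Hom_def)
    have "u = v" by (rule pushout_eq[OF cov_pushout[OF c]]) (use u v z in simp_all)
    then show ?thesis using u v by simp
  qed
qed (auto simp: Hom_def Hom_Arr intro!: imageI)

text \<open>The arrow that the Yoneda lemma assigns to an element \<open>x\<close> of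
  \<open>F\<close> at \<open>X\<close>.\<close>

definition yarr :: "'u \<Rightarrow> 'o \<Rightarrow> 'u \<Rightarrow> 'u" where
  "yarr F X x = mkA (rep X) F (\<lambda>Y i. act F (dec i) x)"

lemma yarr_Hom [simp]:
  assumes "sheaf F" "X \<in> Obj C" "x \<in> el F X" shows "yarr F X x \<in> Hom Sh (rep X) F"
  unfolding yarr_def using assms
  by (intro mkA_Hom) (auto simp: sheaf_rep natural_def Hom_def act_comp)

lemma ap_yarr [simp]:
  "X \<in> Obj C \<Longrightarrow> f \<in> Arr C \<Longrightarrow> Cod C f = X \<Longrightarrow> Dom C f = Y \<Longrightarrow> ap (yarr F X x) Y (\<gamma> f) = act F f x"
  by (auto simp: yarr_def Hom_def)

lemma yarr_inject:
  assumes "sheaf F" "X \<in> Obj C" "x \<in> el F X" "y \<in> el F X" "yarr F X x = yarr F X y"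
  shows "x = y"
  using arg_cong[OF assms(5), of "\<lambda>h. ap h X (\<gamma> (Id C X))"] assms(1-4) by simp

lemma comp_yarr:
  assumes h: "h \<in> Hom Sh F G" and X: "X \<in> Obj C" "x \<in> el F X"
  shows "h \<cdot>\<^bsub>Sh\<^esub> yarr F X x = yarr G X (ap h X x)"
proof -
  note s = Hom_natural[OF h]
  have y: "yarr F X x \<in> Hom Sh (rep X) F" using s X by simp
  show ?thesis
  proof (rule Sh_ext)
    show "h \<cdot>\<^bsub>Sh\<^esub> yarr F X x \<in> Hom Sh (rep X) G" by (rule Sh_comp_Hom[OF y h])
    show "yarr G X (ap h X x) \<in> Hom Sh (rep X) G" using s X h by simp
    show "ap (h \<cdot>\<^bsub>Sh\<^esub> yarr F X x) Y i = ap (yarr G X (ap h X x)) Y i"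
      if Y: "Y \<in> Obj C" "i \<in> el (rep X) Y" for Y i
      using Y X by (simp add: ap_comp[OF y h]) (auto simp: Hom_def ap_act[OF h])
  qed
qed

text \<open>The element is the value of \<open>h\<close> at the identity of \<open>X\<close>;
  naturality along \<open>f\<close> then forces the value at \<open>\<gamma> f\<close>.\<close>

lemma yarr_ex:
  assumes h: "h \<in> Hom Sh (rep X) F" and X: "X \<in> Obj C"
  obtains x where "x \<in> el F X" "h = yarr F X x"
proof
  note s = Hom_natural[OF h]
  have i: "\<gamma> (Id C X) \<in> el (rep X) X" using X by (simp add: Hom_def)
  show x: "ap h X (\<gamma> (Id C X)) \<in> el F X" using h X i by simp
  show "h = yarr F X (ap h X (\<gamma> (Id C X)))"
  proof (rule Sh_ext[OF h])
    show "yarr F X (ap h X (\<gamma> (Id C X))) \<in> Hom Sh (rep X) F" using s x X by simp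
    fix Y j assume Y: "Y \<in> Obj C" "j \<in> el (rep X) Y"
    then obtain f where f: "j = \<gamma> f" "f \<in> Arr C" "Dom C f = Y" "Cod C f = X" by (auto simp: Hom_def)
    have "ap h Y (act (rep X) f (\<gamma> (Id C X))) = act F f (ap h X (\<gamma> (Id C X)))"
      by (rule ap_act[OF h]) (use f i in simp_all)
    then show "ap h Y j = ap (yarr F X (ap h X (\<gamma> (Id C X)))) Y j" using f X by simp
  qed
qed

section \<open>Finite limits of sheaves are pointwise\<close>

lemma Sh_squareD:
  assumes "comm_square Sh m f g n"
  shows "m \<in> Hom Sh (Dom Sh m) (Dom Sh g)" "f \<in> Hom Sh (Dom Sh m) (Dom Sh n)"
    "g \<in> Hom Sh (Dom Sh g) (Cod Sh g)" "n \<in> Hom Sh (Dom Sh n) (Cod Sh g)"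
    "g \<cdot>\<^bsub>Sh\<^esub> m = n \<cdot>\<^bsub>Sh\<^esub> f"
  using Sh.comm_squareD[OF assms] by (auto simp: Hom_def)

lemma Sh_squareI:
  assumes "m \<in> Hom Sh P A" "f \<in> Hom Sh P B" "g \<in> Hom Sh A D" "n \<in> Hom Sh B D"
    and "\<And>X x. X \<in> Obj C \<Longrightarrow> x \<in> el P X \<Longrightarrow> ap g X (ap m X x) = ap n X (ap f X x)"
  shows "comm_square Sh m f g n"
proof -
  have "g \<cdot>\<^bsub>Sh\<^esub> m = n \<cdot>\<^bsub>Sh\<^esub> f"
    by (rule Sh_ext[OF Sh_comp_Hom[OF assms(1,3)] Sh_comp_Hom[OF assms(2,4)]])
      (simp add: ap_comp[OF assms(1,3)] ap_comp[OF assms(2,4)] assms(5))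
  then show ?thesis using assms(1-4) by (auto simp: comm_square_def Hom_def)
qed

lemma Sh_square_ap:
  assumes s: "comm_square Sh m f g n" and x: "X \<in> Obj C" "x \<in> el (Dom Sh m) X"
  shows "ap g X (ap m X x) = ap n X (ap f X x)"
  using ap_comp[OF Sh_squareD(1,3)[OF s] x] ap_comp[OF Sh_squareD(2,4)[OF s] x] Sh_squareD(5)[OF s]
  by simp

text \<open>Representables are themselves sheaves, so the universal property can be tested on
  \<open>rep X\<close>, and arrows out of \<open>rep X\<close> are elements at
  \<open>X\<close>.\<close>

lemma pullback_pointwise:
  assumes p: "is_pullback Sh m f g n" and X: "X \<in> Obj C"
    and a: "a \<in> el (Dom Sh g) X" and b: "b \<in> el (Dom Sh n) X" and e: "ap g X a = ap n X b"
  shows "\<exists>!c. c \<in> el (Dom Sh m) X \<and> ap m X c = a \<and> ap f X c = b"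
proof -
  note s = Sh.pullback_square[OF p]
  note h = Sh_squareD[OF s]
  note sh = Hom_natural(1)[OF h(1)] Hom_natural(1)[OF h(3)] Hom_natural(1)[OF h(4)]
  have y: "yarr (Dom Sh g) X a \<in> Hom Sh (rep X) (Dom Sh g)" "yarr (Dom Sh n) X b \<in> Hom Sh (rep X) (Dom Sh n)"
    using sh a b X by simp_all
  have "comm_square Sh (yarr (Dom Sh g) X a) (yarr (Dom Sh n) X b) g n"
    using y h comp_yarr[OF h(3) X a] comp_yarr[OF h(4) X b] e by (auto simp: comm_square_def Hom_def)
  then obtain k where k: "k \<in> Arr Sh" "Dom Sh k = Dom Sh (yarr (Dom Sh g) X a)" "Cod Sh k = Dom Sh m"
      "m \<cdot>\<^bsub>Sh\<^esub> k = yarr (Dom Sh g) X a" "f \<cdot>\<^bsub>Sh\<^esub> k = yarr (Dom Sh n) X b"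
    by (rule Sh.pullback_factor[OF p])
  have kH: "k \<in> Hom Sh (rep X) (Dom Sh m)" using k y by (simp add: Hom_def)
  obtain c where c: "c \<in> el (Dom Sh m) X" "k = yarr (Dom Sh m) X c" by (rule yarr_ex[OF kH X])
  have m: "yarr (Dom Sh g) X (ap m X c) = yarr (Dom Sh g) X a"
    using k comp_yarr[OF h(1) X c(1)] c by simp
  have f: "yarr (Dom Sh n) X (ap f X c) = yarr (Dom Sh n) X b"
    using k comp_yarr[OF h(2) X c(1)] c by simp
  show ?thesis
  proof (rule ex1I[of _ c])
    show "c \<in> el (Dom Sh m) X \<and> ap m X c = a \<and> ap f X c = b"
      using c yarr_inject[OF sh(2) X _ a m] yarr_inject[OF sh(3) X _ b f] ap_el[OF h(1) X] ap_el[OF h(2) X]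
      by simp
    fix d assume d: "d \<in> el (Dom Sh m) X \<and> ap m X d = a \<and> ap f X d = b"
    have yd: "yarr (Dom Sh m) X d \<in> Hom Sh (rep X) (Dom Sh m)" using d X sh by simp
    have "yarr (Dom Sh m) X d = k"
      by (rule Sh.pullback_eq[OF p])
        (use comp_yarr[OF h(1) X, of d] comp_yarr[OF h(2) X, of d] d yd k kH in \<open>auto simp: Hom_def\<close>)
    then show "d = c" using yarr_inject[OF sh(1) X, of d c] c d by simp
  qed
qed

lemma pullback_pointwiseI:
  assumes s: "comm_square Sh m f g n"
    and p: "\<And>X a b. X \<in> Obj C \<Longrightarrow> a \<in> el (Dom Sh g) X \<Longrightarrow> b \<in> el (Dom Sh n) X \<Longrightarrow> ap g X a = ap n X b \<Longrightarrow>
      \<exists>!c. c \<in> el (Dom Sh m) X \<and> ap m X c = a \<and> ap f X c = b"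
  shows "is_pullback Sh m f g n"
proof (rule Sh.pullbackI[OF s])
  note h = Sh_squareD[OF s]
  note sh = Hom_natural(1)[OF h(1)] Hom_natural(1)[OF h(3)] Hom_natural(1)[OF h(4)]
  fix x y assume xy: "comm_square Sh x y g n"
  define Z where "Z = Dom Sh x"
  have x: "x \<in> Hom Sh Z (Dom Sh g)" and y: "y \<in> Hom Sh Z (Dom Sh n)"
    using Sh_squareD[OF xy] by (auto simp: Z_def)
  define \<alpha> where "\<alpha> X z = (THE c. c \<in> el (Dom Sh m) X \<and> ap m X c = ap x X z \<and> ap f X c = ap y X z)" for X z
  have ex1: "\<exists>!c. c \<in> el (Dom Sh m) X \<and> ap m X c = ap x X z \<and> ap f X c = ap y X z"
    if "X \<in> Obj C" "z \<in> el Z X" for X z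
    by (rule p) (use that x y Sh_square_ap[OF xy, of X z] in \<open>auto simp: Z_def\<close>)
  have \<alpha>: "\<alpha> X z \<in> el (Dom Sh m) X \<and> ap m X (\<alpha> X z) = ap x X z \<and> ap f X (\<alpha> X z) = ap y X z"
    if "X \<in> Obj C" "z \<in> el Z X" for X z
    unfolding \<alpha>_def using theI'[OF ex1[OF that]] .
  have Z: "sheaf Z" using Hom_natural(1)[OF x] .
  have nat: "natural Z (Dom Sh m) \<alpha>"
    unfolding natural_def
  proof (intro conjI ballI)
    show "\<alpha> X z \<in> el (Dom Sh m) X" if "X \<in> Obj C" "z \<in> el Z X" for X z using \<alpha> that by blast
    fix q z assume q: "q \<in> Arr C" and z: "z \<in> el Z (Cod C q)"
    have z': "act Z q z \<in> el Z (Dom C q)" using q z Z by simp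
    have c: "\<alpha> (Cod C q) z \<in> el (Dom Sh m) (Cod C q)" using \<alpha> q z by simp
    \<comment> \<open>Naturality comes from uniqueness: the restriction of the chosen element
      satisfies the condition that characterises the element chosen for the restriction.\<close>
    show "\<alpha> (Dom C q) (act Z q z) = act (Dom Sh m) q (\<alpha> (Cod C q) z)"
      unfolding \<alpha>_def[of "Dom C q"]
    proof (rule the1_equality[OF ex1])
      show "act (Dom Sh m) q (\<alpha> (Cod C q) z) \<in> el (Dom Sh m) (Dom C q) \<and>
        ap m (Dom C q) (act (Dom Sh m) q (\<alpha> (Cod C q) z)) = ap x (Dom C q) (act Z q z) \<and>
        ap f (Dom C q) (act (Dom Sh m) q (\<alpha> (Cod C q) z)) = ap y (Dom C q) (act Z q z)"
        using c q z sh \<alpha>[of "Cod C q" z] ap_act[OF h(1) q c] ap_act[OF h(2) q c]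
          ap_act[OF x q z] ap_act[OF y q z] by simp
    qed (use q z' in simp_all)
  qed
  define k where "k = mkA Z (Dom Sh m) \<alpha>"
  have k: "k \<in> Hom Sh Z (Dom Sh m)" unfolding k_def using Z sh nat by (intro mkA_Hom)
  have "m \<cdot>\<^bsub>Sh\<^esub> k = x"
    by (rule Sh_ext[OF Sh_comp_Hom[OF k h(1)] x]) (simp add: ap_comp[OF k h(1)], simp add: k_def \<alpha>)
  moreover have "f \<cdot>\<^bsub>Sh\<^esub> k = y"
    by (rule Sh_ext[OF Sh_comp_Hom[OF k h(2)] y]) (simp add: ap_comp[OF k h(2)], simp add: k_def \<alpha>)
  ultimately show "\<exists>k. k \<in> Arr Sh \<and> Dom Sh k = Dom Sh x \<and> Cod Sh k = Dom Sh m \<and>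
      m \<cdot>\<^bsub>Sh\<^esub> k = x \<and> f \<cdot>\<^bsub>Sh\<^esub> k = y"
    using k by (intro exI[of _ k]) (simp add: Hom_def Z_def)
next
  note h = Sh_squareD[OF s]
  fix u v assume uv: "u \<in> Arr Sh" "v \<in> Arr Sh" "Dom Sh u = Dom Sh v" "Cod Sh u = Dom Sh m"
    "Cod Sh v = Dom Sh m" "m \<cdot>\<^bsub>Sh\<^esub> u = m \<cdot>\<^bsub>Sh\<^esub> v" "f \<cdot>\<^bsub>Sh\<^esub> u = f \<cdot>\<^bsub>Sh\<^esub> v"
  have u: "u \<in> Hom Sh (Dom Sh v) (Dom Sh m)" and v: "v \<in> Hom Sh (Dom Sh v) (Dom Sh m)"
    using uv by (auto simp: Hom_def)
  show "u = v"
  proof (rule Sh_ext[OF u v])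
    fix X z assume z: "X \<in> Obj C" "z \<in> el (Dom Sh v) X"
    have em: "ap m X (ap u X z) = ap m X (ap v X z)"
      using ap_comp[OF u h(1) z] ap_comp[OF v h(1) z] uv by simp
    have ef: "ap f X (ap u X z) = ap f X (ap v X z)"
      using ap_comp[OF u h(2) z] ap_comp[OF v h(2) z] uv by simp
    have c: "ap v X z \<in> el (Dom Sh m) X" "ap u X z \<in> el (Dom Sh m) X" using u v z by simp_all
    have "\<exists>!c. c \<in> el (Dom Sh m) X \<and> ap m X c = ap m X (ap v X z) \<and> ap f X c = ap f X (ap v X z)"
      by (rule p) (use z c h Sh_square_ap[OF s, of X "ap v X z"] in auto)
    then show "ap u X z = ap v X z" using c em ef by blast
  qed
qed

definition one :: 'u where
  "one = mkP (\<lambda>_. {code {}}) (\<lambda>_ x. x)"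

lemma sheaf_one [simp]: "sheaf one"
  unfolding one_def by (rule sheaf_mkP) auto

lemma el_one [simp]: "X \<in> Obj C \<Longrightarrow> el one X = {code {}}"
  unfolding one_def by (rule el_mkP) auto

lemma act_one [simp]: "f \<in> Arr C \<Longrightarrow> act one f (code {}) = code {}"
  unfolding one_def by (subst act_mkP) auto

lemma terminal_one: "is_terminal Sh one"
  unfolding is_terminal_def
proof (intro conjI ballI)
  fix F assume "F \<in> Obj Sh"
  then have F: "sheaf F" by simp
  show "\<exists>!k. k \<in> Hom Sh F one"
  proof (rule ex1I)
    show k: "mkA F one (\<lambda>_ _. code {}) \<in> Hom Sh F one"
      by (rule mkA_Hom) (use F in \<open>auto simp: natural_def\<close>)
    show "h = mkA F one (\<lambda>_ _. code {})" if h: "h \<in> Hom Sh F one" for h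
      by (rule Sh_ext[OF h k]) (use ap_el[OF h] in force)
  qed
qed simp

text \<open>Products and pullbacks are both sheaves of pairs satisfying a local condition.\<close>

definition pairs :: "'u \<Rightarrow> 'u \<Rightarrow> ('o \<Rightarrow> 'u \<Rightarrow> 'u \<Rightarrow> bool) \<Rightarrow> 'u" where
  "pairs A B \<rho> = mkP (\<lambda>X. {z \<in> prods (el A X) (el B X). \<rho> X (fstc z) (sndc z)})
                    (\<lambda>f z. pr (act A f (fstc z)) (act B f (sndc z)))"

text \<open>What a relation on \<open>A\<close> and \<open>B\<close> must satisfy in order to cut
  out a subsheaf of the product: it passes to restrictions and may be tested on the two legs of a
  covering square.\<close>

definition local_rel :: "'u \<Rightarrow> 'u \<Rightarrow> ('o \<Rightarrow> 'u \<Rightarrow> 'u \<Rightarrow> bool) \<Rightarrow> bool" where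
  "local_rel A B \<rho> \<longleftrightarrow>
    (\<forall>f\<in>Arr C. \<forall>a\<in>el A (Cod C f). \<forall>b\<in>el B (Cod C f). \<rho> (Cod C f) a b \<longrightarrow>
      \<rho> (Dom C f) (act A f a) (act B f b)) \<and>
    (\<forall>m f g n. cov m f g n \<longrightarrow> (\<forall>a\<in>el A (Cod C g). \<forall>b\<in>el B (Cod C g).
      \<rho> (Dom C g) (act A g a) (act B g b) \<and> \<rho> (Dom C n) (act A n a) (act B n b) \<longrightarrow> \<rho> (Cod C g) a b))"

lemma is_set_pairs [simp]: "is_set {z \<in> prods (el A X) (el B X). P z}"
  by (rule is_set_subset[of "prods (el A X) (el B X)"]) auto

lemma el_pairs: "X \<in> Obj C \<Longrightarrow>
    el (pairs A B \<rho>) X = {z \<in> prods (el A X) (el B X). \<rho> X (fstc z) (sndc z)}"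
  unfolding pairs_def by (rule el_mkP) simp_all

lemma pr_el_pairs [simp]: "X \<in> Obj C \<Longrightarrow> pr a b \<in> el (pairs A B \<rho>) X \<longleftrightarrow> a \<in> el A X \<and> b \<in> el B X \<and> \<rho> X a b"
  by (simp add: el_pairs)

lemma el_pairsE:
  assumes "z \<in> el (pairs A B \<rho>) X" "X \<in> Obj C"
  obtains a b where "z = pr a b" "a \<in> el A X" "b \<in> el B X" "\<rho> X a b"
  using assms by (auto simp: el_pairs elim: in_prodsE)

lemma act_pairs [simp]: "f \<in> Arr C \<Longrightarrow> Cod C f = X \<Longrightarrow> a \<in> el A X \<Longrightarrow> b \<in> el B X \<Longrightarrow> \<rho> X a b \<Longrightarrow>
    act (pairs A B \<rho>) f (pr a b) = pr (act A f a) (act B f b)"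
  unfolding pairs_def by (subst act_mkP) auto

lemma sheaf_pairs [simp]:
  assumes A: "sheaf A" and B: "sheaf B" and \<rho>: "local_rel A B \<rho>"
  shows "sheaf (pairs A B \<rho>)"
  unfolding pairs_def
proof (rule sheaf_mkP)
  fix m f g n assume c: "cov m f g n"
  note [simp] = covD(1-5)[OF c] covD(8)[OF c]
  have [simp]: "Dom C g = Cod C m" "Dom C n = Cod C f" using covD[OF c] by auto
  show "\<exists>z\<in>{z \<in> prods (el A (Cod C g)) (el B (Cod C g)). \<rho> (Cod C g) (fstc z) (sndc z)}.
      pr (act A g (fstc z)) (act B g (sndc z)) = x \<and> pr (act A n (fstc z)) (act B n (sndc z)) = y"
    if x: "x \<in> {z \<in> prods (el A (Dom C g)) (el B (Dom C g)). \<rho> (Dom C g) (fstc z) (sndc z)}"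
      and y: "y \<in> {z \<in> prods (el A (Dom C n)) (el B (Dom C n)). \<rho> (Dom C n) (fstc z) (sndc z)}"
      and e: "pr (act A m (fstc x)) (act B m (sndc x)) = pr (act A f (fstc y)) (act B f (sndc y))" for x y
  proof -
    obtain a b where x': "x = pr a b" "a \<in> el A (Dom C g)" "b \<in> el B (Dom C g)" "\<rho> (Dom C g) a b"
      using x by (auto elim: in_prodsE)
    obtain a' b' where y': "y = pr a' b'" "a' \<in> el A (Dom C n)" "b' \<in> el B (Dom C n)" "\<rho> (Dom C n) a' b'"
      using y by (auto elim: in_prodsE)
    have "act A m a = act A f a'" "act B m b = act B f b'" using e x' y' by simp_all
    obtain p where p: "p \<in> el A (Cod C g)" "act A g p = a" "act A n p = a'"
      by (rule sheaf_glue[OF A c x'(2) y'(2) \<open>act A m a = act A f a'\<close>])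
    obtain q where q: "q \<in> el B (Cod C g)" "act B g q = b" "act B n q = b'"
      by (rule sheaf_glue[OF B c x'(3) y'(3) \<open>act B m b = act B f b'\<close>])
    have "\<rho> (Cod C g) p q" using \<rho> c p q x' y' unfolding local_rel_def by blast
    then show ?thesis using p q x' y' by (intro bexI[of _ "pr p q"]) simp_all
  qed
  show "z = z'" if z: "z \<in> {z \<in> prods (el A (Cod C g)) (el B (Cod C g)). \<rho> (Cod C g) (fstc z) (sndc z)}"
      "z' \<in> {z \<in> prods (el A (Cod C g)) (el B (Cod C g)). \<rho> (Cod C g) (fstc z) (sndc z)}"
      "pr (act A g (fstc z)) (act B g (sndc z)) = pr (act A g (fstc z')) (act B g (sndc z'))"
      "pr (act A n (fstc z)) (act B n (sndc z)) = pr (act A n (fstc z')) (act B n (sndc z'))" for z z'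
    using z by (auto elim!: in_prodsE intro: sheaf_eq[OF A c] sheaf_eq[OF B c])
qed (use A B \<rho> in \<open>auto simp: local_rel_def act_comp elim!: in_prodsE\<close>)

definition proj1 :: "'u \<Rightarrow> 'u \<Rightarrow> ('o \<Rightarrow> 'u \<Rightarrow> 'u \<Rightarrow> bool) \<Rightarrow> 'u" where
  "proj1 A B \<rho> = mkA (pairs A B \<rho>) A (\<lambda>X. fstc)"

definition proj2 :: "'u \<Rightarrow> 'u \<Rightarrow> ('o \<Rightarrow> 'u \<Rightarrow> 'u \<Rightarrow> bool) \<Rightarrow> 'u" where
  "proj2 A B \<rho> = mkA (pairs A B \<rho>) B (\<lambda>X. sndc)"

lemma proj_Hom [simp]:
  assumes "sheaf A" "sheaf B" "local_rel A B \<rho>"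
  shows "proj1 A B \<rho> \<in> Hom Sh (pairs A B \<rho>) A" "proj2 A B \<rho> \<in> Hom Sh (pairs A B \<rho>) B"
  unfolding proj1_def proj2_def
  by (rule mkA_Hom; use assms in \<open>auto simp: natural_def elim!: el_pairsE\<close>)+

lemma ap_proj [simp]:
  assumes "X \<in> Obj C" "a \<in> el A X" "b \<in> el B X" "\<rho> X a b"
  shows "ap (proj1 A B \<rho>) X (pr a b) = a" "ap (proj2 A B \<rho>) X (pr a b) = b"
  using assms by (simp_all add: proj1_def proj2_def)

lemma has_pullbacks_Sh: "has_pullbacks Sh"
  unfolding has_pullbacks_def
proof (intro ballI impI)
  fix g n assume gn: "g \<in> Arr Sh" "n \<in> Arr Sh" "Cod Sh g = Cod Sh n"
  define A B D where "A = Dom Sh g" and "B = Dom Sh n" and "D = Cod Sh g"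
  have g: "g \<in> Hom Sh A D" and n: "n \<in> Hom Sh B D" using gn by (auto simp: A_def B_def D_def Hom_def)
  note sh = Hom_natural(1,2)[OF g] Hom_natural(1,2)[OF n]
  define \<rho> where "\<rho> X a b \<longleftrightarrow> ap g X a = ap n X b" for X a b
  have \<rho>: "local_rel A B \<rho>"
    unfolding local_rel_def
  proof (intro conjI ballI allI impI)
    show "\<rho> (Dom C f) (act A f a) (act B f b)"
      if "f \<in> Arr C" "a \<in> el A (Cod C f)" "b \<in> el B (Cod C f)" "\<rho> (Cod C f) a b" for f a b
      using that by (simp add: \<rho>_def ap_act[OF g] ap_act[OF n])
    \<comment> \<open>An equation between elements of the sheaf \<open>D\<close> holds once it holds
      on both legs, which makes the relation local.\<close>
    show "\<rho> (Cod C s) a b" if c: "cov m f s t" and "a \<in> el A (Cod C s)" "b \<in> el B (Cod C s)"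
      "\<rho> (Dom C s) (act A s a) (act B s b) \<and> \<rho> (Dom C t) (act A t a) (act B t b)" for m f s t a b
      unfolding \<rho>_def
      by (rule sheaf_eq[OF sh(2) c])
        (use that covD[OF c] g n ap_act[OF g, of s a] ap_act[OF n, of s b] ap_act[OF g, of t a] ap_act[OF n, of t b]
         in \<open>auto simp: \<rho>_def\<close>)
  qed
  note p = proj_Hom[OF sh(1,3) \<rho>]
  have "is_pullback Sh (proj1 A B \<rho>) (proj2 A B \<rho>) g n"
  proof (rule pullback_pointwiseI)
    show "comm_square Sh (proj1 A B \<rho>) (proj2 A B \<rho>) g n"
      by (rule Sh_squareI[OF p g n]) (auto simp: \<rho>_def elim!: el_pairsE)
    fix X a b assume ab: "X \<in> Obj C" "a \<in> el (Dom Sh g) X" "b \<in> el (Dom Sh n) X" "ap g X a = ap n X b"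
    have d: "Dom Sh (proj1 A B \<rho>) = pairs A B \<rho>" using p by (simp add: Hom_def)
    show "\<exists>!c. c \<in> el (Dom Sh (proj1 A B \<rho>)) X \<and> ap (proj1 A B \<rho>) X c = a \<and> ap (proj2 A B \<rho>) X c = b"
      unfolding d by (rule ex1I[of _ "pr a b"])
        (use ab in \<open>auto simp: A_def[symmetric] B_def[symmetric] \<rho>_def elim!: el_pairsE\<close>)
  qed
  then show "\<exists>m f. is_pullback Sh m f g n" by blast
qed

abbreviation top_rel :: "'o \<Rightarrow> 'u \<Rightarrow> 'u \<Rightarrow> bool" where
  "top_rel \<equiv> \<lambda>_ _ _. True"

lemma local_top [simp]: "local_rel A B top_rel"
  by (simp add: local_rel_def)

lemma product_pairs:
  assumes A: "sheaf A" and B: "sheaf B"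
  shows "is_product Sh A B (pairs A B top_rel) (proj1 A B top_rel) (proj2 A B top_rel)"
  unfolding is_product_def
proof (intro conjI allI ballI)
  note p = proj_Hom[OF A B local_top]
  show "proj1 A B top_rel \<in> Hom Sh (pairs A B top_rel) A" "proj2 A B top_rel \<in> Hom Sh (pairs A B top_rel) B"
    using p by simp_all
  fix Z x y assume x: "x \<in> Hom Sh Z A" and y: "y \<in> Hom Sh Z B"
  have Z: "sheaf Z" using Hom_natural[OF x] by simp
  define k where "k = mkA Z (pairs A B top_rel) (\<lambda>X z. pr (ap x X z) (ap y X z))"
  have k: "k \<in> Hom Sh Z (pairs A B top_rel)"
    unfolding k_def using x y Z A B
    by (intro mkA_Hom) (auto simp: natural_def ap_act[OF x] ap_act[OF y])
  show "\<exists>!k. k \<in> Hom Sh Z (pairs A B top_rel) \<and> proj1 A B top_rel \<cdot>\<^bsub>Sh\<^esub> k = x \<and> proj2 A B top_rel \<cdot>\<^bsub>Sh\<^esub> k = y"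
  proof (rule ex1I[of _ k], intro conjI k)
    show "proj1 A B top_rel \<cdot>\<^bsub>Sh\<^esub> k = x"
      by (rule Sh_ext[OF Sh_comp_Hom[OF k p(1)] x])
        (use x y in \<open>simp add: ap_comp[OF k p(1)]\<close>, use x y in \<open>simp add: k_def\<close>)
    show "proj2 A B top_rel \<cdot>\<^bsub>Sh\<^esub> k = y"
      by (rule Sh_ext[OF Sh_comp_Hom[OF k p(2)] y])
        (use x y in \<open>simp add: ap_comp[OF k p(2)]\<close>, use x y in \<open>simp add: k_def\<close>)
    fix l assume l: "l \<in> Hom Sh Z (pairs A B top_rel) \<and> proj1 A B top_rel \<cdot>\<^bsub>Sh\<^esub> l = x \<and> proj2 A B top_rel \<cdot>\<^bsub>Sh\<^esub> l = y"
    then have lH: "l \<in> Hom Sh Z (pairs A B top_rel)" by simp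
    show "l = k"
    proof (rule Sh_ext[OF lH k])
      fix X z assume z: "X \<in> Obj C" "z \<in> el Z X"
      obtain a b where ab: "ap l X z = pr a b" "a \<in> el A X" "b \<in> el B X"
        using ap_el[OF lH z] z by (auto elim: el_pairsE)
      have "a = ap x X z" using ap_comp[OF lH p(1) z] l ab z by simp
      moreover have "b = ap y X z" using ap_comp[OF lH p(2) z] l ab z by simp
      ultimately show "ap l X z = ap k X z" using ab z by (simp add: k_def)
    qed
  qed
qed

text \<open>Exponentials are tested against every product of \<open>Z\<close> and \<open>A\<close>,
  not only the one built from pairs, so the pointwise form is needed for an arbitrary product cone.
  As for pullbacks, it is tested on \<open>rep X\<close>.\<close>

lemma product_pointwise:
  assumes p: "is_product Sh A B P p q" and X: "X \<in> Obj C" and a: "a \<in> el A X" and b: "b \<in> el B X"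
  shows "\<exists>!c. c \<in> el P X \<and> ap p X c = a \<and> ap q X c = b"
proof -
  have h: "p \<in> Hom Sh P A" "q \<in> Hom Sh P B" and
    u: "\<And>Z x y. x \<in> Hom Sh Z A \<Longrightarrow> y \<in> Hom Sh Z B \<Longrightarrow> \<exists>!k. k \<in> Hom Sh Z P \<and> p \<cdot>\<^bsub>Sh\<^esub> k = x \<and> q \<cdot>\<^bsub>Sh\<^esub> k = y"
    using p by (auto simp: is_product_def)
  note sh = Hom_natural(1,2)[OF h(1)] Hom_natural(2)[OF h(2)]
  have "yarr A X a \<in> Hom Sh (rep X) A" "yarr B X b \<in> Hom Sh (rep X) B" using sh X a b by simp_all
  from u[OF this] obtain k where k: "k \<in> Hom Sh (rep X) P" "p \<cdot>\<^bsub>Sh\<^esub> k = yarr A X a" "q \<cdot>\<^bsub>Sh\<^esub> k = yarr B X b"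
    and un: "\<And>l. l \<in> Hom Sh (rep X) P \<Longrightarrow> p \<cdot>\<^bsub>Sh\<^esub> l = yarr A X a \<Longrightarrow> q \<cdot>\<^bsub>Sh\<^esub> l = yarr B X b \<Longrightarrow> l = k"
    by blast
  obtain c where c: "c \<in> el P X" "k = yarr P X c" by (rule yarr_ex[OF k(1) X])
  have e: "yarr A X (ap p X c) = yarr A X a" "yarr B X (ap q X c) = yarr B X b"
    using k comp_yarr[OF h(1) X c(1)] comp_yarr[OF h(2) X c(1)] c by simp_all
  show ?thesis
  proof (rule ex1I[of _ c])
    show "c \<in> el P X \<and> ap p X c = a \<and> ap q X c = b"
      using c yarr_inject[OF sh(2) X _ a e(1)] yarr_inject[OF sh(3) X _ b e(2)] ap_el[OF h(1) X] ap_el[OF h(2) X]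
      by simp
    fix d assume d: "d \<in> el P X \<and> ap p X d = a \<and> ap q X d = b"
    have "yarr P X d = k"
      by (rule un) (use d X sh comp_yarr[OF h(1) X, of d] comp_yarr[OF h(2) X, of d] in simp_all)
    then show "d = c" using yarr_inject[OF sh(1) X, of d c] c d by simp
  qed
qed

end

section \<open>Exponentials and the subobject classifier\<close>

context sheaves
begin

section \<open>Exponentials of sheaves\<close>

definition idx :: "'u \<Rightarrow> 'o \<Rightarrow> 'u set" where
  "idx A X = {pr (\<gamma> f) a |f a. f \<in> Arr C \<and> Cod C f = X \<and> a \<in> el A (Dom C f)}"

lemma is_set_total: "is_set (\<Union>i\<in>elts U. el A (Dom C (dec i)))"
  by (rule is_set_Union) simp_all

lemma is_set_idx [simp]: "is_set (idx A X)"
proof (rule is_set_subset[OF is_set_prods[OF is_set_elts[of U] is_set_total[of A]]], rule subsetI)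
  fix z assume "z \<in> idx A X"
  then obtain f a where f: "z = pr (\<gamma> f) a" "f \<in> Arr C" "a \<in> el A (Dom C f)"
    by (auto simp: idx_def)
  then have "a \<in> (\<Union>i\<in>elts U. el A (Dom C (dec i)))" by (intro UN_I[of "\<gamma> f"]) simp_all
  then show "z \<in> prods (elts U) (\<Union>i\<in>elts U. el A (Dom C (dec i)))" using f by simp
qed

text \<open>Such a family is a natural transformation from the product of \<open>rep X\<close> and
  \<open>A\<close> to \<open>B\<close>. By the Yoneda lemma these must be the elements of the
  exponential at \<open>X\<close>; \<open>idx A X\<close> is the set of elements on which one is
  tabulated.\<close>

definition family :: "'u \<Rightarrow> 'u \<Rightarrow> 'o \<Rightarrow> ('a \<Rightarrow> 'u \<Rightarrow> 'u) \<Rightarrow> bool" where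
  "family A B X \<alpha> \<longleftrightarrow> (\<forall>f\<in>Arr C. Cod C f = X \<longrightarrow> (\<forall>a\<in>el A (Dom C f). \<alpha> f a \<in> el B (Dom C f) \<and>
     (\<forall>k\<in>Arr C. Cod C k = Dom C f \<longrightarrow> \<alpha> (f \<cdot> k) (act A k a) = act B k (\<alpha> f a))))"

definition fcode :: "'u \<Rightarrow> 'o \<Rightarrow> ('a \<Rightarrow> 'u \<Rightarrow> 'u) \<Rightarrow> 'u" where
  "fcode A X \<alpha> = lam (idx A X) (\<lambda>z. \<alpha> (dec (fstc z)) (sndc z))"

definition ev1 :: "'u \<Rightarrow> 'a \<Rightarrow> 'u \<Rightarrow> 'u" where
  "ev1 u f a = app u (pr (\<gamma> f) a)"

lemma pr_in_idx: "f \<in> Arr C \<Longrightarrow> Cod C f = X \<Longrightarrow> a \<in> el A (Dom C f) \<Longrightarrow> pr (\<gamma> f) a \<in> idx A X"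
  by (auto simp: idx_def)

lemma ev1_fcode [simp]:
  "f \<in> Arr C \<Longrightarrow> Cod C f = X \<Longrightarrow> a \<in> el A (Dom C f) \<Longrightarrow> ev1 (fcode A X \<alpha>) f a = \<alpha> f a"
  by (simp add: ev1_def fcode_def pr_in_idx)

lemma fcode_cong:
  "(\<And>f a. f \<in> Arr C \<Longrightarrow> Cod C f = X \<Longrightarrow> a \<in> el A (Dom C f) \<Longrightarrow> \<alpha> f a = \<beta> f a) \<Longrightarrow>
    fcode A X \<alpha> = fcode A X \<beta>"
  unfolding fcode_def by (rule lam_cong) (auto simp: idx_def)

definition expo :: "'u \<Rightarrow> 'u \<Rightarrow> 'u" where
  "expo A B = mkP (\<lambda>X. {fcode A X \<alpha> |\<alpha>. family A B X \<alpha>})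
    (\<lambda>h u. fcode A (Dom C h) (\<lambda>f a. ev1 u (h \<cdot> f) a))"

lemma is_set_fcodes [simp]: "is_set {fcode A X \<alpha> |\<alpha>. family A B X \<alpha>}"
proof (rule is_set_subset)
  show "is_set {lam (idx A X) \<phi> |\<phi>. (\<forall>x\<in>idx A X. \<phi> x \<in> (\<Union>i\<in>elts U. el B (Dom C (dec i)))) \<and> True}"
    by (rule is_set_lam[OF is_set_idx is_set_total])
  show "{fcode A X \<alpha> |\<alpha>. family A B X \<alpha>} \<subseteq>
    {lam (idx A X) \<phi> |\<phi>. (\<forall>x\<in>idx A X. \<phi> x \<in> (\<Union>i\<in>elts U. el B (Dom C (dec i)))) \<and> True}"
  proof clarify
    fix \<alpha> assume f: "family A B X \<alpha>"
    have "\<alpha> (dec (fstc z)) (sndc z) \<in> (\<Union>i\<in>elts U. el B (Dom C (dec i)))" if z: "z \<in> idx A X" for z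
    proof -
      obtain q a where q: "z = pr (\<gamma> q) a" "q \<in> Arr C" "Cod C q = X" "a \<in> el A (Dom C q)"
        using z by (auto simp: idx_def)
      then have "\<alpha> q a \<in> el B (Dom C q)" using f unfolding family_def by blast
      then show ?thesis using q by (intro UN_I[of "\<gamma> q"]) simp_all
    qed
    then show "\<exists>\<phi>. fcode A X \<alpha> = lam (idx A X) \<phi> \<and>
        (\<forall>x\<in>idx A X. \<phi> x \<in> (\<Union>i\<in>elts U. el B (Dom C (dec i)))) \<and> True"
      unfolding fcode_def by blast
  qed
qed

lemma el_expo: "X \<in> Obj C \<Longrightarrow> el (expo A B) X = {fcode A X \<alpha> |\<alpha>. family A B X \<alpha>}"
  unfolding expo_def by (rule el_mkP) simp_all

lemma act_expo: "h \<in> Arr C \<Longrightarrow> u \<in> el (expo A B) (Cod C h) \<Longrightarrow>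
    act (expo A B) h u = fcode A (Dom C h) (\<lambda>f a. ev1 u (h \<cdot> f) a)"
  by (simp add: el_expo) (simp add: expo_def act_mkP)

lemma familyD:
  assumes "family A B X \<alpha>" "f \<in> Arr C" "Cod C f = X" "a \<in> el A (Dom C f)"
  shows "\<alpha> f a \<in> el B (Dom C f)"
    and "k \<in> Arr C \<Longrightarrow> Cod C k = Dom C f \<Longrightarrow> \<alpha> (f \<cdot> k) (act A k a) = act B k (\<alpha> f a)"
  using assms by (auto simp: family_def)

lemma family_ev1:
  assumes A: "sheaf A" and u: "u \<in> {fcode A X \<alpha> |\<alpha>. family A B X \<alpha>}"
  shows "family A B X (ev1 u)" "u = fcode A X (ev1 u)"
proof -
  obtain \<alpha> where a: "u = fcode A X \<alpha>" "family A B X \<alpha>" using u by blast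
  show "family A B X (ev1 u)" unfolding family_def a(1)
    using familyD[OF a(2)] A by simp
  show "u = fcode A X (ev1 u)" using a by (auto intro!: fcode_cong)
qed

lemma family_restrict:
  assumes A: "sheaf A" and f: "family A B X \<alpha>" and h: "h \<in> Arr C" "Cod C h = X"
  shows "family A B (Dom C h) (\<lambda>f a. \<alpha> (h \<cdot> f) a)"
  unfolding family_def
proof (intro ballI impI conjI)
  fix q a assume q: "q \<in> Arr C" "Cod C q = Dom C h" "a \<in> el A (Dom C q)"
  show "\<alpha> (h \<cdot> q) a \<in> el B (Dom C q)" using familyD(1)[OF f, of "h \<cdot> q" a] q h by simp
  show "\<alpha> (h \<cdot> (q \<cdot> k)) (act A k a) = act B k (\<alpha> (h \<cdot> q) a)" if "k \<in> Arr C" "Cod C k = Dom C q" for k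
    using familyD(2)[OF f, of "h \<cdot> q" a k] q h that by simp
qed

text \<open>Both sheaf conditions reduce to those of \<open>B\<close>. An arrow \<open>h\<close>
  into the final corner pulls the covering square back to one on the domain of \<open>h\<close>, and
  the value of a family at \<open>h\<close> is determined by its values along the two legs found
  there.\<close>

lemma sheaf_expo:
  assumes A: "sheaf A" and B: "sheaf B"
  shows "sheaf (expo A B)"
  unfolding expo_def
proof (rule sheaf_mkP)
  show "fcode A (Dom C h) (\<lambda>f a. ev1 u (h \<cdot> f) a) \<in> {fcode A (Dom C h) \<alpha> |\<alpha>. family A B (Dom C h) \<alpha>}"
    if "h \<in> Arr C" "u \<in> {fcode A (Cod C h) \<alpha> |\<alpha>. family A B (Cod C h) \<alpha>}" for h u
    using family_restrict[OF A family_ev1(1)[OF A that(2)]] that(1) by blast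
  show "fcode A (Dom C (Id C X)) (\<lambda>f a. ev1 u (Id C X \<cdot> f) a) = u"
    if "X \<in> Obj C" "u \<in> {fcode A X \<alpha> |\<alpha>. family A B X \<alpha>}" for X u
    using family_ev1(2)[OF A that(2)] that(1) fcode_cong[of X A "\<lambda>f a. ev1 u (Id C X \<cdot> f) a" "ev1 u"] by simp
  show "fcode A (Dom C (g \<cdot> f)) (\<lambda>q a. ev1 u ((g \<cdot> f) \<cdot> q) a) =
      fcode A (Dom C f) (\<lambda>q a. ev1 (fcode A (Dom C g) (\<lambda>q a. ev1 u (g \<cdot> q) a)) (f \<cdot> q) a)"
    if "f \<in> Arr C" "g \<in> Arr C" "Cod C f = Dom C g" for f g u
    using that by (auto intro!: fcode_cong)
next
  fix m f g n z z' assume c: "cov m f g n"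
    and z: "z \<in> {fcode A (Cod C g) \<alpha> |\<alpha>. family A B (Cod C g) \<alpha>}"
    and z': "z' \<in> {fcode A (Cod C g) \<alpha> |\<alpha>. family A B (Cod C g) \<alpha>}"
    and eg: "fcode A (Dom C g) (\<lambda>f a. ev1 z (g \<cdot> f) a) = fcode A (Dom C g) (\<lambda>f a. ev1 z' (g \<cdot> f) a)"
    and en: "fcode A (Dom C n) (\<lambda>f a. ev1 z (n \<cdot> f) a) = fcode A (Dom C n) (\<lambda>f a. ev1 z' (n \<cdot> f) a)"
  note fz = family_ev1[OF A z] and fz' = family_ev1[OF A z']
  have eg': "ev1 z (g \<cdot> q) a = ev1 z' (g \<cdot> q) a"
    if "q \<in> Arr C" "Cod C q = Dom C g" "a \<in> el A (Dom C q)" for q a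
    using arg_cong[OF eg, of "\<lambda>w. ev1 w q a"] that by simp
  have en': "ev1 z (n \<cdot> q) a = ev1 z' (n \<cdot> q) a"
    if "q \<in> Arr C" "Cod C q = Dom C n" "a \<in> el A (Dom C q)" for q a
    using arg_cong[OF en, of "\<lambda>w. ev1 w q a"] that by simp
  show "z = z'"
  proof (rule trans[OF fz(2) trans[OF _ fz'(2)[symmetric]]], rule fcode_cong)
    fix h x assume h: "h \<in> Arr C" "Cod C h = Cod C g" "x \<in> el A (Dom C h)"
    obtain m' f' g' n' a b c' where s: "cov m' f' g' n'" "is_pullback C g' a h g" "is_pullback C n' b h n"
      using cov_stable[OF c h(1,2)] by blast
    note G = comm_squareD[OF pullback_square[OF s(2)]] and N = comm_squareD[OF pullback_square[OF s(3)]]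
    note S = covD[OF s(1)]
    have d: "Cod C g' = Dom C h" "Cod C n' = Dom C h" "Cod C a = Dom C g" "Cod C b = Dom C n"
      "Dom C a = Dom C g'" "Dom C b = Dom C n'"
      using G N by auto
    have "act B g' (ev1 z h x) = ev1 z (h \<cdot> g') (act A g' x)"
      using familyD(2)[OF fz(1) h, of g'] G d by simp
    also have "\<dots> = ev1 z' (h \<cdot> g') (act A g' x)"
      using eg'[of a "act A g' x"] A G d h by simp
    also have "\<dots> = act B g' (ev1 z' h x)"
      using familyD(2)[OF fz'(1) h, of g'] G d by simp
    finally have 1: "act B g' (ev1 z h x) = act B g' (ev1 z' h x)" .
    have "act B n' (ev1 z h x) = ev1 z (h \<cdot> n') (act A n' x)"
      using familyD(2)[OF fz(1) h, of n'] N d by simp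
    also have "\<dots> = ev1 z' (h \<cdot> n') (act A n' x)"
      using en'[of b "act A n' x"] A N d h by simp
    also have "\<dots> = act B n' (ev1 z' h x)"
      using familyD(2)[OF fz'(1) h, of n'] N d by simp
    finally have 2: "act B n' (ev1 z h x) = act B n' (ev1 z' h x)" .
    show "ev1 z h x = ev1 z' h x"
      by (rule sheaf_eq[OF B s(1) 1 2]) (use familyD(1)[OF fz(1) h] familyD(1)[OF fz'(1) h] d in simp_all)
  qed
next
  fix m f g n u v assume c: "cov m f g n"
    and u: "u \<in> {fcode A (Dom C g) \<alpha> |\<alpha>. family A B (Dom C g) \<alpha>}"
    and v: "v \<in> {fcode A (Dom C n) \<alpha> |\<alpha>. family A B (Dom C n) \<alpha>}"
    and uv: "fcode A (Dom C m) (\<lambda>q a. ev1 u (m \<cdot> q) a) = fcode A (Dom C f) (\<lambda>q a. ev1 v (f \<cdot> q) a)"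
  note fu = family_ev1[OF A u] and fv = family_ev1[OF A v]
  note S = covD[OF c]
  have uv': "ev1 u (m \<cdot> q) a = ev1 v (f \<cdot> q) a"
    if "q \<in> Arr C" "Cod C q = Dom C m" "a \<in> el A (Dom C q)" for q a
    using arg_cong[OF uv, of "\<lambda>w. ev1 w q a"] that S by simp
  \<comment> \<open>The value wanted at \<open>h\<close> and \<open>x\<close> is characterised by
    its restrictions along all \<open>k\<close> for which \<open>h \<cdot> k\<close> factors through
    a leg, not along one chosen pulled-back square. Naturality in \<open>h\<close> then follows from
    uniqueness, with no choices to compare.\<close>
  define spec where "spec h x z \<longleftrightarrow> z \<in> el B (Dom C h) \<and>
    (\<forall>k r. k \<in> Arr C \<and> r \<in> Arr C \<and> Cod C k = Dom C h \<and> Cod C r = Dom C g \<and> Dom C r = Dom C k \<and> h \<cdot> k = g \<cdot> r \<longrightarrow>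
      act B k z = ev1 u r (act A k x)) \<and>
    (\<forall>k r. k \<in> Arr C \<and> r \<in> Arr C \<and> Cod C k = Dom C h \<and> Cod C r = Dom C n \<and> Dom C r = Dom C k \<and> h \<cdot> k = n \<cdot> r \<longrightarrow>
      act B k z = ev1 v r (act A k x))" for h x z
  have specD:
    "k \<in> Arr C \<Longrightarrow> r \<in> Arr C \<Longrightarrow> Cod C k = Dom C h \<Longrightarrow> Cod C r = Dom C g \<Longrightarrow> Dom C r = Dom C k \<Longrightarrow>
      h \<cdot> k = g \<cdot> r \<Longrightarrow> act B k z = ev1 u r (act A k x)"
    "k \<in> Arr C \<Longrightarrow> r \<in> Arr C \<Longrightarrow> Cod C k = Dom C h \<Longrightarrow> Cod C r = Dom C n \<Longrightarrow> Dom C r = Dom C k \<Longrightarrow>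
      h \<cdot> k = n \<cdot> r \<Longrightarrow> act B k z = ev1 v r (act A k x)"
    if "spec h x z" for h x z k r
    using that unfolding spec_def by blast+
  have ex1: "\<exists>!z. spec h x z" if h: "h \<in> Arr C" "Cod C h = Cod C g" and x: "x \<in> el A (Dom C h)" for h x
  proof -
    obtain m' f' g' n' a b c' where s: "cov m' f' g' n'" "is_pullback C g' a h g" "is_pullback C n' b h n"
        "comm_square C m' c' a m" "comm_square C f' c' b f"
      using cov_stable[OF c h] by blast
    note G = comm_squareD[OF pullback_square[OF s(2)]] and N = comm_squareD[OF pullback_square[OF s(3)]]
    note P = covD[OF s(1)] and L = comm_squareD[OF s(4)] and R = comm_squareD[OF s(5)]
    have d: "Cod C g' = Dom C h" "Cod C n' = Dom C h" "Cod C a = Dom C g" "Cod C b = Dom C n"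
      "Dom C a = Dom C g'" "Dom C b = Dom C n'" "Cod C m' = Dom C g'" "Cod C f' = Dom C n'"
      "Dom C f' = Dom C m'" "Cod C c' = Dom C m" "Dom C c' = Dom C m'"
      using G N P L R by auto
    note arr = G(1-4) N(1-4) P(1-4) L(1-4) R(1-4)
    have 1: "ev1 u a (act A g' x) \<in> el B (Dom C g')"
      using familyD(1)[OF fu(1), of a "act A g' x"] A x arr d by simp
    have 2: "ev1 v b (act A n' x) \<in> el B (Dom C n')"
      using familyD(1)[OF fv(1), of b "act A n' x"] A x arr d by simp
    \<comment> \<open>The two local values agree over the corner because \<open>c'\<close> sends it
      to the corner of the given square, where \<open>u\<close> and \<open>v\<close> restrict to the
      same family.\<close>
    have "act B m' (ev1 u a (act A g' x)) = ev1 u (a \<cdot> m') (act A m' (act A g' x))"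
      using familyD(2)[OF fu(1), of a "act A g' x" m'] A x arr d by simp
    also have "\<dots> = ev1 u (m \<cdot> c') (act A (g' \<cdot> m') x)"
      using L(9) act_comp[OF A, of m' g' x] x arr d by simp
    also have "\<dots> = ev1 v (f \<cdot> c') (act A (n' \<cdot> f') x)"
      using uv'[of c' "act A (g' \<cdot> m') x"] P(9) A x arr d by simp
    also have "\<dots> = ev1 v (b \<cdot> f') (act A f' (act A n' x))"
      using R(9) act_comp[OF A, of f' n' x] x arr d by simp
    also have "\<dots> = act B f' (ev1 v b (act A n' x))"
      using familyD(2)[OF fv(1), of b "act A n' x" f'] A x arr d by simp
    finally have 3: "act B m' (ev1 u a (act A g' x)) = act B f' (ev1 v b (act A n' x))" .
    obtain z where z: "z \<in> el B (Cod C g')" "act B g' z = ev1 u a (act A g' x)" "act B n' z = ev1 v b (act A n' x)"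
      by (rule sheaf_glue[OF B s(1) 1 2 3])
    have z1: "z \<in> el B (Dom C h)" using z d by simp
    show ?thesis
    proof (rule ex1I[of _ z])
      show "spec h x z"
        unfolding spec_def
      proof (intro conjI allI impI z1)
        \<comment> \<open>Any factorisation through a leg passes through the pulled-back leg, so the
          values fixed there determine all the others.\<close>
        fix k r assume kr: "k \<in> Arr C \<and> r \<in> Arr C \<and> Cod C k = Dom C h \<and> Cod C r = Dom C g \<and>
          Dom C r = Dom C k \<and> h \<cdot> k = g \<cdot> r"
        then have "comm_square C k r h g" using h G by (simp add: comm_square_def)
        then obtain t where t: "t \<in> Arr C" "Dom C t = Dom C k" "Cod C t = Dom C g'" "g' \<cdot> t = k" "a \<cdot> t = r"
          by (rule pullback_factor[OF s(2)])
        have "act B k z = act B t (ev1 u a (act A g' x))"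
          using act_comp[OF B, of t g' z] t z1 z arr d by simp
        also have "\<dots> = ev1 u r (act A t (act A g' x))"
          using familyD(2)[OF fu(1), of a "act A g' x" t] t A x arr d by simp
        also have "\<dots> = ev1 u r (act A k x)" using act_comp[OF A, of t g' x] t x arr d by simp
        finally show "act B k z = ev1 u r (act A k x)" .
      next
        fix k r assume kr: "k \<in> Arr C \<and> r \<in> Arr C \<and> Cod C k = Dom C h \<and> Cod C r = Dom C n \<and>
          Dom C r = Dom C k \<and> h \<cdot> k = n \<cdot> r"
        then have "comm_square C k r h n" using h N by (simp add: comm_square_def)
        then obtain t where t: "t \<in> Arr C" "Dom C t = Dom C k" "Cod C t = Dom C n'" "n' \<cdot> t = k" "b \<cdot> t = r"
          by (rule pullback_factor[OF s(3)])
        have "act B k z = act B t (ev1 v b (act A n' x))"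
          using act_comp[OF B, of t n' z] t z1 z arr d by simp
        also have "\<dots> = ev1 v r (act A t (act A n' x))"
          using familyD(2)[OF fv(1), of b "act A n' x" t] t A x arr d by simp
        also have "\<dots> = ev1 v r (act A k x)" using act_comp[OF A, of t n' x] t x arr d by simp
        finally show "act B k z = ev1 v r (act A k x)" .
      qed
      fix w assume w: "spec h x w"
      show "w = z"
      proof (rule sheaf_eq[OF B s(1)])
        have "act B g' w = ev1 u a (act A g' x)"
          by (rule specD(1)[OF w]) (use G d in simp_all)
        then show "act B g' w = act B g' z" using z by simp
        have "act B n' w = ev1 v b (act A n' x)"
          by (rule specD(2)[OF w]) (use N d in simp_all)
        then show "act B n' w = act B n' z" using z by simp
      qed (use w z1 d in \<open>auto simp: spec_def\<close>)
    qed
  qed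
  define \<alpha> where "\<alpha> h x = (THE z. spec h x z)" for h x
  have \<alpha>: "spec h x (\<alpha> h x)" if "h \<in> Arr C" "Cod C h = Cod C g" "x \<in> el A (Dom C h)" for h x
    unfolding \<alpha>_def by (rule theI'[OF ex1[OF that]])
  have "family A B (Cod C g) \<alpha>"
    unfolding family_def
  proof (intro ballI impI conjI)
    fix h x assume h: "h \<in> Arr C" "Cod C h = Cod C g" "x \<in> el A (Dom C h)"
    note sp = \<alpha>[OF h]
    show "\<alpha> h x \<in> el B (Dom C h)" using sp by (simp add: spec_def)
    fix k assume k: "k \<in> Arr C" "Cod C k = Dom C h"
    have e: "act A r (act A k x) = act A (k \<cdot> r) x" if "r \<in> Arr C" "Cod C r = Dom C k" for r
      using act_comp[OF A, of r k x] that k h by simp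
    have e': "act B r (act B k (\<alpha> h x)) = act B (k \<cdot> r) (\<alpha> h x)" if "r \<in> Arr C" "Cod C r = Dom C k" for r
      using act_comp[OF B, of r k "\<alpha> h x"] that k sp by (simp add: spec_def)
    have "spec (h \<cdot> k) (act A k x) (act B k (\<alpha> h x))"
      unfolding spec_def
    proof (intro conjI allI impI)
      show "act B k (\<alpha> h x) \<in> el B (Dom C (h \<cdot> k))" using sp k h B by (simp add: spec_def)
      fix l r assume l: "l \<in> Arr C \<and> r \<in> Arr C \<and> Cod C l = Dom C (h \<cdot> k) \<and> Cod C r = Dom C g \<and>
          Dom C r = Dom C l \<and> (h \<cdot> k) \<cdot> l = g \<cdot> r"
      then have l': "l \<in> Arr C" "Cod C l = Dom C k" using k h by auto
      have "act B (k \<cdot> l) (\<alpha> h x) = ev1 u r (act A (k \<cdot> l) x)"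
        by (intro specD(1)[OF sp]) (use l l' k h in simp_all)
      then show "act B l (act B k (\<alpha> h x)) = ev1 u r (act A l (act A k x))"
        using l k h e e' by simp
    next
      fix l r assume l: "l \<in> Arr C \<and> r \<in> Arr C \<and> Cod C l = Dom C (h \<cdot> k) \<and> Cod C r = Dom C n \<and>
          Dom C r = Dom C l \<and> (h \<cdot> k) \<cdot> l = n \<cdot> r"
      then have l': "l \<in> Arr C" "Cod C l = Dom C k" using k h by auto
      have "act B (k \<cdot> l) (\<alpha> h x) = ev1 v r (act A (k \<cdot> l) x)"
        by (intro specD(2)[OF sp]) (use l l' k h in simp_all)
      then show "act B l (act B k (\<alpha> h x)) = ev1 v r (act A l (act A k x))"
        using l k h e e' by simp
    qed
    moreover have "act A k x \<in> el A (Dom C (h \<cdot> k))" using h k A by simp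
    ultimately show "\<alpha> (h \<cdot> k) (act A k x) = act B k (\<alpha> h x)"
      unfolding \<alpha>_def[of "h \<cdot> k"] using h k by (intro the1_equality[OF ex1]) simp_all
  qed
  moreover have "fcode A (Dom C g) (\<lambda>q a. ev1 (fcode A (Cod C g) \<alpha>) (g \<cdot> q) a) = u"
  proof (rule trans[OF _ fu(2)[symmetric]], rule fcode_cong)
    fix q x assume q: "q \<in> Arr C" "Cod C q = Dom C g" "x \<in> el A (Dom C q)"
    have sp: "spec (g \<cdot> q) x (\<alpha> (g \<cdot> q) x)" using \<alpha> q S by simp
    \<comment> \<open>The arrow \<open>g \<cdot> q\<close> factors through the leg as it stands, so
      the characterisation applied to an identity returns the value of \<open>u\<close>.\<close>
    have "act B (Id C (Dom C q)) (\<alpha> (g \<cdot> q) x) = ev1 u q (act A (Id C (Dom C q)) x)"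
      by (rule specD(1)[OF sp]) (use q S in simp_all)
    then show "ev1 (fcode A (Cod C g) \<alpha>) (g \<cdot> q) x = ev1 u q x"
      using q S A B sp by (simp add: spec_def)
  qed
  moreover have "fcode A (Dom C n) (\<lambda>q a. ev1 (fcode A (Cod C g) \<alpha>) (n \<cdot> q) a) = v"
  proof (rule trans[OF _ fv(2)[symmetric]], rule fcode_cong)
    fix q x assume q: "q \<in> Arr C" "Cod C q = Dom C n" "x \<in> el A (Dom C q)"
    have sp: "spec (n \<cdot> q) x (\<alpha> (n \<cdot> q) x)" using \<alpha> q S by simp
    have "act B (Id C (Dom C q)) (\<alpha> (n \<cdot> q) x) = ev1 v q (act A (Id C (Dom C q)) x)"
      by (rule specD(2)[OF sp]) (use q S in simp_all)
    then show "ev1 (fcode A (Cod C g) \<alpha>) (n \<cdot> q) x = ev1 v q x"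
      using q S A B sp by (simp add: spec_def)
  qed
  ultimately show "\<exists>z\<in>{fcode A (Cod C g) \<alpha> |\<alpha>. family A B (Cod C g) \<alpha>}.
      fcode A (Dom C g) (\<lambda>q a. ev1 z (g \<cdot> q) a) = u \<and> fcode A (Dom C n) (\<lambda>q a. ev1 z (n \<cdot> q) a) = v"
    by blast
qed simp

lemma el_expoD:
  assumes "sheaf A" "X \<in> Obj C" "u \<in> el (expo A B) X"
  shows "family A B X (ev1 u)" "u = fcode A X (ev1 u)"
  using family_ev1[of A u X B] assms by (auto simp: el_expo)

lemma fcode_el: "X \<in> Obj C \<Longrightarrow> family A B X \<alpha> \<Longrightarrow> fcode A X \<alpha> \<in> el (expo A B) X"
  by (auto simp: el_expo)

text \<open>The element of \<open>rep X\<close> at which the family is evaluated is the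
  identity.\<close>

definition eval :: "'u \<Rightarrow> 'u \<Rightarrow> 'u" where
  "eval A B = mkA (pairs (expo A B) A top_rel) B (\<lambda>X z. ev1 (fstc z) (Id C X) (sndc z))"

lemma eval_Hom:
  assumes A: "sheaf A" and B: "sheaf B"
  shows "eval A B \<in> Hom Sh (pairs (expo A B) A top_rel) B"
  unfolding eval_def
proof (rule mkA_Hom)
  show "natural (pairs (expo A B) A top_rel) B (\<lambda>X z. ev1 (fstc z) (Id C X) (sndc z))"
    unfolding natural_def
  proof (intro conjI ballI)
    show "ev1 (fstc z) (Id C X) (sndc z) \<in> el B X" if "X \<in> Obj C" "z \<in> el (pairs (expo A B) A top_rel) X" for X z
      using that(2,1) familyD(1)[OF el_expoD(1)[OF A that(1)], of "fstc z" B "Id C X" "sndc z"]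
      by (elim el_pairsE) simp_all
    fix f z assume f: "f \<in> Arr C" and z: "z \<in> el (pairs (expo A B) A top_rel) (Cod C f)"
    obtain u a where u: "z = pr u a" "u \<in> el (expo A B) (Cod C f)" "a \<in> el A (Cod C f)"
      using z f by (auto elim: el_pairsE)
    have "family A B (Cod C f) (ev1 u)" using el_expoD[OF A _ u(2)] f by simp
    from familyD(2)[OF this, of "Id C (Cod C f)" a f]
    show "ev1 (fstc (act (pairs (expo A B) A top_rel) f z)) (Id C (Dom C f))
            (sndc (act (pairs (expo A B) A top_rel) f z)) =
          act B f (ev1 (fstc z) (Id C (Cod C f)) (sndc z))"
      using u f A by (simp add: act_expo)
  qed
qed (simp_all add: assms sheaf_expo)

lemma ap_eval [simp]:
  "X \<in> Obj C \<Longrightarrow> u \<in> el (expo A B) X \<Longrightarrow> a \<in> el A X \<Longrightarrow> ap (eval A B) X (pr u a) = ev1 u (Id C X) a"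
  by (simp add: eval_def)

lemma exponential_expo:
  assumes A: "sheaf A" and B: "sheaf B"
  shows "is_exponential Sh A B (expo A B) (pairs (expo A B) A top_rel)
    (proj1 (expo A B) A top_rel) (proj2 (expo A B) A top_rel) (eval A B)"
  unfolding is_exponential_def
proof (intro conjI allI impI)
  note E = sheaf_expo[OF A B] and ev = eval_Hom[OF A B]
  note pj = proj_Hom[OF E A local_top]
  show "is_product Sh (expo A B) A (pairs (expo A B) A top_rel)
    (proj1 (expo A B) A top_rel) (proj2 (expo A B) A top_rel)" by (rule product_pairs[OF E A])
  show "eval A B \<in> Hom Sh (pairs (expo A B) A top_rel) B" by (rule ev)
  fix Z Q r s h assume a: "is_product Sh Z A Q r s \<and> h \<in> Hom Sh Q B"
  then have Q: "is_product Sh Z A Q r s" and h: "h \<in> Hom Sh Q B" by auto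
  have r: "r \<in> Hom Sh Q Z" and s: "s \<in> Hom Sh Q A" using Q by (auto simp: is_product_def)
  note sh = Hom_natural(1,2)[OF r]
  \<comment> \<open>\<open>w X x a\<close> plays the part of the pair of \<open>x\<close> and
    \<open>a\<close> in the arbitrary product \<open>Q\<close>.\<close>
  define w where "w X x a = (THE c. c \<in> el Q X \<and> ap r X c = x \<and> ap s X c = a)" for X x a
  have w: "w X x a \<in> el Q X" "ap r X (w X x a) = x" "ap s X (w X x a) = a"
    if "X \<in> Obj C" "x \<in> el Z X" "a \<in> el A X" for X x a
    using theI'[OF product_pointwise[OF Q that]] unfolding w_def by auto
  have w_eq: "c = w X (ap r X c) (ap s X c)" if "X \<in> Obj C" "c \<in> el Q X" for X c
    unfolding w_def
    by (rule sym, rule the1_equality[OF product_pointwise[OF Q]]) (use that r s in simp_all)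
  have w_act: "w (Dom C k) (act Z k x) (act A k a) = act Q k (w (Cod C k) x a)"
    if "k \<in> Arr C" "x \<in> el Z (Cod C k)" "a \<in> el A (Cod C k)" for k x a
    using w_eq[of "Dom C k" "act Q k (w (Cod C k) x a)"] w[of "Cod C k" x a] that sh
    by (simp add: ap_act[OF r] ap_act[OF s])
  \<comment> \<open>The transpose of \<open>h\<close>: the element \<open>x\<close> is restricted
    along \<open>f\<close> to the stage where \<open>a\<close> lives, and \<open>h\<close> is
    applied to the pair.\<close>
  define \<kappa> where "\<kappa> X x = fcode A X (\<lambda>f a. ap h (Dom C f) (w (Dom C f) (act Z f x) a))" for X x
  have fam: "family A B X (\<lambda>f a. ap h (Dom C f) (w (Dom C f) (act Z f x) a))"
    if X: "X \<in> Obj C" "x \<in> el Z X" for X x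
    unfolding family_def
  proof (intro ballI impI conjI)
    fix f a assume f: "f \<in> Arr C" "Cod C f = X" "a \<in> el A (Dom C f)"
    have fx: "act Z f x \<in> el Z (Dom C f)" using f X sh by simp
    show "ap h (Dom C f) (w (Dom C f) (act Z f x) a) \<in> el B (Dom C f)" using h w(1)[OF _ fx f(3)] f by simp
    fix k assume k: "k \<in> Arr C" "Cod C k = Dom C f"
    have "ap h (Dom C k) (w (Dom C k) (act Z k (act Z f x)) (act A k a)) = act B k (ap h (Dom C f) (w (Dom C f) (act Z f x) a))"
      using w_act[OF k(1), of "act Z f x" a] k f fx w(1)[OF _ fx f(3)]
      by (simp add: ap_act[OF h])
    then show "ap h (Dom C (f \<cdot> k)) (w (Dom C (f \<cdot> k)) (act Z (f \<cdot> k) x) (act A k a)) =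
        act B k (ap h (Dom C f) (w (Dom C f) (act Z f x) a))"
      using act_comp[OF sh(2), of k f x] k f X by simp
  qed
  have \<kappa>: "natural Z (expo A B) \<kappa>"
    unfolding natural_def
  proof (intro conjI ballI)
    show el: "\<kappa> X x \<in> el (expo A B) X" if "X \<in> Obj C" "x \<in> el Z X" for X x
      unfolding \<kappa>_def using fcode_el[OF that(1) fam[OF that]] .
    fix f x assume f: "f \<in> Arr C" and x: "x \<in> el Z (Cod C f)"
    have e: "ev1 (\<kappa> (Cod C f) x) (f \<cdot> q) a = ap h (Dom C q) (w (Dom C q) (act Z q (act Z f x)) a)"
      if "q \<in> Arr C" "Cod C q = Dom C f" "a \<in> el A (Dom C q)" for q a
      using that f x act_comp[OF sh(2), of q f x] by (simp add: \<kappa>_def)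
    show "\<kappa> (Dom C f) (act Z f x) = act (expo A B) f (\<kappa> (Cod C f) x)"
      using f x el[of "Cod C f" x] e by (auto simp: act_expo \<kappa>_def[of "Dom C f"] intro!: fcode_cong)
  qed
  define k where "k = mkA Z (expo A B) \<kappa>"
  have k: "k \<in> Hom Sh Z (expo A B)" unfolding k_def by (rule mkA_Hom[OF sh(2) E \<kappa>])
  have \<kappa>_el: "\<kappa> X x \<in> el (expo A B) X" if "X \<in> Obj C" "x \<in> el Z X" for X x
    using \<kappa> that by (simp add: natural_def)
  define l where "l = mkA Q (pairs (expo A B) A top_rel) (\<lambda>X c. pr (\<kappa> X (ap r X c)) (ap s X c))"
  have l: "l \<in> Hom Sh Q (pairs (expo A B) A top_rel)"
    unfolding l_def
  proof (rule mkA_Hom)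
    show "natural Q (pairs (expo A B) A top_rel) (\<lambda>X c. pr (\<kappa> X (ap r X c)) (ap s X c))"
      using \<kappa> r s sh E A by (auto simp: natural_def ap_act[OF r] ap_act[OF s])
  qed (use sh E A in simp_all)
  show "\<exists>!k. k \<in> Hom Sh Z (expo A B) \<and> (\<exists>l. l \<in> Hom Sh Q (pairs (expo A B) A top_rel) \<and>
      proj1 (expo A B) A top_rel \<cdot>\<^bsub>Sh\<^esub> l = k \<cdot>\<^bsub>Sh\<^esub> r \<and> proj2 (expo A B) A top_rel \<cdot>\<^bsub>Sh\<^esub> l = s \<and> eval A B \<cdot>\<^bsub>Sh\<^esub> l = h)"
  proof (rule ex1I[of _ k], intro conjI k exI[of _ l] l)
    show "proj1 (expo A B) A top_rel \<cdot>\<^bsub>Sh\<^esub> l = k \<cdot>\<^bsub>Sh\<^esub> r"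
      by (rule Sh_ext[OF Sh_comp_Hom[OF l pj(1)] Sh_comp_Hom[OF r k]])
        (use r s \<kappa>_el in \<open>simp add: ap_comp[OF l pj(1)] ap_comp[OF r k]\<close>, use r s \<kappa>_el in \<open>simp add: l_def k_def\<close>)
    show "proj2 (expo A B) A top_rel \<cdot>\<^bsub>Sh\<^esub> l = s"
      by (rule Sh_ext[OF Sh_comp_Hom[OF l pj(2)] s])
        (use r s \<kappa>_el in \<open>simp add: ap_comp[OF l pj(2)]\<close>, use r s \<kappa>_el in \<open>simp add: l_def\<close>)
    show "eval A B \<cdot>\<^bsub>Sh\<^esub> l = h"
    proof (rule Sh_ext[OF Sh_comp_Hom[OF l ev] h])
      fix X c assume c: "X \<in> Obj C" "c \<in> el Q X"
      have "ap (eval A B \<cdot>\<^bsub>Sh\<^esub> l) X c = ev1 (\<kappa> X (ap r X c)) (Id C X) (ap s X c)"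
        using c r s \<kappa>_el by (simp add: ap_comp[OF l ev]) (simp add: l_def)
      also have "\<dots> = ap h X (w X (ap r X c) (ap s X c))"
        using c r s sh by (simp add: \<kappa>_def)
      finally show "ap (eval A B \<cdot>\<^bsub>Sh\<^esub> l) X c = ap h X c" using w_eq[OF c] by simp
    qed
    fix k' assume k': "k' \<in> Hom Sh Z (expo A B) \<and> (\<exists>l. l \<in> Hom Sh Q (pairs (expo A B) A top_rel) \<and>
      proj1 (expo A B) A top_rel \<cdot>\<^bsub>Sh\<^esub> l = k' \<cdot>\<^bsub>Sh\<^esub> r \<and> proj2 (expo A B) A top_rel \<cdot>\<^bsub>Sh\<^esub> l = s \<and> eval A B \<cdot>\<^bsub>Sh\<^esub> l = h)"
    then have kH: "k' \<in> Hom Sh Z (expo A B)" by simp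
    obtain l' where l': "l' \<in> Hom Sh Q (pairs (expo A B) A top_rel)"
      "proj1 (expo A B) A top_rel \<cdot>\<^bsub>Sh\<^esub> l' = k' \<cdot>\<^bsub>Sh\<^esub> r" "proj2 (expo A B) A top_rel \<cdot>\<^bsub>Sh\<^esub> l' = s" "eval A B \<cdot>\<^bsub>Sh\<^esub> l' = h"
      using k' by blast
    have hc: "ap h X c = ev1 (ap k' X (ap r X c)) (Id C X) (ap s X c)" if c: "X \<in> Obj C" "c \<in> el Q X" for X c
    proof -
      obtain u a where ua: "ap l' X c = pr u a" "u \<in> el (expo A B) X" "a \<in> el A X"
        using ap_el[OF l'(1) c] c by (auto elim: el_pairsE)
      have "u = ap k' X (ap r X c)"
        using ap_comp[OF l'(1) pj(1) c] ap_comp[OF r kH c] l'(2) ua c by simp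
      moreover have "a = ap s X c" using ap_comp[OF l'(1) pj(2) c] l'(3) ua c by simp
      moreover have "ap h X c = ev1 u (Id C X) a" using ap_comp[OF l'(1) ev c] l'(4) ua c by simp
      ultimately show ?thesis by simp
    qed
    show "k' = k"
    proof (rule Sh_ext[OF kH k])
      fix X x assume x: "X \<in> Obj C" "x \<in> el Z X"
      have u: "ap k' X x \<in> el (expo A B) X" using kH x by simp
      note fu = el_expoD[OF A x(1) u]
      have "ap k' X x = fcode A X (\<lambda>f a. ap h (Dom C f) (w (Dom C f) (act Z f x) a))"
      proof (rule trans[OF fu(2)], rule fcode_cong)
        fix f a assume f: "f \<in> Arr C" "Cod C f = X" "a \<in> el A (Dom C f)"
        have fx: "act Z f x \<in> el Z (Dom C f)" using f x sh by simp
        \<comment> \<open>Naturality of \<open>k'\<close> along \<open>f\<close> turns the value of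
          its family at \<open>f\<close> into a value at an identity, and \<open>hc\<close> fixes
          the latter.\<close>
        have "ap h (Dom C f) (w (Dom C f) (act Z f x) a) = ev1 (ap k' (Dom C f) (act Z f x)) (Id C (Dom C f)) a"
          using hc[of "Dom C f" "w (Dom C f) (act Z f x) a"] w[OF _ fx f(3)] f by simp
        also have "\<dots> = ev1 (ap k' X x) f a"
          using ap_act[OF kH f(1), of x "Dom C f" X] f x u A by (simp add: act_expo)
        finally show "ev1 (ap k' X x) f a = ap h (Dom C f) (w (Dom C f) (act Z f x) a)" by simp
      qed
      then show "ap k' X x = ap k X x" using x by (simp add: k_def \<kappa>_def)
    qed
  qed
qed

section \<open>The sheaf of closed sieves as subobject classifier\<close>

definition sieve_of :: "'o \<Rightarrow> ('a \<Rightarrow> bool) \<Rightarrow> 'u" where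
  "sieve_of X Q = code (\<gamma> ` {f \<in> Arr C. Cod C f = X \<and> Q f})"

definition mem :: "'a \<Rightarrow> 'u \<Rightarrow> bool" where
  "mem f s \<longleftrightarrow> \<gamma> f \<in> elts s"

lemma mem_sieve_of [simp]: "f \<in> Arr C \<Longrightarrow> mem f (sieve_of X Q) \<longleftrightarrow> Cod C f = X \<and> Q f"
  unfolding mem_def sieve_of_def by (subst elts_code) auto

lemma sieve_of_cong: "(\<And>f. f \<in> Arr C \<Longrightarrow> Cod C f = X \<Longrightarrow> Q f \<longleftrightarrow> R f) \<Longrightarrow> sieve_of X Q = sieve_of X R"
  unfolding sieve_of_def by (rule arg_cong[where f = code]) auto

text \<open>The closed sieves on \<open>X\<close> are the subsheaves of \<open>rep X\<close>, which
  is why they must be the truth values at \<open>X\<close>. The closure clause concerns covers of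
  the domain of every \<open>h\<close>, not just covers of \<open>X\<close>.\<close>

definition closed_sieve :: "'o \<Rightarrow> ('a \<Rightarrow> bool) \<Rightarrow> bool" where
  "closed_sieve X Q \<longleftrightarrow>
    (\<forall>f\<in>Arr C. \<forall>k\<in>Arr C. Cod C f = X \<and> Cod C k = Dom C f \<and> Q f \<longrightarrow> Q (f \<cdot> k)) \<and>
    (\<forall>m f g n. cov m f g n \<longrightarrow> (\<forall>h\<in>Arr C. Cod C h = X \<and> Dom C h = Cod C g \<and> Q (h \<cdot> g) \<and> Q (h \<cdot> n) \<longrightarrow> Q h))"

lemma closed_sieveD:
  assumes "closed_sieve X Q"
  shows "f \<in> Arr C \<Longrightarrow> k \<in> Arr C \<Longrightarrow> Cod C f = X \<Longrightarrow> Cod C k = Dom C f \<Longrightarrow> Q f \<Longrightarrow> Q (f \<cdot> k)"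
    and "cov m f g n \<Longrightarrow> h \<in> Arr C \<Longrightarrow> Cod C h = X \<Longrightarrow> Dom C h = Cod C g \<Longrightarrow> Q (h \<cdot> g) \<Longrightarrow> Q (h \<cdot> n) \<Longrightarrow> Q h"
  using assms unfolding closed_sieve_def by blast+

definition Omega :: 'u where
  "Omega = mkP (\<lambda>X. {sieve_of X Q |Q. closed_sieve X Q}) (\<lambda>h s. sieve_of (Dom C h) (\<lambda>f. mem (h \<cdot> f) s))"

lemma is_set_sieves [simp]: "is_set {sieve_of X Q |Q. closed_sieve X Q}"
  by (rule is_set_subset[OF is_set_Pow[OF is_set_elts[of U]]])
    (auto simp: sieve_of_def elts_code[OF is_set_\<gamma>])

lemma el_Omega: "X \<in> Obj C \<Longrightarrow> el Omega X = {sieve_of X Q |Q. closed_sieve X Q}"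
  unfolding Omega_def by (rule el_mkP) simp_all

lemma act_Omega: "h \<in> Arr C \<Longrightarrow> s \<in> el Omega (Cod C h) \<Longrightarrow>
    act Omega h s = sieve_of (Dom C h) (\<lambda>f. mem (h \<cdot> f) s)"
  by (simp add: el_Omega) (simp add: Omega_def act_mkP)

lemma sieve_mem:
  assumes "s \<in> {sieve_of X Q |Q. closed_sieve X Q}"
  shows "closed_sieve X (\<lambda>f. mem f s)" "s = sieve_of X (\<lambda>f. mem f s)"
proof -
  obtain Q where Q: "closed_sieve X Q" "s = sieve_of X Q" using assms by blast
  show "s = sieve_of X (\<lambda>f. mem f s)" unfolding Q(2) by (rule sieve_of_cong) simp
  show "closed_sieve X (\<lambda>f. mem f s)"
    unfolding closed_sieve_def
  proof (intro conjI ballI allI impI)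
    show "mem (f \<cdot> k) s" if "f \<in> Arr C" "k \<in> Arr C" "Cod C f = X \<and> Cod C k = Dom C f \<and> mem f s" for f k
      using closed_sieveD(1)[OF Q(1), of f k] that Q(2) by simp
    show "mem h s" if c: "cov m f g n" and "h \<in> Arr C"
      "Cod C h = X \<and> Dom C h = Cod C g \<and> mem (h \<cdot> g) s \<and> mem (h \<cdot> n) s" for m f g n h
      using closed_sieveD(2)[OF Q(1) c, of h] that Q(2) covD(3,4,8)[OF c] by auto
  qed
qed

lemma closed_sieve_restrict:
  assumes Q: "closed_sieve X Q" and h: "h \<in> Arr C" "Cod C h = X"
  shows "closed_sieve (Dom C h) (\<lambda>f. Q (h \<cdot> f))"
  unfolding closed_sieve_def
proof (intro conjI ballI allI impI)
  show "Q (h \<cdot> (f \<cdot> k))" if "f \<in> Arr C" "k \<in> Arr C" "Cod C f = Dom C h \<and> Cod C k = Dom C f \<and> Q (h \<cdot> f)" for f k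
    using closed_sieveD(1)[OF Q, of "h \<cdot> f" k] that h by simp
  show "Q (h \<cdot> k)" if c: "cov m f g n" and "k \<in> Arr C"
      "Cod C k = Dom C h \<and> Dom C k = Cod C g \<and> Q (h \<cdot> (k \<cdot> g)) \<and> Q (h \<cdot> (k \<cdot> n))" for m f g n k
    using closed_sieveD(2)[OF Q c, of "h \<cdot> k"] that h covD(3,4,8)[OF c] by auto
qed

text \<open>Sieves with equal restrictions along both legs contain the same arrows, since each arrow
  is covered by pieces that factor through a leg. For gluing, an arrow may factor through the legs
  in several ways, and the verdicts of \<open>s\<close> and \<open>t\<close> on all of these have to
  agree.\<close>

lemma sheaf_Omega: "sheaf Omega"
  unfolding Omega_def
proof (rule sheaf_mkP)
  show "sieve_of (Dom C h) (\<lambda>f. mem (h \<cdot> f) s) \<in> {sieve_of (Dom C h) Q |Q. closed_sieve (Dom C h) Q}"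
    if "h \<in> Arr C" "s \<in> {sieve_of (Cod C h) Q |Q. closed_sieve (Cod C h) Q}" for h s
    using closed_sieve_restrict[OF sieve_mem(1)[OF that(2)] that(1)] by blast
  show "sieve_of (Dom C (Id C X)) (\<lambda>f. mem (Id C X \<cdot> f) s) = s"
    if "X \<in> Obj C" "s \<in> {sieve_of X Q |Q. closed_sieve X Q}" for X s
    using sieve_mem(2)[OF that(2)] that(1) sieve_of_cong[of X "\<lambda>f. mem (Id C X \<cdot> f) s" "\<lambda>f. mem f s"] by simp
  show "sieve_of (Dom C (g \<cdot> f)) (\<lambda>k. mem ((g \<cdot> f) \<cdot> k) s) =
      sieve_of (Dom C f) (\<lambda>k. mem (f \<cdot> k) (sieve_of (Dom C g) (\<lambda>f. mem (g \<cdot> f) s)))"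
    if "f \<in> Arr C" "g \<in> Arr C" "Cod C f = Dom C g" for f g s
    using that by (auto intro!: sieve_of_cong)
next
  fix m f g n s s' assume c: "cov m f g n"
    and s: "s \<in> {sieve_of (Cod C g) Q |Q. closed_sieve (Cod C g) Q}"
    and s': "s' \<in> {sieve_of (Cod C g) Q |Q. closed_sieve (Cod C g) Q}"
    and eg: "sieve_of (Dom C g) (\<lambda>f. mem (g \<cdot> f) s) = sieve_of (Dom C g) (\<lambda>f. mem (g \<cdot> f) s')"
    and en: "sieve_of (Dom C n) (\<lambda>f. mem (n \<cdot> f) s) = sieve_of (Dom C n) (\<lambda>f. mem (n \<cdot> f) s')"
  have g: "mem (g \<cdot> k) s \<longleftrightarrow> mem (g \<cdot> k) s'" if "k \<in> Arr C" "Cod C k = Dom C g" for k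
    using arg_cong[OF eg, of "mem k"] that by simp
  have n: "mem (n \<cdot> k) s \<longleftrightarrow> mem (n \<cdot> k) s'" if "k \<in> Arr C" "Cod C k = Dom C n" for k
    using arg_cong[OF en, of "mem k"] that by simp
  have imp: "mem h t'" if h: "h \<in> Arr C" "Cod C h = Cod C g" "mem h t"
    and t: "closed_sieve (Cod C g) (\<lambda>f. mem f t)" "closed_sieve (Cod C g) (\<lambda>f. mem f t')"
    and tt: "\<And>k. k \<in> Arr C \<Longrightarrow> Cod C k = Dom C g \<Longrightarrow> mem (g \<cdot> k) t \<Longrightarrow> mem (g \<cdot> k) t'"
      "\<And>k. k \<in> Arr C \<Longrightarrow> Cod C k = Dom C n \<Longrightarrow> mem (n \<cdot> k) t \<Longrightarrow> mem (n \<cdot> k) t'" for h t t'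
  proof -
    obtain m' f' g' n' a b where p: "cov m' f' g' n'" "is_pullback C g' a h g" "is_pullback C n' b h n"
      using cov_stable[OF c h(1,2)] by blast
    note G = comm_squareD[OF pullback_square[OF p(2)]] and N = comm_squareD[OF pullback_square[OF p(3)]]
    have d: "Cod C g' = Dom C h" "Cod C n' = Dom C h" "Cod C a = Dom C g" "Cod C b = Dom C n"
      using G N by auto
    have "mem (h \<cdot> g') t'" using tt(1)[of a] closed_sieveD(1)[OF t(1), of h g'] h G(1-4,9) d by simp
    moreover have "mem (h \<cdot> n') t'" using tt(2)[of b] closed_sieveD(1)[OF t(1), of h n'] h N(1-4,9) d by simp
    ultimately show ?thesis using closed_sieveD(2)[OF t(2) p(1), of h] h d by simp
  qed
  note cs = sieve_mem(1)[OF s] and cs' = sieve_mem(1)[OF s']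
  show "s = s'"
    by (rule trans[OF sieve_mem(2)[OF s] trans[OF _ sieve_mem(2)[OF s', symmetric]]], rule sieve_of_cong)
      (use imp[OF _ _ _ cs cs'] imp[OF _ _ _ cs' cs] g n in blast)
next
  fix m f g n s t assume c: "cov m f g n"
    and s: "s \<in> {sieve_of (Dom C g) Q |Q. closed_sieve (Dom C g) Q}"
    and t: "t \<in> {sieve_of (Dom C n) Q |Q. closed_sieve (Dom C n) Q}"
    and st: "sieve_of (Dom C m) (\<lambda>k. mem (m \<cdot> k) s) = sieve_of (Dom C f) (\<lambda>k. mem (f \<cdot> k) t)"
  note S = covD[OF c] and cs = sieve_mem(1)[OF s] and ct = sieve_mem(1)[OF t]
  have st': "mem (m \<cdot> k) s \<longleftrightarrow> mem (f \<cdot> k) t" if "k \<in> Arr C" "Cod C k = Dom C m" for k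
    using arg_cong[OF st, of "mem k"] that S by simp
  \<comment> \<open>Two factorisations through \<open>g\<close> are compared on the cover of the
    kernel pair: along \<open>p\<close> they are equal, and along \<open>q\<close> membership passes
    from \<open>s\<close> to \<open>t\<close> and back over the corner, since
    \<open>f \<cdot> k = f \<cdot> k'\<close>.\<close>
  have ker: "mem v s" if u: "u \<in> Arr C" "v \<in> Arr C" "Dom C u = Dom C v" "Cod C u = Dom C g" "Cod C v = Dom C g"
    "g \<cdot> u = g \<cdot> v" "mem u s" for u v
  proof -
    obtain m' f' p q k k' where k: "cov m' f' p q" "Cod C p = Dom C u" "u \<cdot> p = v \<cdot> p"
      "k \<in> Arr C" "k' \<in> Arr C" "Dom C k = Dom C q" "Dom C k' = Dom C q" "Cod C k = Dom C m" "Cod C k' = Dom C m"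
      "u \<cdot> q = m \<cdot> k" "v \<cdot> q = m \<cdot> k'" "f \<cdot> k = f \<cdot> k'"
      using cov_kernel[OF c u(1-6)] by blast
    note P = covD[OF k(1)]
    have "mem (v \<cdot> p) s" using closed_sieveD(1)[OF cs, of u p] u k P by simp
    moreover have "mem (v \<cdot> q) s"
      using closed_sieveD(1)[OF cs, of u q] u k P st'[of k] st'[of k'] by simp
    ultimately show "mem v s" using closed_sieveD(2)[OF cs k(1), of v] u k by simp
  qed
  \<comment> \<open>A factorisation through \<open>g\<close> and one through \<open>n\<close> come
    from the corner, because the covering square is a pullback, and there \<open>s\<close> and
    \<open>t\<close> agree.\<close>
  have crossing: "mem u s \<longleftrightarrow> mem v t" if u: "u \<in> Arr C" "v \<in> Arr C" "Dom C u = Dom C v" "Cod C u = Dom C g"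
    "Cod C v = Dom C n" "g \<cdot> u = n \<cdot> v" for u v
  proof -
    have "comm_square C u v g n" using u S by (simp add: comm_square_def)
    then obtain k where "k \<in> Arr C" "Cod C k = Dom C m" "m \<cdot> k = u" "f \<cdot> k = v"
      by (rule pullback_factor[OF cov_pullback[OF c]])
    then show ?thesis using st' by blast
  qed
  \<comment> \<open>The glued sieve asks that every factorisation of every restriction of
    \<open>h\<close> through a leg be accepted. With this universal form closure needs only that
    \<open>s\<close> and \<open>t\<close> are closed; consistency is needed only when
    \<open>Q\<close> is restricted back to the legs.\<close>
  define Q where "Q h \<longleftrightarrow> (\<forall>k r. k \<in> Arr C \<and> r \<in> Arr C \<and> Cod C k = Dom C h \<and> Dom C r = Dom C k \<longrightarrow>
      (Cod C r = Dom C g \<and> h \<cdot> k = g \<cdot> r \<longrightarrow> mem r s) \<and> (Cod C r = Dom C n \<and> h \<cdot> k = n \<cdot> r \<longrightarrow> mem r t))" for h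
  have "closed_sieve (Cod C g) Q"
    unfolding closed_sieve_def
  proof (intro conjI ballI allI impI)
    show "Q (h \<cdot> l)" if h: "h \<in> Arr C" "l \<in> Arr C" "Cod C h = Cod C g \<and> Cod C l = Dom C h \<and> Q h" for h l
      unfolding Q_def
    proof (intro allI impI)
      fix k r assume k: "k \<in> Arr C \<and> r \<in> Arr C \<and> Cod C k = Dom C (h \<cdot> l) \<and> Dom C r = Dom C k"
      have "Q h" using h by simp
      from this[unfolded Q_def, rule_format, of "l \<cdot> k" r]
      show "(Cod C r = Dom C g \<and> (h \<cdot> l) \<cdot> k = g \<cdot> r \<longrightarrow> mem r s) \<and> (Cod C r = Dom C n \<and> (h \<cdot> l) \<cdot> k = n \<cdot> r \<longrightarrow> mem r t)"
        using k h by simp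
    qed
    show "Q h" if c0: "cov m0 f0 g0 n0" and h: "h \<in> Arr C"
      and hQ: "Cod C h = Cod C g \<and> Dom C h = Cod C g0 \<and> Q (h \<cdot> g0) \<and> Q (h \<cdot> n0)" for m0 f0 g0 n0 h
      unfolding Q_def
    proof (intro allI impI)
      fix k r assume k: "k \<in> Arr C \<and> r \<in> Arr C \<and> Cod C k = Dom C h \<and> Dom C r = Dom C k"
      then have k1: "k \<in> Arr C" "Cod C k = Cod C g0" using hQ by auto
      \<comment> \<open>The cover of the domain of \<open>h\<close> is pulled back along
        \<open>k\<close>. Over its legs \<open>r\<close> restricts to factorisations of restrictions
        of \<open>h \<cdot> g0\<close> and \<open>h \<cdot> n0\<close>, which are accepted, so
        closedness of \<open>s\<close> or \<open>t\<close> accepts \<open>r\<close>.\<close>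
      obtain m' f' g' n' a b where p: "cov m' f' g' n'" "is_pullback C g' a k g0" "is_pullback C n' b k n0"
        using cov_stable[OF c0 k1] by blast
      note G = comm_squareD[OF pullback_square[OF p(2)]] and N = comm_squareD[OF pullback_square[OF p(3)]]
      have d: "Cod C g' = Dom C k" "Cod C n' = Dom C k" "Cod C a = Dom C g0" "Cod C b = Dom C n0"
        "Dom C a = Dom C g'" "Dom C b = Dom C n'"
        using G N by auto
      note C0 = covD[OF c0]
      have 1: "Q (h \<cdot> g0)" and 2: "Q (h \<cdot> n0)" using hQ by auto
      have eg: "(h \<cdot> g0) \<cdot> a = w \<cdot> (r \<cdot> g')" if "h \<cdot> k = w \<cdot> r" "w \<in> Arr C" "Cod C r = Dom C w" for w
        using comp_eq_comp[OF that(1), of g'] that k k1 G(1-4,9) d h hQ C0(1-4) by auto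
      have en: "(h \<cdot> n0) \<cdot> b = w \<cdot> (r \<cdot> n')" if "h \<cdot> k = w \<cdot> r" "w \<in> Arr C" "Cod C r = Dom C w" for w
        using comp_eq_comp[OF that(1), of n'] that k k1 N(1-4,9) d h hQ C0(1-4,8) by auto
      show "(Cod C r = Dom C g \<and> h \<cdot> k = g \<cdot> r \<longrightarrow> mem r s) \<and> (Cod C r = Dom C n \<and> h \<cdot> k = n \<cdot> r \<longrightarrow> mem r t)"
      proof (intro conjI impI)
        assume r: "Cod C r = Dom C g \<and> h \<cdot> k = g \<cdot> r"
        have "mem (r \<cdot> g') s"
          using 1[unfolded Q_def, rule_format, of a "r \<cdot> g'"] eg[of g] r k1 k G(1-4,9) d h hQ C0(1-4,8) S(3,4,8) by auto
        moreover have "mem (r \<cdot> n') s"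
          using 2[unfolded Q_def, rule_format, of b "r \<cdot> n'"] en[of g] r k1 k N(1-4,9) d h hQ C0(1-4,8) S(3,4,8) by auto
        ultimately show "mem r s" using closed_sieveD(2)[OF cs p(1), of r] r k d by simp
      next
        assume r: "Cod C r = Dom C n \<and> h \<cdot> k = n \<cdot> r"
        have "mem (r \<cdot> g') t"
          using 1[unfolded Q_def, rule_format, of a "r \<cdot> g'"] eg[of n] r k1 k G(1-4,9) d h hQ C0(1-4,8) S(3,4,8) by auto
        moreover have "mem (r \<cdot> n') t"
          using 2[unfolded Q_def, rule_format, of b "r \<cdot> n'"] en[of n] r k1 k N(1-4,9) d h hQ C0(1-4,8) S(3,4,8) by auto
        ultimately show "mem r t" using closed_sieveD(2)[OF ct p(1), of r] r k d by simp
      qed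
    qed
  qed
  moreover have "sieve_of (Dom C g) (\<lambda>k. mem (g \<cdot> k) (sieve_of (Cod C g) Q)) = s"
  proof (rule trans[OF _ sieve_mem(2)[OF s, symmetric]], rule sieve_of_cong)
    fix w assume w: "w \<in> Arr C" "Cod C w = Dom C g"
    \<comment> \<open>Other factorisations of a restriction of \<open>g \<cdot> w\<close> run
      through \<open>g\<close>, handled by \<open>ker\<close>, or through \<open>n\<close>, handled
      by \<open>crossing\<close>. In the dual case below, two factorisations through the mono
      \<open>n\<close> are equal.\<close>
    have "Q (g \<cdot> w) \<longleftrightarrow> mem w s"
    proof
      assume "Q (g \<cdot> w)"
      from this[unfolded Q_def, rule_format, of "Id C (Dom C w)" w] show "mem w s" using w S by simp
    next
      assume ws: "mem w s"
      show "Q (g \<cdot> w)"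
        unfolding Q_def
      proof (intro allI impI)
        fix k r assume k: "k \<in> Arr C \<and> r \<in> Arr C \<and> Cod C k = Dom C (g \<cdot> w) \<and> Dom C r = Dom C k"
        then have k': "k \<in> Arr C" "Cod C k = Dom C w" using w S by auto
        have "mem (w \<cdot> k) s" using closed_sieveD(1)[OF cs, of w k] ws w k S by simp
        then show "(Cod C r = Dom C g \<and> (g \<cdot> w) \<cdot> k = g \<cdot> r \<longrightarrow> mem r s) \<and> (Cod C r = Dom C n \<and> (g \<cdot> w) \<cdot> k = n \<cdot> r \<longrightarrow> mem r t)"
          using ker[of "w \<cdot> k" r] crossing[of "w \<cdot> k" r] w k k' S by simp
      qed
    qed
    then show "mem (g \<cdot> w) (sieve_of (Cod C g) Q) \<longleftrightarrow> mem w s"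
      using w S by simp
  qed
  moreover have "sieve_of (Dom C n) (\<lambda>k. mem (n \<cdot> k) (sieve_of (Cod C g) Q)) = t"
  proof (rule trans[OF _ sieve_mem(2)[OF t, symmetric]], rule sieve_of_cong)
    fix w assume w: "w \<in> Arr C" "Cod C w = Dom C n"
    have "Q (n \<cdot> w) \<longleftrightarrow> mem w t"
    proof
      assume "Q (n \<cdot> w)"
      from this[unfolded Q_def, rule_format, of "Id C (Dom C w)" w] show "mem w t" using w S by simp
    next
      assume ws: "mem w t"
      show "Q (n \<cdot> w)"
        unfolding Q_def
      proof (intro allI impI)
        fix k r assume k: "k \<in> Arr C \<and> r \<in> Arr C \<and> Cod C k = Dom C (n \<cdot> w) \<and> Dom C r = Dom C k"
        then have k': "k \<in> Arr C" "Cod C k = Dom C w" using w S by auto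
        have wt: "mem (w \<cdot> k) t" using closed_sieveD(1)[OF ct, of w k] ws w k S by simp
        show "(Cod C r = Dom C g \<and> (n \<cdot> w) \<cdot> k = g \<cdot> r \<longrightarrow> mem r s) \<and> (Cod C r = Dom C n \<and> (n \<cdot> w) \<cdot> k = n \<cdot> r \<longrightarrow> mem r t)"
        proof (intro conjI impI)
          assume r: "Cod C r = Dom C g \<and> (n \<cdot> w) \<cdot> k = g \<cdot> r"
          then show "mem r s" using crossing[of r "w \<cdot> k"] wt w k k' S by simp
        next
          assume r: "Cod C r = Dom C n \<and> (n \<cdot> w) \<cdot> k = n \<cdot> r"
          have "w \<cdot> k = r" by (rule monoD[OF cov_mono[OF c]]) (use r w k k' S in simp_all)
          then show "mem r t" using wt by simp
        qed
      qed
    qed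
    then show "mem (n \<cdot> w) (sieve_of (Cod C g) Q) \<longleftrightarrow> mem w t"
      using w S by simp
  qed
  ultimately show "\<exists>z\<in>{sieve_of (Cod C g) Q |Q. closed_sieve (Cod C g) Q}.
      sieve_of (Dom C g) (\<lambda>f. mem (g \<cdot> f) z) = s \<and> sieve_of (Dom C n) (\<lambda>f. mem (n \<cdot> f) z) = t"
    by blast
qed simp

lemma el_OmegaD:
  assumes "X \<in> Obj C" "s \<in> el Omega X"
  shows "closed_sieve X (\<lambda>f. mem f s)" "s = sieve_of X (\<lambda>f. mem f s)"
  using sieve_mem[of s X] assms by (auto simp: el_Omega)

definition true :: 'u where
  "true = mkA one Omega (\<lambda>X _. sieve_of X (\<lambda>_. True))"

lemma max_sieve [simp]: "X \<in> Obj C \<Longrightarrow> sieve_of X (\<lambda>_. True) \<in> el Omega X"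
  by (auto simp: el_Omega closed_sieve_def)

lemma true_Hom: "true \<in> Hom Sh one Omega"
  unfolding true_def
  by (rule mkA_Hom) (auto simp: sheaf_Omega natural_def act_Omega intro!: sieve_of_cong)

lemma ap_true [simp]: "X \<in> Obj C \<Longrightarrow> ap true X (code {}) = sieve_of X (\<lambda>_. True)"
  by (simp add: true_def)

text \<open>This turns membership in a closed sieve into the truth of a restriction, so that a map
  into \<open>Omega\<close> is determined by where it takes the value true. The forward direction
  looks at an identity arrow.\<close>

lemma act_Omega_max:
  assumes f: "f \<in> Arr C" and s: "s \<in> el Omega (Cod C f)"
  shows "act Omega f s = sieve_of (Dom C f) (\<lambda>_. True) \<longleftrightarrow> mem f s"
proof
  assume "act Omega f s = sieve_of (Dom C f) (\<lambda>_. True)"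
  then have "mem (Id C (Dom C f)) (act Omega f s)" using f by simp
  then show "mem f s" using f s by (simp add: act_Omega)
next
  assume m: "mem f s"
  have "closed_sieve (Cod C f) (\<lambda>f. mem f s)" using el_OmegaD f s by simp
  note D = closed_sieveD(1)[OF this]
  show "act Omega f s = sieve_of (Dom C f) (\<lambda>_. True)"
    unfolding act_Omega[OF f s] by (rule sieve_of_cong) (use D m f in simp)
qed

text \<open>Elements at \<open>X\<close> are arrows from the sheaf \<open>rep X\<close>, and a mono
  separates these.\<close>

lemma mono_pointwise:
  assumes m: "mono_arrow Sh m" and X: "X \<in> Obj C" and x: "x \<in> el (Dom Sh m) X" "y \<in> el (Dom Sh m) X"
    and e: "ap m X x = ap m X y"
  shows "x = y"
proof -
  have h: "m \<in> Hom Sh (Dom Sh m) (Cod Sh m)" using ArrHom[OF Sh.mono_arr[OF m]] .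
  note sh = Hom_natural(1)[OF h]
  have y: "yarr (Dom Sh m) X x \<in> Hom Sh (rep X) (Dom Sh m)" "yarr (Dom Sh m) X y \<in> Hom Sh (rep X) (Dom Sh m)"
    using sh X x by simp_all
  have "yarr (Dom Sh m) X x = yarr (Dom Sh m) X y"
    by (rule Sh.monoD[OF m]) (use y comp_yarr[OF h X x(1)] comp_yarr[OF h X x(2)] e in \<open>auto simp: Hom_def\<close>)
  then show ?thesis using yarr_inject[OF sh X x] by simp
qed

lemma classifier_true: "is_subobject_classifier Sh true"
  unfolding is_subobject_classifier_def
proof (intro conjI allI impI)
  have D: "Dom Sh true = one" using true_Hom by (simp add: Hom_def)
  show "true \<in> Arr Sh" using true_Hom by (simp add: Hom_def)
  show "is_terminal Sh (Dom Sh true)" using D terminal_one by simp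
  fix m assume m: "mono_arrow Sh m"
  define A B where "A = Dom Sh m" and "B = Cod Sh m"
  have mH: "m \<in> Hom Sh A B" using Sh.mono_arr[OF m] by (simp add: A_def B_def Hom_def)
  note sh = Hom_natural(1,2)[OF mH]
  define im where "im X = ap m X ` el A X" for X
  \<comment> \<open>The truth value of \<open>b\<close> lying in the image of \<open>m\<close>
    collects the arrows along which \<open>b\<close> restricts into the image.\<close>
  define \<chi>f where "\<chi>f X b = sieve_of X (\<lambda>f. act B f b \<in> im (Dom C f))" for X b
  have im_act: "act B f b \<in> im (Dom C f)" if "f \<in> Arr C" "b \<in> im (Cod C f)" for f b
    using that sh by (auto simp: im_def ap_act[OF mH, symmetric] intro!: imageI)
  have cl: "closed_sieve X (\<lambda>f. act B f b \<in> im (Dom C f))" if X: "X \<in> Obj C" and b: "b \<in> el B X" for X b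
    unfolding closed_sieve_def
  proof (intro conjI ballI allI impI)
    show "act B (f \<cdot> k) b \<in> im (Dom C (f \<cdot> k))"
      if "f \<in> Arr C" "k \<in> Arr C" "Cod C f = X \<and> Cod C k = Dom C f \<and> act B f b \<in> im (Dom C f)" for f k
      using that im_act[of k "act B f b"] act_comp[OF sh(2), of k f b] b by simp
    show "act B h b \<in> im (Dom C h)" if c: "cov k f g n" and h: "h \<in> Arr C"
      and hh: "Cod C h = X \<and> Dom C h = Cod C g \<and> act B (h \<cdot> g) b \<in> im (Dom C (h \<cdot> g)) \<and> act B (h \<cdot> n) b \<in> im (Dom C (h \<cdot> n))"
      for k f g n h
    proof -
      note S = covD[OF c]
      have d: "Cod C h = X" "Dom C h = Cod C g" using hh by auto
      obtain x where x: "x \<in> el A (Dom C g)" "act B g (act B h b) = ap m (Dom C g) x"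
        using hh h S b act_comp[OF sh(2), of g h b] by (auto simp: im_def)
      obtain y where y: "y \<in> el A (Dom C n)" "act B n (act B h b) = ap m (Dom C n) y"
        using hh h S b act_comp[OF sh(2), of n h b] by (auto simp: im_def)
      have hb: "act B h b \<in> el B (Cod C g)" using h d b sh by simp
      \<comment> \<open>Closedness of this sieve uses both the mono and the sheaf \<open>A\<close>:
        the preimages \<open>x\<close> and \<open>y\<close> agree over the corner because
        \<open>m\<close> is injective, so they glue to a preimage of the whole element.\<close>
      have mm: "ap m (Dom C k) (act A k x) = ap m (Dom C k) (act A f y)"
      proof -
        have "ap m (Dom C k) (act A k x) = act B k (act B g (act B h b))"
          using ap_act[OF mH, of k x "Dom C k" "Dom C g"] x S by simp
        also have "\<dots> = act B (g \<cdot> k) (act B h b)" using act_comp[OF sh(2), of k g] hb S by simp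
        also have "\<dots> = act B f (act B n (act B h b))" using act_comp[OF sh(2), of f n] hb S by simp
        also have "\<dots> = ap m (Dom C k) (act A f y)"
          using ap_act[OF mH, of f y "Dom C k" "Dom C n"] y S by simp
        finally show ?thesis .
      qed
      have "act A k x = act A f y"
        by (rule mono_pointwise[OF m _ _ _ mm]) (use x y S sh in \<open>simp_all add: A_def[symmetric]\<close>)
      then obtain z where z: "z \<in> el A (Cod C g)" "act A g z = x" "act A n z = y"
        by (rule sheaf_glue[OF sh(1) c x(1) y(1)])
      have "act B h b = ap m (Cod C g) z"
      proof (rule sheaf_eq[OF sh(2) c])
        show "act B g (act B h b) = act B g (ap m (Cod C g) z)"
          using x z ap_act[OF mH, of g z "Dom C g" "Cod C g"] S by simp
        show "act B n (act B h b) = act B n (ap m (Cod C g) z)"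
          using y z ap_act[OF mH, of n z "Dom C n" "Cod C g"] S by simp
      qed (use hb z S mH in auto)
      then show ?thesis using z d by (auto simp: im_def)
    qed
  qed
  have \<chi>f_el: "\<chi>f X b \<in> el Omega X" if "X \<in> Obj C" "b \<in> el B X" for X b
    unfolding \<chi>f_def using cl[OF that] that by (auto simp: el_Omega)
  define \<chi> where "\<chi> = mkA B Omega \<chi>f"
  have \<chi>: "\<chi> \<in> Hom Sh B Omega"
    unfolding \<chi>_def
  proof (rule mkA_Hom[OF sh(2) sheaf_Omega])
    show "natural B Omega \<chi>f"
      unfolding natural_def
    proof (intro conjI ballI)
      fix f b assume f: "f \<in> Arr C" and b: "b \<in> el B (Cod C f)"
      show "\<chi>f (Dom C f) (act B f b) = act Omega f (\<chi>f (Cod C f) b)"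
        unfolding act_Omega[OF f \<chi>f_el[OF Cod_in_Obj[OF f] b]]
        by (subst \<chi>f_def, rule sieve_of_cong) (use f b act_comp[OF sh(2)] in \<open>simp add: \<chi>f_def\<close>)
    qed (rule \<chi>f_el)
  qed
  define k where "k = mkA A one (\<lambda>_ _. code {})"
  have k: "k \<in> Hom Sh A one" unfolding k_def by (rule mkA_Hom) (use sh in \<open>auto simp: natural_def\<close>)
  have max: "\<chi>f X b = sieve_of X (\<lambda>_. True) \<longleftrightarrow> b \<in> im X" if X: "X \<in> Obj C" "b \<in> el B X" for X b
  proof
    assume "\<chi>f X b = sieve_of X (\<lambda>_. True)"
    then have "mem (Id C X) (\<chi>f X b)" using X by simp
    then show "b \<in> im X" using X sh by (simp add: \<chi>f_def)
  next
    assume "b \<in> im X"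
    then show "\<chi>f X b = sieve_of X (\<lambda>_. True)"
      unfolding \<chi>f_def by (intro sieve_of_cong) (use im_act in auto)
  qed
  have pb: "is_pullback Sh m k \<chi> true"
  proof (rule pullback_pointwiseI)
    show "comm_square Sh m k \<chi> true"
    proof (rule Sh_squareI[OF mH k \<chi> true_Hom])
      fix X x assume x: "X \<in> Obj C" "x \<in> el A X"
      show "ap \<chi> X (ap m X x) = ap true X (ap k X x)"
        using x mH max[of X "ap m X x"] by (simp add: \<chi>_def k_def im_def)
    qed
    fix X b a assume X: "X \<in> Obj C" and b: "b \<in> el (Dom Sh \<chi>) X" and a: "a \<in> el (Dom Sh true) X"
      and e: "ap \<chi> X b = ap true X a"
    have b': "b \<in> el B X" and a': "a = code {}" using b a \<chi> D X by (auto simp: Hom_def)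
    then have "b \<in> im X" using e X max[OF X b'] by (simp add: \<chi>_def)
    then obtain x where x: "x \<in> el A X" "ap m X x = b" by (auto simp: im_def)
    show "\<exists>!c. c \<in> el (Dom Sh m) X \<and> ap m X c = b \<and> ap k X c = a"
      by (rule ex1I[of _ x])
        (use x a' X mono_pointwise[OF m X] in \<open>auto simp: A_def[symmetric] k_def\<close>)
  qed
  show "\<exists>!\<chi>. \<exists>k. is_pullback Sh m k \<chi> true"
  proof (rule ex1I[of _ \<chi>])
    show "\<exists>k. is_pullback Sh m k \<chi> true" using pb by blast
    fix \<psi> assume "\<exists>k. is_pullback Sh m k \<psi> true"
    then obtain l where l: "is_pullback Sh m l \<psi> true" by blast
    note L = Sh.pullback_square[OF l]
    have \<psi>: "\<psi> \<in> Hom Sh B Omega" and lH: "l \<in> Hom Sh A one"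
      using Sh.comm_squareD[OF L] D true_Hom by (auto simp: Hom_def A_def B_def)
    have max': "ap \<psi> X b = sieve_of X (\<lambda>_. True) \<longleftrightarrow> b \<in> im X" if X: "X \<in> Obj C" "b \<in> el B X" for X b
    proof
      assume e: "ap \<psi> X b = sieve_of X (\<lambda>_. True)"
      have "\<exists>!c. c \<in> el (Dom Sh m) X \<and> ap m X c = b \<and> ap l X c = code {}"
        by (rule pullback_pointwise[OF l X(1)]) (use e X \<psi> D in \<open>auto simp: Hom_def\<close>)
      then show "b \<in> im X" by (auto simp: im_def A_def)
    next
      assume "b \<in> im X"
      then obtain x where x: "x \<in> el A X" "b = ap m X x" by (auto simp: im_def)
      have "ap \<psi> X (ap m X x) = ap true X (ap l X x)"
        by (rule Sh_square_ap[OF L X(1)]) (use x in \<open>simp add: A_def\<close>)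
      moreover have "ap l X x = code {}" using ap_el[OF lH X(1) x(1)] X by simp
      ultimately show "ap \<psi> X b = sieve_of X (\<lambda>_. True)" using x X by simp
    qed
    \<comment> \<open>The pullback condition fixes where \<open>\<psi>\<close> is true, and by
      \<open>act_Omega_max\<close> this fixes every arrow of the sieve.\<close>
    show "\<psi> = \<chi>"
    proof (rule Sh_ext[OF \<psi> \<chi>])
      fix X b assume X: "X \<in> Obj C" "b \<in> el B X"
      have s: "ap \<psi> X b \<in> el Omega X" using \<psi> X by simp
      have "sieve_of X (\<lambda>f. mem f (ap \<psi> X b)) = \<chi>f X b"
        unfolding \<chi>f_def
      proof (rule sieve_of_cong)
        fix f assume f: "f \<in> Arr C" "Cod C f = X"
        have "mem f (ap \<psi> X b) \<longleftrightarrow> ap \<psi> (Dom C f) (act B f b) = sieve_of (Dom C f) (\<lambda>_. True)"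
          using act_Omega_max[OF f(1), of "ap \<psi> X b"] ap_act[OF \<psi> f(1), of b "Dom C f" X] f X s by simp
        also have "\<dots> \<longleftrightarrow> act B f b \<in> im (Dom C f)" using max' f X sh by simp
        finally show "mem f (ap \<psi> X b) \<longleftrightarrow> act B f b \<in> im (Dom C f)" .
      qed
      then show "ap \<psi> X b = ap \<chi> X b" using el_OmegaD(2)[OF X(1) s] X by (simp add: \<chi>_def)
    qed
  qed
qed

theorem topos_Sh: "topos Sh"
  unfolding topos_def
proof (intro conjI ballI)
  show "category Sh" by (rule category_Sh)
  show "\<exists>T. is_terminal Sh T" using terminal_one by blast
  show "has_pullbacks Sh" by (rule has_pullbacks_Sh)
  show "\<exists>t. is_subobject_classifier Sh t" using classifier_true by blast
  fix A B assume "A \<in> Obj Sh" "B \<in> Obj Sh"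
  then have "sheaf A" "sheaf B" by simp_all
  then show "\<exists>P p q. is_product Sh A B P p q" "\<exists>E P p q ev. is_exponential Sh A B E P p q ev"
    using product_pairs exponential_expo by blast+
qed

end

section \<open>The site of an rm-adhesive category\<close>

context category
begin

lemma van_kampen_pushout:
  assumes "van_kampen C m f g n" "comm_square C m' f' g' n'"
    "is_pullback C m' c a m" "is_pullback C f' c b f" "is_pullback C g' a d g" "is_pullback C n' b d n"
  shows "is_pushout C m' f' g' n'"
  using assms pullback_square unfolding van_kampen_def by metis

lemma van_kampen_pullback:
  assumes "van_kampen C m f g n" "is_pushout C m' f' g' n'"
    "is_pullback C m' c a m" "is_pullback C f' c b f" "comm_square C g' a d g" "comm_square C n' b d n"
  shows "is_pullback C g' a d g" "is_pullback C n' b d n"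
  using assms pullback_square pushout_square unfolding van_kampen_def by metis+

text \<open>The van Kampen property is applied to the cube whose top is the trivial pushout of an
  identity along \<open>f\<close> and whose vertical maps are \<open>m\<close>, two identities and
  \<open>n\<close>. Its front face is the square itself, up to orientation, and its right face is
  the kernel pair condition for \<open>n\<close>.\<close>

lemma van_kampen_mono:
  assumes vk: "van_kampen C m f g n" and p: "is_pushout C m f g n" and m: "mono_arrow C m"
  shows "is_pullback C m f g n" "mono_arrow C n"
proof -
  note S = comm_squareD[OF pushout_square[OF p]]
  have [simp]: "m \<in> Arr C" "f \<in> Arr C" "g \<in> Arr C" "n \<in> Arr C" "Dom C f = Dom C m" "Cod C m = Dom C g"
    "Cod C f = Dom C n" "Cod C n = Cod C g" "Dom C m \<in> Obj C" "Dom C n \<in> Obj C"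
    using S by auto
  have 1: "is_pullback C (Id C (Dom C m)) (Id C (Dom C m)) m m"
    using pullback_mono_comp[OF m, of "Id C (Dom C m)" "Dom C m"] by simp
  have 2: "is_pullback C f (Id C (Dom C m)) (Id C (Dom C n)) f" by (rule pullback_Id) simp_all
  have 3: "is_pushout C (Id C (Dom C m)) f f (Id C (Dom C n))" by (rule pushout_Id) simp_all
  have 4: "comm_square C f m n g" "comm_square C (Id C (Dom C n)) (Id C (Dom C n)) n n"
    using S(9) by (simp_all add: comm_square_def)
  note P = van_kampen_pullback[OF vk 3 1 2 4]
  show "is_pullback C m f g n" by (rule pullback_swap[OF P(1)])
  show "mono_arrow C n" by (rule mono_iff_pullback[OF P(2)]) simp
qed

text \<open>The faces over \<open>g\<close>, \<open>n\<close> and \<open>m\<close> are chosen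
  pullbacks. The arrow \<open>f'\<close> is then induced, and its face is a pullback by pasting and
  cancelling, since \<open>g \<cdot> m = n \<cdot> f\<close>; all side faces being pullbacks, the
  top is a pushout.\<close>

lemma van_kampen_stable:
  assumes pb: "has_pullbacks C" and vk: "van_kampen C m f g n" and p: "is_pushout C m f g n"
    and h: "h \<in> Arr C" "Cod C h = Cod C g"
  obtains m' f' g' n' a b c where "is_pushout C m' f' g' n'"
    "is_pullback C g' a h g" "is_pullback C n' b h n" "is_pullback C m' c a m" "is_pullback C f' c b f"
proof -
  note S = comm_squareD[OF pushout_square[OF p]]
  obtain g' a where G: "is_pullback C g' a h g" using pb S h unfolding has_pullbacks_def by metis
  obtain n' b where N: "is_pullback C n' b h n" using pb S h unfolding has_pullbacks_def by metis
  note GS = comm_squareD[OF pullback_square[OF G]] and NS = comm_squareD[OF pullback_square[OF N]]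
  obtain m' c where M: "is_pullback C m' c a m"
    using pb S GS unfolding has_pullbacks_def by metis
  note MS = comm_squareD[OF pullback_square[OF M]]
  have d: "Dom C a = Dom C g'" "Dom C b = Dom C n'" "Cod C a = Dom C g" "Cod C b = Dom C n"
    "Cod C g' = Dom C h" "Cod C n' = Dom C h" "Cod C m' = Dom C g'" "Dom C c = Dom C m'" "Cod C c = Dom C m"
    "Dom C f = Dom C m" "Cod C m = Dom C g" "Cod C f = Dom C n"
    using S GS NS MS by auto
  note arr = S(1-4) GS(1-4) NS(1-4) MS(1-4)
  have O: "is_pullback C (g' \<cdot> m') c h (n \<cdot> f)"
    using pullback_paste[OF M G] S(9) by simp
  have "comm_square C (g' \<cdot> m') (f \<cdot> c) h n"
    using comm_squareD(9)[OF pullback_square[OF O]] arr d h S(8) by (simp add: comm_square_def)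
  then obtain f' where f': "f' \<in> Arr C" "Dom C f' = Dom C (g' \<cdot> m')" "Cod C f' = Dom C n'"
    "n' \<cdot> f' = g' \<cdot> m'" "b \<cdot> f' = f \<cdot> c"
    by (rule pullback_factor[OF N])
  have F: "is_pullback C f' c b f"
  proof (rule pullback_cancel[OF _ N])
    show "is_pullback C (n' \<cdot> f') c h (n \<cdot> f)" using O f' by simp
    show "comm_square C f' c b f" using f' arr d by (simp add: comm_square_def)
  qed
  have "comm_square C m' f' g' n'" using f' arr d by (simp add: comm_square_def)
  then have "is_pushout C m' f' g' n'" by (rule van_kampen_pushout[OF vk _ M F G N])
  then show ?thesis using that G N M F by blast
qed

text \<open>
  The kernel pair of \<open>g\<close> is the pushout \<open>Q\<close> of \<open>m\<close> along the diagonal \<open>\<delta>\<close> of the kernel pair of \<open>f\<close>.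
  To see this, put \<open>Q\<close> on top of a cube over the given square: its pullback along \<open>m\<close> is again the
  kernel pair of \<open>f\<close>, and gluing the second projection of that kernel pair onto \<open>Q\<close> collapses \<open>Q\<close>
  to the codomain of \<open>m\<close>, so that the front face of the cube is a pullback.
\<close>

lemma kernel_pair_pushout:
  assumes rm: "rm_adhesive C" and m: "regular_mono C m" and p: "is_pushout C m f g n"
  obtains k1 k2 \<delta> i j a b where "is_pullback C k1 k2 f f" "is_pushout C m \<delta> i j" "is_pullback C b a g g"
    "Cod C i = Dom C a" "a \<cdot> i = Id C (Dom C g)" "b \<cdot> i = Id C (Dom C g)" "a \<cdot> j = m \<cdot> k1" "b \<cdot> j = m \<cdot> k2"
    "Dom C j = Dom C k1"
proof -
  have pbs: "has_pullbacks C" and pos: "has_rm_pushouts C"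
    and vk: "\<And>m f g n. regular_mono C m \<Longrightarrow> is_pushout C m f g n \<Longrightarrow> van_kampen C m f g n"
    using rm by (auto simp: rm_adhesive_def)
  note mm = regular_mono_mono[OF m]
  note S = comm_squareD[OF pushout_square[OF p]]
  have arr [simp]: "m \<in> Arr C" "f \<in> Arr C" "g \<in> Arr C" "n \<in> Arr C" "Dom C f = Dom C m" "Cod C m = Dom C g"
    "Cod C f = Dom C n" "Cod C n = Cod C g" "Dom C m \<in> Obj C" "Dom C n \<in> Obj C" "Dom C g \<in> Obj C"
    using S by auto
  obtain k1 k2 where K: "is_pullback C k1 k2 f f" using pbs arr unfolding has_pullbacks_def by blast
  note KS = comm_squareD[OF pullback_square[OF K]]
  have [simp]: "k1 \<in> Arr C" "k2 \<in> Arr C" "Dom C k2 = Dom C k1" "Cod C k1 = Dom C m" "Cod C k2 = Dom C m"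
    "Dom C k1 \<in> Obj C"
    using KS by auto
  have "comm_square C (Id C (Dom C m)) (Id C (Dom C m)) f f" by (simp add: comm_square_def)
  then obtain \<delta> where \<delta>: "\<delta> \<in> Arr C" "Dom C \<delta> = Dom C (Id C (Dom C m))" "Cod C \<delta> = Dom C k1"
    "k1 \<cdot> \<delta> = Id C (Dom C m)" "k2 \<cdot> \<delta> = Id C (Dom C m)"
    by (rule pullback_factor[OF K])
  have [simp]: "\<delta> \<in> Arr C" "Dom C \<delta> = Dom C m" "Cod C \<delta> = Dom C k1" using \<delta> by auto
  obtain i j where ij: "is_pushout C m \<delta> i j" using pos m \<delta> unfolding has_rm_pushouts_def by fastforce
  note IJ = comm_squareD[OF pushout_square[OF ij]]
  have [simp]: "i \<in> Arr C" "j \<in> Arr C" "Dom C i = Dom C g" "Dom C j = Dom C k1" "Cod C j = Cod C i" "Cod C i \<in> Obj C"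
    using IJ by auto
  \<comment> \<open>An arrow from \<open>Q\<close> to the domain of \<open>g\<close> that restricts
    to the identity along \<open>i\<close> and to \<open>m \<cdot> k\<close> along \<open>j\<close>.
    For the two projections \<open>k1\<close> and \<open>k2\<close> this gives the candidate kernel
    pair \<open>a\<close>, \<open>b\<close>.\<close>
  have fold: "\<exists>a. a \<in> Arr C \<and> Dom C a = Cod C i \<and> Cod C a = Dom C g \<and> a \<cdot> i = Id C (Dom C g) \<and> a \<cdot> j = m \<cdot> k"
    if k: "k \<in> Arr C" "Dom C k = Dom C k1" "Cod C k = Dom C m" "k \<cdot> \<delta> = Id C (Dom C m)" for k
  proof -
    have "comm_square C m \<delta> (Id C (Dom C g)) (m \<cdot> k)" using k by (simp add: comm_square_def)
    then obtain a where "a \<in> Arr C" "Dom C a = Cod C i" "Cod C a = Cod C (Id C (Dom C g))"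
      "a \<cdot> i = Id C (Dom C g)" "a \<cdot> j = m \<cdot> k"
      by (rule pushout_factor[OF ij])
    then show ?thesis by (intro exI[of _ a]) simp
  qed
  obtain a where a [simp]: "a \<in> Arr C" "Dom C a = Cod C i" "Cod C a = Dom C g"
    and ai: "a \<cdot> i = Id C (Dom C g)" and aj: "a \<cdot> j = m \<cdot> k1" using fold[of k1] \<delta> by auto
  obtain b where b [simp]: "b \<in> Arr C" "Dom C b = Cod C i" "Cod C b = Dom C g"
    and bi: "b \<cdot> i = Id C (Dom C g)" and bj: "b \<cdot> j = m \<cdot> k2" using fold[of k2] \<delta> by auto
  have left: "is_pullback C j k1 a m"
  proof -
    obtain \<pi> \<rho> where P: "is_pullback C \<pi> \<rho> a m" using pbs unfolding has_pullbacks_def by fastforce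
    note PS = comm_squareD[OF pullback_square[OF P]]
    have [simp]: "\<pi> \<in> Arr C" "\<rho> \<in> Arr C" "Dom C \<rho> = Dom C \<pi>" "Cod C \<pi> = Cod C i" "Cod C \<rho> = Dom C m"
      using PS by auto
    have ims: "comm_square C (i \<cdot> m) (Id C (Dom C m)) a m"
      using comp_eq_comp[OF ai, of m] by (simp add: comm_square_def)
    obtain u where u: "u \<in> Arr C" "Dom C u = Dom C (i \<cdot> m)" "Cod C u = Dom C \<pi>"
      "\<pi> \<cdot> u = i \<cdot> m" "\<rho> \<cdot> u = Id C (Dom C m)" by (rule pullback_factor[OF P ims])
    have [simp]: "u \<in> Arr C" "Dom C u = Dom C m" "Cod C u = Dom C \<pi>" using u by auto
    have js: "comm_square C j k1 a m" using aj by (simp add: comm_square_def)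
    obtain v where v: "v \<in> Arr C" "Dom C v = Dom C j" "Cod C v = Dom C \<pi>"
      "\<pi> \<cdot> v = j" "\<rho> \<cdot> v = k1" by (rule pullback_factor[OF P js])
    have [simp]: "v \<in> Arr C" "Dom C v = Dom C k1" "Cod C v = Dom C \<pi>" using v by auto
    have uv: "u = v \<cdot> \<delta>"
      by (rule pullback_eq[OF P])
        (use u v \<delta> IJ(9) comp_eq_comp[OF v(4), of \<delta>] comp_eq_comp[OF v(5), of \<delta>] in simp_all)
    \<comment> \<open>The pushout that defines \<open>Q\<close> is pulled back along
      \<open>\<pi>\<close>. The van Kampen property makes the result a pushout of an identity, so
      \<open>v\<close> is invertible, with inverse \<open>w\<close>; hence \<open>j\<close> is the
      pullback of \<open>m\<close> along \<open>a\<close>.\<close>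
    have "is_pushout C (Id C (Dom C m)) \<delta> u v"
    proof (rule van_kampen_pushout[OF vk[OF m ij]])
      show "comm_square C (Id C (Dom C m)) \<delta> u v" using uv by (simp add: comm_square_def)
      show "is_pullback C (Id C (Dom C m)) (Id C (Dom C m)) m m"
        using pullback_mono_comp[OF mm, of "Id C (Dom C m)" "Dom C m"] by simp
      show "is_pullback C \<delta> (Id C (Dom C m)) (Id C (Dom C k1)) \<delta>" by (rule pullback_Id) simp_all
      show "is_pullback C u m \<pi> i"
      proof (rule pullback_cancel[OF _ pullback_swap[OF P]])
        show "is_pullback C (\<rho> \<cdot> u) m m (a \<cdot> i)"
          unfolding u(5) ai by (rule pullback_Id) simp_all
        show "comm_square C u m \<pi> i" using u by (simp add: comm_square_def)
      qed
      show "is_pullback C v (Id C (Dom C k1)) \<pi> j"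
      proof (rule pullback_cancel[OF _ pullback_swap[OF P]])
        show "is_pullback C (\<rho> \<cdot> v) (Id C (Dom C k1)) m (a \<cdot> j)"
          unfolding v(5) aj by (rule pullback_mono_comp[OF mm]) simp_all
        show "comm_square C v (Id C (Dom C k1)) \<pi> j" using v by (simp add: comm_square_def)
      qed
    qed
    note po = this
    have "comm_square C (Id C (Dom C m)) \<delta> \<delta> (Id C (Dom C k1))" by (simp add: comm_square_def)
    then obtain w where w: "w \<in> Arr C" "Dom C w = Cod C u" "Cod C w = Cod C \<delta>" "w \<cdot> u = \<delta>" "w \<cdot> v = Id C (Dom C k1)"
      by (rule pushout_factor[OF po])
    have [simp]: "w \<in> Arr C" "Dom C w = Dom C \<pi>" "Cod C w = Dom C k1" "Dom C \<pi> \<in> Obj C" using w by auto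
    have vw: "v \<cdot> w = Id C (Dom C \<pi>)"
      by (rule pushout_eq[OF po]) (use w uv in simp_all)
    have "is_pullback C v k1 \<rho> (Id C (Dom C m))"
    proof (rule pullbackI)
      show "comm_square C v k1 \<rho> (Id C (Dom C m))" using v by (simp add: comm_square_def)
      show "\<exists>k. k \<in> Arr C \<and> Dom C k = Dom C x \<and> Cod C k = Dom C v \<and> v \<cdot> k = x \<and> k1 \<cdot> k = y"
        if xy: "comm_square C x y \<rho> (Id C (Dom C m))" for x y
      proof -
        have x [simp]: "x \<in> Arr C" "Cod C x = Dom C \<pi>" "y \<in> Arr C" "Cod C y = Dom C m" and "\<rho> \<cdot> x = y"
          using comm_squareD[OF xy] by auto
        have vx: "v \<cdot> (w \<cdot> x) = x" using comp_eq_comp[OF vw, of x] by simp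
        moreover have "k1 \<cdot> (w \<cdot> x) = y"
          using comp_eq_comp[OF v(5), of "w \<cdot> x"] vx \<open>\<rho> \<cdot> x = y\<close> by simp
        ultimately show ?thesis by (intro exI[of _ "w \<cdot> x"]) simp
      qed
      show "h = k" if h: "h \<in> Arr C" "k \<in> Arr C" "Cod C h = Dom C v" "Cod C k = Dom C v" "v \<cdot> h = v \<cdot> k" for h k
      proof -
        have "w \<cdot> (v \<cdot> h) = h" using comp_eq_comp[OF w(5), of h] h(1,3) by simp
        moreover have "w \<cdot> (v \<cdot> k) = k" using comp_eq_comp[OF w(5), of k] h(2,4) by simp
        ultimately show ?thesis using h(5) by metis
      qed
    qed
    from pullback_paste[OF this P] show ?thesis using v by simp
  qed
  \<comment> \<open>Pasted onto the pushout of \<open>m\<close> along \<open>\<delta>\<close>, this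
    square gives the trivial pushout of \<open>m\<close> along an identity, as
    \<open>k2 \<cdot> \<delta>\<close> and \<open>b \<cdot> i\<close> are identities.\<close>
  have top: "is_pushout C j k2 b m"
  proof (rule pushout_cancel[OF _ ij])
    show "is_pushout C m (k2 \<cdot> \<delta>) (b \<cdot> i) m" unfolding bi \<delta>(5) by (rule pushout_Id) simp_all
    show "comm_square C j k2 b m" using bj by (simp add: comm_square_def)
  qed
  have "g \<cdot> b = g \<cdot> a"
  proof (rule pushout_eq[OF ij])
    show "(g \<cdot> b) \<cdot> i = (g \<cdot> a) \<cdot> i" using ai bi by simp
    have "g \<cdot> (m \<cdot> k2) = g \<cdot> (m \<cdot> k1)"
      using comm_square_ext[OF pushout_square[OF p], of k1] comm_square_ext[OF pushout_square[OF p], of k2] KS(9) by simp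
    then show "(g \<cdot> b) \<cdot> j = (g \<cdot> a) \<cdot> j" using aj bj by simp
  qed simp_all
  \<comment> \<open>In the final cube the top is the pushout just found, the vertical maps are
    \<open>a\<close>, \<open>f\<close>, \<open>k1\<close> and \<open>g\<close>, and the right face
    is the given square. The front face delivered by the van Kampen property is the kernel pair of
    \<open>g\<close>.\<close>
  then have "comm_square C b a g g" by (simp add: comm_square_def)
  then have "is_pullback C b a g g"
    by (rule van_kampen_pullback(1)[OF vk[OF m p] top left pullback_swap[OF K] _ pushout_square[OF p]])
  then show ?thesis using that K ij ai bi aj bj by auto
qed

text \<open>For the kernel condition, \<open>u\<close> and \<open>v\<close> together form one arrow
  \<open>w\<close> into the kernel pair of \<open>g\<close>. That object is a pushout with legs
  \<open>i\<close>, the diagonal, and \<open>j\<close>, coming from the kernel pair of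
  \<open>f\<close>; pulling this pushout back along \<open>w\<close> yields the required
  cover.\<close>

lemma rm_adhesive_site:
  assumes rm: "rm_adhesive C"
  shows "square_site C (\<lambda>m f g n. regular_mono C m \<and> is_pushout C m f g n)"
proof
  have pbs: "has_pullbacks C" using rm by (simp add: rm_adhesive_def)
  have vk: "\<And>m f g n. regular_mono C m \<Longrightarrow> is_pushout C m f g n \<Longrightarrow> van_kampen C m f g n"
    using rm by (auto simp: rm_adhesive_def)
  fix m f g n assume c: "regular_mono C m \<and> is_pushout C m f g n"
  then have m: "regular_mono C m" and p: "is_pushout C m f g n" by auto
  note S = comm_squareD[OF pushout_square[OF p]]
  show "is_pushout C m f g n" by (rule p)
  show "is_pullback C m f g n" "mono_arrow C n"
    using van_kampen_mono[OF vk[OF m p] p regular_mono_mono[OF m]] by simp_all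
  show "\<exists>m' f' g' n' a b c. (regular_mono C m' \<and> is_pushout C m' f' g' n') \<and>
      is_pullback C g' a h g \<and> is_pullback C n' b h n \<and> comm_square C m' c a m \<and> comm_square C f' c b f"
    if h: "h \<in> Arr C" "Cod C h = Cod C g" for h
  proof -
    obtain m' f' g' n' a b c where q: "is_pushout C m' f' g' n'"
      "is_pullback C g' a h g" "is_pullback C n' b h n" "is_pullback C m' c a m" "is_pullback C f' c b f"
      by (rule van_kampen_stable[OF pbs vk[OF m p] p h])
    have "regular_mono C m'" by (rule pullback_regular_mono[OF q(4) m])
    then show ?thesis using q pullback_square by blast
  qed
  show "\<exists>m' f' s t c c'. (regular_mono C m' \<and> is_pushout C m' f' s t) \<and> Cod C s = Dom C u \<and> u \<cdot> s = v \<cdot> s \<and>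
        c \<in> Arr C \<and> c' \<in> Arr C \<and> Dom C c = Dom C t \<and> Dom C c' = Dom C t \<and>
        Cod C c = Dom C m \<and> Cod C c' = Dom C m \<and> u \<cdot> t = m \<cdot> c \<and> v \<cdot> t = m \<cdot> c' \<and> f \<cdot> c = f \<cdot> c'"
    if u: "u \<in> Arr C" "v \<in> Arr C" "Dom C u = Dom C v" "Cod C u = Dom C g" "Cod C v = Dom C g" "g \<cdot> u = g \<cdot> v" for u v
  proof -
    obtain k1 k2 \<delta> i j a b where k: "is_pullback C k1 k2 f f" "is_pushout C m \<delta> i j" "is_pullback C b a g g"
      "Cod C i = Dom C a" "a \<cdot> i = Id C (Dom C g)" "b \<cdot> i = Id C (Dom C g)" "a \<cdot> j = m \<cdot> k1" "b \<cdot> j = m \<cdot> k2"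
      "Dom C j = Dom C k1"
      by (rule kernel_pair_pushout[OF rm m p])
    note K = comm_squareD[OF pullback_square[OF k(1)]] and IJ = comm_squareD[OF pushout_square[OF k(2)]]
      and AB = comm_squareD[OF pullback_square[OF k(3)]]
    have "comm_square C u v g g" using u S by (simp add: comm_square_def)
    then obtain w where w: "w \<in> Arr C" "Dom C w = Dom C u" "Cod C w = Dom C b" "b \<cdot> w = u" "a \<cdot> w = v"
      by (rule pullback_factor[OF k(3)])
    have wi: "Cod C w = Cod C i" using w k(4) AB by simp
    obtain m' f' s t x y z where q: "is_pushout C m' f' s t" "is_pullback C s x w i" "is_pullback C t y w j"
      "is_pullback C m' z x m" "is_pullback C f' z y \<delta>"
      by (rule van_kampen_stable[OF pbs vk[OF m k(2)] k(2) w(1) wi])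
    note X = comm_squareD[OF pullback_square[OF q(2)]] and Y = comm_squareD[OF pullback_square[OF q(3)]]
    have d: "Cod C s = Dom C w" "Cod C t = Dom C w" "Dom C x = Dom C s" "Dom C y = Dom C t" "Cod C x = Dom C g"
      "Cod C y = Dom C k1" "Dom C a = Dom C b" "Cod C i = Dom C a" "Cod C j = Dom C a" "Dom C i = Dom C g"
      "Dom C j = Dom C k1"
      using X Y IJ K AB S k(4,9) by (auto simp: comm_square_def)
    note arr = S(1-4) u(1,2) w(1) X(1-4) Y(1-4) K(1-4) IJ(1-4) AB(1-4)
    have kk: "Dom C k2 = Dom C k1" "Cod C k1 = Dom C m" "Cod C k2 = Dom C m" "Dom C b = Cod C w"
      "Cod C m = Dom C g" "Dom C f = Dom C m"
      using K S w by auto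
    \<comment> \<open>Over the leg \<open>i\<close> the pair is diagonal, so both components reduce
      to \<open>x\<close>; over \<open>j\<close> they are the \<open>m\<close>-images of the two
      projections of the kernel pair of \<open>f\<close>.\<close>
    have us: "u \<cdot> s = x"
    proof -
      have "u \<cdot> s = b \<cdot> (i \<cdot> x)" using comp_eq_comp[OF w(4), of s] X(9) arr d kk by simp
      then show ?thesis using comp_eq_comp[OF k(6), of x] arr d kk by simp
    qed
    have vs: "v \<cdot> s = x"
    proof -
      have "v \<cdot> s = a \<cdot> (i \<cdot> x)" using comp_eq_comp[OF w(5), of s] X(9) arr d kk by simp
      then show ?thesis using comp_eq_comp[OF k(5), of x] arr d kk by simp
    qed
    have ut: "u \<cdot> t = m \<cdot> (k2 \<cdot> y)"
    proof -
      have "u \<cdot> t = b \<cdot> (j \<cdot> y)" using comp_eq_comp[OF w(4), of t] Y(9) arr d kk by simp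
      then show ?thesis using comp_eq_comp[OF k(8), of y] arr d kk by simp
    qed
    have vt: "v \<cdot> t = m \<cdot> (k1 \<cdot> y)"
    proof -
      have "v \<cdot> t = a \<cdot> (j \<cdot> y)" using comp_eq_comp[OF w(5), of t] Y(9) arr d kk by simp
      then show ?thesis using comp_eq_comp[OF k(7), of y] arr d kk by simp
    qed
    have ff: "f \<cdot> (k2 \<cdot> y) = f \<cdot> (k1 \<cdot> y)"
      using comm_square_ext[OF pullback_square[OF k(1)], of y] arr d kk by simp
    have "regular_mono C m'" by (rule pullback_regular_mono[OF q(4) m])
    moreover have "Cod C s = Dom C u" using d w by simp
    moreover have "k2 \<cdot> y \<in> Arr C" "k1 \<cdot> y \<in> Arr C" "Dom C (k2 \<cdot> y) = Dom C t" "Dom C (k1 \<cdot> y) = Dom C t"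
      "Cod C (k2 \<cdot> y) = Dom C m" "Cod C (k1 \<cdot> y) = Dom C m"
      using arr d kk by simp_all
    ultimately show ?thesis using q(1) us vs ut vt ff by metis
  qed
qed

end

section \<open>Relations in an elementary topos\<close>

context category
begin

section \<open>Subobjects and relations through their generalised elements\<close>

definition thru :: "'a \<Rightarrow> 'a \<Rightarrow> bool" where
  "thru m h \<longleftrightarrow> (\<exists>l. l \<in> Arr C \<and> Dom C l = Dom C h \<and> Cod C l = Dom C m \<and> m \<cdot> l = h)"

lemma thruI: "l \<in> Arr C \<Longrightarrow> Dom C l = Dom C h \<Longrightarrow> Cod C l = Dom C m \<Longrightarrow> m \<cdot> l = h \<Longrightarrow> thru m h"
  by (auto simp: thru_def)

lemma thruE:
  assumes "thru m h"
  obtains l where "l \<in> Arr C" "Dom C l = Dom C h" "Cod C l = Dom C m" "m \<cdot> l = h"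
  using assms by (auto simp: thru_def)

text \<open>A relation from \<open>A\<close> to \<open>W\<close> is a jointly monic span instead of
  a mono into a product. Thus a graph or a pair of legs of a square is a relation as it stands;
  \<open>inr\<close> is membership of a pair of generalised elements.\<close>

definition rel :: "'a \<Rightarrow> 'a \<Rightarrow> 'o \<Rightarrow> 'o \<Rightarrow> bool" where
  "rel r s A W \<longleftrightarrow> r \<in> Arr C \<and> s \<in> Arr C \<and> Dom C s = Dom C r \<and> Cod C r = A \<and> Cod C s = W \<and>
    (\<forall>h k. h \<in> Arr C \<and> k \<in> Arr C \<and> Dom C h = Dom C k \<and> Cod C h = Dom C r \<and> Cod C k = Dom C r \<and>
      r \<cdot> h = r \<cdot> k \<and> s \<cdot> h = s \<cdot> k \<longrightarrow> h = k)"

lemma relI: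
  assumes "r \<in> Arr C" "s \<in> Arr C" "Dom C s = Dom C r" "Cod C r = A" "Cod C s = W"
    "\<And>h k. h \<in> Arr C \<Longrightarrow> k \<in> Arr C \<Longrightarrow> Dom C h = Dom C k \<Longrightarrow> Cod C h = Dom C r \<Longrightarrow> Cod C k = Dom C r \<Longrightarrow>
      r \<cdot> h = r \<cdot> k \<Longrightarrow> s \<cdot> h = s \<cdot> k \<Longrightarrow> h = k"
  shows "rel r s A W"
  using assms unfolding rel_def by blast

lemma relD:
  assumes "rel r s A W"
  shows "r \<in> Arr C" "s \<in> Arr C" "Dom C s = Dom C r" "Cod C r = A" "Cod C s = W"
  using assms by (auto simp: rel_def)

lemma rel_eq:
  assumes "rel r s A W" "r \<cdot> h = r \<cdot> k" "s \<cdot> h = s \<cdot> k" "h \<in> Arr C" "k \<in> Arr C" "Dom C h = Dom C k"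
    "Cod C h = Dom C r" "Cod C k = Dom C r"
  shows "h = k"
  using assms unfolding rel_def by blast

definition inr :: "'a \<Rightarrow> 'a \<Rightarrow> 'a \<Rightarrow> 'a \<Rightarrow> bool" where
  "inr r s x w \<longleftrightarrow> (\<exists>k. k \<in> Arr C \<and> Dom C k = Dom C x \<and> Cod C k = Dom C r \<and> r \<cdot> k = x \<and> s \<cdot> k = w)"

lemma inrI: "k \<in> Arr C \<Longrightarrow> Dom C k = Dom C x \<Longrightarrow> Cod C k = Dom C r \<Longrightarrow> r \<cdot> k = x \<Longrightarrow> s \<cdot> k = w \<Longrightarrow> inr r s x w"
  by (auto simp: inr_def)

lemma inrE:
  assumes "inr r s x w"
  obtains k where "k \<in> Arr C" "Dom C k = Dom C x" "Cod C k = Dom C r" "r \<cdot> k = x" "s \<cdot> k = w"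
  using assms by (auto simp: inr_def)

lemma product_arr:
  assumes "is_product C A B P p q"
  shows "p \<in> Arr C" "q \<in> Arr C" "Dom C p = P" "Dom C q = P" "Cod C p = A" "Cod C q = B"
  using assms by (auto simp: is_product_def Hom_def)

lemma product_pair:
  assumes "is_product C A B P p q" "x \<in> Arr C" "y \<in> Arr C" "Dom C y = Dom C x" "Cod C x = A" "Cod C y = B"
  obtains k where "k \<in> Arr C" "Dom C k = Dom C x" "Cod C k = P" "p \<cdot> k = x" "q \<cdot> k = y"
proof -
  have "x \<in> Hom C (Dom C x) A" "y \<in> Hom C (Dom C x) B" using assms by (auto simp: Hom_def)
  then have "\<exists>!k. k \<in> Hom C (Dom C x) P \<and> p \<cdot> k = x \<and> q \<cdot> k = y"
    using assms(1) unfolding is_product_def by blast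
  then show ?thesis using that by (auto simp: Hom_def)
qed

lemma product_eq:
  assumes P: "is_product C A B P p q" and e: "p \<cdot> h = p \<cdot> k" "q \<cdot> h = q \<cdot> k"
    and a: "h \<in> Arr C" "k \<in> Arr C" "Dom C h = Dom C k" "Cod C h = P" "Cod C k = P"
  shows "h = k"
proof -
  note pa = product_arr[OF P]
  have "p \<cdot> k \<in> Hom C (Dom C k) A" "q \<cdot> k \<in> Hom C (Dom C k) B" using pa a by (auto simp: Hom_def)
  then have "\<exists>!l. l \<in> Hom C (Dom C k) P \<and> p \<cdot> l = p \<cdot> k \<and> q \<cdot> l = q \<cdot> k"
    using P unfolding is_product_def by blast
  moreover have "h \<in> Hom C (Dom C k) P" "k \<in> Hom C (Dom C k) P" using a by (auto simp: Hom_def)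
  ultimately show ?thesis using e by blast
qed

end

locale elementary_topos = category C for C :: "('o, 'a) cat" (structure) +
  assumes topos: "topos C"
begin

section \<open>Truth values, equalizers and comprehension in a topos\<close>

definition tru :: 'a where "tru = (SOME t. is_subobject_classifier C t)"

lemma classifier: "is_subobject_classifier C tru"
  using topos someI_ex[of "is_subobject_classifier C"] by (auto simp: topos_def tru_def)

lemma tru_arr [simp]: "tru \<in> Arr C"
  using classifier by (simp add: is_subobject_classifier_def)

lemma tru_ex1: "X \<in> Obj C \<Longrightarrow> \<exists>!k. k \<in> Hom C X (Dom C tru)"
  using classifier by (auto simp: is_subobject_classifier_def is_terminal_def)

lemma pullback_ex:
  assumes "g \<in> Arr C" "n \<in> Arr C" "Cod C g = Cod C n"
  obtains m f where "is_pullback C m f g n"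
  using topos assms unfolding topos_def has_pullbacks_def by blast

lemma product_ex:
  assumes "A \<in> Obj C" "B \<in> Obj C"
  obtains P p q where "is_product C A B P p q"
  using topos assms unfolding topos_def by blast

definition bang :: "'o \<Rightarrow> 'a" where "bang X = (THE k. k \<in> Hom C X (Dom C tru))"

lemma bang [simp]: "X \<in> Obj C \<Longrightarrow> bang X \<in> Arr C" "X \<in> Obj C \<Longrightarrow> Dom C (bang X) = X"
  "X \<in> Obj C \<Longrightarrow> Cod C (bang X) = Dom C tru"
  using theI'[OF tru_ex1, of X] by (auto simp: bang_def Hom_def)

lemma bang_unique: "k \<in> Arr C \<Longrightarrow> Cod C k = Dom C tru \<Longrightarrow> k = bang (Dom C k)"
  using tru_ex1[of "Dom C k"] bang[of "Dom C k"] by (auto simp: Hom_def)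

definition tr :: "'o \<Rightarrow> 'a" where "tr X = tru \<cdot> bang X"

lemma tr [simp]: "X \<in> Obj C \<Longrightarrow> tr X \<in> Arr C" "X \<in> Obj C \<Longrightarrow> Dom C (tr X) = X"
  "X \<in> Obj C \<Longrightarrow> Cod C (tr X) = Cod C tru"
  by (simp_all add: tr_def)

lemma mono_tru: "mono_arrow C tru"
proof (rule monoI[OF tru_arr])
  fix h k assume h: "h \<in> Arr C" "k \<in> Arr C" "Dom C h = Dom C k" "Cod C h = Dom C tru" "Cod C k = Dom C tru"
  have "h = bang (Dom C h)" using h by (intro bang_unique)
  also have "\<dots> = k" unfolding h(3) using h by (intro bang_unique[symmetric])
  finally show "h = k" .
qed

lemma pullback_tru:
  assumes p: "is_pullback C m k \<chi> tru" and h: "h \<in> Arr C" "Cod C h = Dom C \<chi>"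
  shows "thru m h \<longleftrightarrow> \<chi> \<cdot> h = tr (Dom C h)"
proof
  note S = comm_squareD[OF pullback_square[OF p]]
  assume "thru m h"
  then obtain l where l: "l \<in> Arr C" "Dom C l = Dom C h" "Cod C l = Dom C m" "m \<cdot> l = h" by (rule thruE)
  have "\<chi> \<cdot> h = tru \<cdot> (k \<cdot> l)" using comm_square_ext[OF pullback_square[OF p], of l] l by simp
  also have "k \<cdot> l = bang (Dom C h)" using bang_unique[of "k \<cdot> l"] l S by simp
  finally show "\<chi> \<cdot> h = tr (Dom C h)" by (simp add: tr_def)
next
  note S = comm_squareD[OF pullback_square[OF p]]
  assume "\<chi> \<cdot> h = tr (Dom C h)"
  then have "comm_square C h (bang (Dom C h)) \<chi> tru"
    using h S by (simp add: comm_square_def tr_def)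
  then obtain l where "l \<in> Arr C" "Dom C l = Dom C h" "Cod C l = Dom C m" "m \<cdot> l = h"
    by (rule pullback_factor[OF p])
  then show "thru m h" by (rule thruI)
qed

lemma pullback_truI:
  assumes m: "mono_arrow C m" and \<chi>: "\<chi> \<in> Arr C" "Dom C \<chi> = Cod C m" "Cod C \<chi> = Cod C tru"
    and t: "\<And>h. h \<in> Arr C \<Longrightarrow> Cod C h = Cod C m \<Longrightarrow> thru m h \<longleftrightarrow> \<chi> \<cdot> h = tr (Dom C h)"
  shows "is_pullback C m (bang (Dom C m)) \<chi> tru"
proof (rule pullbackI)
  note ma = mono_arr[OF m]
  have "thru m m" by (rule thruI[of "Id C (Dom C m)"]) (use ma in simp_all)
  then have "\<chi> \<cdot> m = tr (Dom C m)" using t ma by simp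
  then show "comm_square C m (bang (Dom C m)) \<chi> tru" using ma \<chi> by (simp add: comm_square_def tr_def)
  show "h = k" if "h \<in> Arr C" "k \<in> Arr C" "Dom C h = Dom C k" "Cod C h = Dom C m" "Cod C k = Dom C m"
    "m \<cdot> h = m \<cdot> k" for h k by (rule monoD[OF m]) (use that in simp_all)
  show "\<exists>k. k \<in> Arr C \<and> Dom C k = Dom C x \<and> Cod C k = Dom C m \<and> m \<cdot> k = x \<and> bang (Dom C m) \<cdot> k = y"
    if xy: "comm_square C x y \<chi> tru" for x y
  proof -
    note S = comm_squareD[OF xy]
    have y: "y = bang (Dom C x)" using bang_unique[of y] S by simp
    then have "thru m x" using t[of x] S \<chi> by (simp add: tr_def)
    then obtain l where l: "l \<in> Arr C" "Dom C l = Dom C x" "Cod C l = Dom C m" "m \<cdot> l = x" by (rule thruE)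
    have "bang (Dom C m) \<cdot> l = y" using bang_unique[of "bang (Dom C m) \<cdot> l"] l ma y by simp
    then show ?thesis using l by (intro exI[of _ l]) simp
  qed
qed

lemma classify:
  assumes m: "mono_arrow C m"
  obtains \<chi> where "\<chi> \<in> Arr C" "Dom C \<chi> = Cod C m" "Cod C \<chi> = Cod C tru"
    "\<And>h. h \<in> Arr C \<Longrightarrow> Cod C h = Cod C m \<Longrightarrow> thru m h \<longleftrightarrow> \<chi> \<cdot> h = tr (Dom C h)"
proof -
  obtain \<chi> k where p: "is_pullback C m k \<chi> tru"
    using classifier m unfolding is_subobject_classifier_def by blast
  note S = comm_squareD[OF pullback_square[OF p]]
  show ?thesis by (rule that[of \<chi>]) (use S pullback_tru[OF p] in auto)
qed

lemma comprehension:
  assumes \<chi>: "\<chi> \<in> Arr C" "Cod C \<chi> = Cod C tru"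
  obtains m where "mono_arrow C m" "Cod C m = Dom C \<chi>"
    "\<And>h. h \<in> Arr C \<Longrightarrow> Cod C h = Dom C \<chi> \<Longrightarrow> thru m h \<longleftrightarrow> \<chi> \<cdot> h = tr (Dom C h)"
proof -
  obtain m k where p: "is_pullback C m k \<chi> tru" using pullback_ex[of \<chi> tru] \<chi> by auto
  show ?thesis
    by (rule that[of m]) (use pullback_mono[OF p mono_tru] pullback_tru[OF p] comm_squareD[OF pullback_square[OF p]] in auto)
qed

text \<open>Both maps classify the subobject obtained by comprehension from \<open>\<chi>\<close>,
  and characteristic maps are unique. It is therefore enough to compare where the two are
  true.\<close>

lemma truth_eq:
  assumes \<chi>: "\<chi> \<in> Arr C" "Cod C \<chi> = Cod C tru" "\<psi> \<in> Arr C" "Cod C \<psi> = Cod C tru" "Dom C \<psi> = Dom C \<chi>"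
    and e: "\<And>h. h \<in> Arr C \<Longrightarrow> Cod C h = Dom C \<chi> \<Longrightarrow> \<chi> \<cdot> h = tr (Dom C h) \<longleftrightarrow> \<psi> \<cdot> h = tr (Dom C h)"
  shows "\<chi> = \<psi>"
proof -
  obtain m where m: "mono_arrow C m" "Cod C m = Dom C \<chi>"
    and t: "\<And>h. h \<in> Arr C \<Longrightarrow> Cod C h = Dom C \<chi> \<Longrightarrow> thru m h \<longleftrightarrow> \<chi> \<cdot> h = tr (Dom C h)"
    using comprehension[OF \<chi>(1,2)] by blast
  have 1: "is_pullback C m (bang (Dom C m)) \<chi> tru" by (rule pullback_truI) (use m t \<chi> in simp_all)
  have 2: "is_pullback C m (bang (Dom C m)) \<psi> tru" by (rule pullback_truI) (use m t \<chi> e in simp_all)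
  have "\<exists>!\<chi>. \<exists>k. is_pullback C m k \<chi> tru"
    using classifier m(1) by (simp add: is_subobject_classifier_def)
  then show ?thesis using 1 2 by blast
qed

text \<open>The equalizer is the pullback of the diagonal of the codomain along the pairing of
  \<open>u\<close> and \<open>v\<close>.\<close>

lemma equalizer_ex:
  assumes u: "u \<in> Arr C" "v \<in> Arr C" "Dom C v = Dom C u" "Cod C v = Cod C u"
  obtains e where "mono_arrow C e" "Cod C e = Dom C u"
    "\<And>h. h \<in> Arr C \<Longrightarrow> Cod C h = Dom C u \<Longrightarrow> thru e h \<longleftrightarrow> u \<cdot> h = v \<cdot> h"
proof -
  have Y: "Cod C u \<in> Obj C" using u by simp
  obtain P p q where P: "is_product C (Cod C u) (Cod C u) P p q" using product_ex[OF Y Y] by blast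
  note pa = product_arr[OF P]
  obtain z where z: "z \<in> Arr C" "Dom C z = Dom C u" "Cod C z = P" "p \<cdot> z = u" "q \<cdot> z = v"
    by (rule product_pair[OF P u(1,2,3) refl u(4)])
  obtain \<Delta> where \<Delta>: "\<Delta> \<in> Arr C" "Dom C \<Delta> = Cod C u" "Cod C \<Delta> = P" "p \<cdot> \<Delta> = Id C (Cod C u)" "q \<cdot> \<Delta> = Id C (Cod C u)"
    using product_pair[OF P, of "Id C (Cod C u)" "Id C (Cod C u)"] Y by auto
  have p\<Delta>: "p \<cdot> (\<Delta> \<cdot> h) = h" "q \<cdot> (\<Delta> \<cdot> h) = h" if "h \<in> Arr C" "Cod C h = Cod C u" for h
    using comp_eq_comp[OF \<Delta>(4), of h] comp_eq_comp[OF \<Delta>(5), of h] that pa \<Delta> by simp_all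
  have mono: "mono_arrow C \<Delta>"
    by (rule monoI) (use \<Delta> p\<Delta> in \<open>metis+\<close>)
  obtain e k where E: "is_pullback C e k z \<Delta>" using pullback_ex[of z \<Delta>] z \<Delta> by auto
  note S = comm_squareD[OF pullback_square[OF E]]
  show ?thesis
  proof (rule that[of e])
    show "mono_arrow C e" by (rule pullback_mono[OF E mono])
    show "Cod C e = Dom C u" using S z by simp
    fix h assume h: "h \<in> Arr C" "Cod C h = Dom C u"
    have pz: "p \<cdot> (z \<cdot> h) = u \<cdot> h" "q \<cdot> (z \<cdot> h) = v \<cdot> h"
      using comp_eq_comp[OF z(4), of h] comp_eq_comp[OF z(5), of h] h z pa by simp_all
    show "thru e h \<longleftrightarrow> u \<cdot> h = v \<cdot> h"
    proof
      assume "thru e h"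
      then obtain l where l: "l \<in> Arr C" "Dom C l = Dom C h" "Cod C l = Dom C e" "e \<cdot> l = h" by (rule thruE)
      have "z \<cdot> h = \<Delta> \<cdot> (k \<cdot> l)" using comm_square_ext[OF pullback_square[OF E], of l] l by simp
      moreover have "k \<cdot> l \<in> Arr C" "Cod C (k \<cdot> l) = Cod C u" using l S \<Delta> by auto
      ultimately show "u \<cdot> h = v \<cdot> h" using pz p\<Delta>[of "k \<cdot> l"] by metis
    next
      assume eq: "u \<cdot> h = v \<cdot> h"
      have "z \<cdot> h = \<Delta> \<cdot> (u \<cdot> h)"
      proof (rule product_eq[OF P])
        have d: "u \<cdot> h \<in> Arr C" "Cod C (u \<cdot> h) = Cod C u" using h u by simp_all
        show "p \<cdot> (z \<cdot> h) = p \<cdot> (\<Delta> \<cdot> (u \<cdot> h))" "q \<cdot> (z \<cdot> h) = q \<cdot> (\<Delta> \<cdot> (u \<cdot> h))"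
          using pz p\<Delta>[OF d] eq by simp_all
      qed (use h u z \<Delta> in simp_all)
      then have "comm_square C h (u \<cdot> h) z \<Delta>" using h u z \<Delta> by (simp add: comm_square_def)
      then obtain l where "l \<in> Arr C" "Dom C l = Dom C h" "Cod C l = Dom C e" "e \<cdot> l = h"
        by (rule pullback_factor[OF E])
      then show "thru e h" by (rule thruI)
    qed
  qed
qed

text \<open>The subobject is the equalizer of the two characteristic maps. Their equality on
  \<open>h\<close> is an equality of truth values, hence a comparison at all later stages
  \<open>h \<cdot> k\<close>; this is the forcing clause for a biconditional.\<close>

lemma iff_comprehension:
  assumes s: "mono_arrow C s" "mono_arrow C s'" "Cod C s' = Cod C s"
  obtains e where "mono_arrow C e" "Cod C e = Cod C s"
    "\<And>h. h \<in> Arr C \<Longrightarrow> Cod C h = Cod C s \<Longrightarrow>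
      thru e h \<longleftrightarrow> (\<forall>k. k \<in> Arr C \<and> Cod C k = Dom C h \<longrightarrow> (thru s (h \<cdot> k) \<longleftrightarrow> thru s' (h \<cdot> k)))"
proof -
  obtain \<chi> where \<chi>: "\<chi> \<in> Arr C" "Dom C \<chi> = Cod C s" "Cod C \<chi> = Cod C tru"
    and ts: "\<And>h. h \<in> Arr C \<Longrightarrow> Cod C h = Cod C s \<Longrightarrow> thru s h \<longleftrightarrow> \<chi> \<cdot> h = tr (Dom C h)"
    using classify[OF s(1)] by blast
  obtain \<psi> where \<psi>: "\<psi> \<in> Arr C" "Dom C \<psi> = Cod C s" "Cod C \<psi> = Cod C tru"
    and ts': "\<And>h. h \<in> Arr C \<Longrightarrow> Cod C h = Cod C s \<Longrightarrow> thru s' h \<longleftrightarrow> \<psi> \<cdot> h = tr (Dom C h)"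
    using classify[OF s(2)] s(3) by metis
  obtain e where e: "mono_arrow C e" "Cod C e = Dom C \<chi>"
    and te: "\<And>h. h \<in> Arr C \<Longrightarrow> Cod C h = Dom C \<chi> \<Longrightarrow> thru e h \<longleftrightarrow> \<chi> \<cdot> h = \<psi> \<cdot> h"
    using equalizer_ex[of \<chi> \<psi>] \<chi> \<psi> by auto
  show ?thesis
  proof (rule that[of e])
    fix h assume h: "h \<in> Arr C" "Cod C h = Cod C s"
    show "thru e h \<longleftrightarrow> (\<forall>k. k \<in> Arr C \<and> Cod C k = Dom C h \<longrightarrow> (thru s (h \<cdot> k) \<longleftrightarrow> thru s' (h \<cdot> k)))"
    proof
      assume "thru e h"
      then have eq: "\<chi> \<cdot> h = \<psi> \<cdot> h" using te h \<chi> by simp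
      show "\<forall>k. k \<in> Arr C \<and> Cod C k = Dom C h \<longrightarrow> (thru s (h \<cdot> k) \<longleftrightarrow> thru s' (h \<cdot> k))"
      proof (intro allI impI)
        fix k assume "k \<in> Arr C \<and> Cod C k = Dom C h"
        then have k: "k \<in> Arr C" "Cod C k = Dom C h" by auto
        have "\<chi> \<cdot> (h \<cdot> k) = \<psi> \<cdot> (h \<cdot> k)" using comp_eq_comp[OF eq, of k] \<chi> \<psi> h k by simp
        then show "thru s (h \<cdot> k) \<longleftrightarrow> thru s' (h \<cdot> k)" using ts[of "h \<cdot> k"] ts'[of "h \<cdot> k"] h k by simp
      qed
    next
      assume a: "\<forall>k. k \<in> Arr C \<and> Cod C k = Dom C h \<longrightarrow> (thru s (h \<cdot> k) \<longleftrightarrow> thru s' (h \<cdot> k))"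
      have "\<chi> \<cdot> h = \<psi> \<cdot> h"
      proof (rule truth_eq)
        fix k assume k: "k \<in> Arr C" "Cod C k = Dom C (\<chi> \<cdot> h)"
        then have k': "Cod C k = Dom C h" using h \<chi> by simp
        have "thru s (h \<cdot> k) \<longleftrightarrow> thru s' (h \<cdot> k)" using a k k' by blast
        then show "(\<chi> \<cdot> h) \<cdot> k = tr (Dom C k) \<longleftrightarrow> (\<psi> \<cdot> h) \<cdot> k = tr (Dom C k)"
          using ts[of "h \<cdot> k"] ts'[of "h \<cdot> k"] h k k' \<chi> \<psi> by simp
      qed (use h \<chi> \<psi> in simp_all)
      then show "thru e h" using te h \<chi> by simp
    qed
  qed (use e \<chi> in simp_all)
qed

section \<open>Power objects\<close>

definition represents :: "'o \<Rightarrow> ('a \<Rightarrow> 'a \<Rightarrow> bool) \<Rightarrow> 'o \<Rightarrow> 'a \<Rightarrow> 'a \<Rightarrow> 'a \<Rightarrow> bool" where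
  "represents W mem A \<phi> r s \<longleftrightarrow> (\<forall>x w. x \<in> Arr C \<and> w \<in> Arr C \<and> Dom C w = Dom C x \<and> Cod C x = A \<and> Cod C w = W \<longrightarrow>
    (mem (\<phi> \<cdot> x) w \<longleftrightarrow> inr r s x w))"

text \<open>\<open>E\<close> is a power object of \<open>W\<close>, and \<open>mem\<close> is the membership relation on generalised elements.\<close>

definition power :: "'o \<Rightarrow> 'o \<Rightarrow> ('a \<Rightarrow> 'a \<Rightarrow> bool) \<Rightarrow> bool" where
  "power W E mem \<longleftrightarrow>
    (\<forall>r s A. rel r s A W \<longrightarrow> (\<exists>\<phi>\<in>Hom C A E. represents W mem A \<phi> r s)) \<and>
    (\<forall>A. \<forall>\<phi>\<in>Hom C A E. \<forall>\<psi>\<in>Hom C A E.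
      (\<forall>x w. x \<in> Arr C \<longrightarrow> w \<in> Arr C \<longrightarrow> Dom C w = Dom C x \<longrightarrow> Cod C x = A \<longrightarrow> Cod C w = W \<longrightarrow>
        mem (\<phi> \<cdot> x) w = mem (\<psi> \<cdot> x) w) \<longrightarrow> \<phi> = \<psi>) \<and>
    (\<forall>A. \<forall>\<phi>\<in>Hom C A E. \<exists>r s. rel r s A W \<and> represents W mem A \<phi> r s)"

lemma representsD:
  "represents W mem A \<phi> r s \<Longrightarrow> x \<in> Arr C \<Longrightarrow> w \<in> Arr C \<Longrightarrow> Dom C w = Dom C x \<Longrightarrow> Cod C x = A \<Longrightarrow> Cod C w = W \<Longrightarrow>
    mem (\<phi> \<cdot> x) w \<longleftrightarrow> inr r s x w"
  unfolding represents_def by blast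

lemma power_represent:
  assumes "power W E mem" "rel r s A W"
  obtains \<phi> where "\<phi> \<in> Arr C" "Dom C \<phi> = A" "Cod C \<phi> = E" "represents W mem A \<phi> r s"
  using assms unfolding power_def Hom_def by blast

lemma power_eq:
  assumes "power W E mem" "\<phi> \<in> Hom C A E" "\<psi> \<in> Hom C A E"
    "\<And>x w. x \<in> Arr C \<Longrightarrow> w \<in> Arr C \<Longrightarrow> Dom C w = Dom C x \<Longrightarrow> Cod C x = A \<Longrightarrow> Cod C w = W \<Longrightarrow>
      mem (\<phi> \<cdot> x) w \<longleftrightarrow> mem (\<psi> \<cdot> x) w"
  shows "\<phi> = \<psi>"
  using assms(1)[unfolded power_def, THEN conjunct2, THEN conjunct1, rule_format, OF assms(2,3)] assms(4) by blast

lemma power_relation: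
  assumes "power W E mem" "\<phi> \<in> Hom C A E"
  obtains r s where "rel r s A W" "represents W mem A \<phi> r s"
  using assms unfolding power_def by blast

text \<open>The power object is the exponential of the object of truth values by \<open>W\<close>. A
  relation from \<open>A\<close> to \<open>W\<close> pairs to a mono into the product of
  \<open>A\<close> and \<open>W\<close>; its characteristic map is transposed to an arrow from
  \<open>A\<close>.\<close>

lemma power_ex:
  assumes W: "W \<in> Obj C"
  obtains E mem where "power W E mem"
proof -
  have "\<exists>E P p q ev. is_exponential C W (Cod C tru) E P p q ev"
    using topos W unfolding topos_def by (auto simp del: Cod_in_Obj simp add: Cod_in_Obj[OF tru_arr])
  then obtain E P p q ev where X: "is_exponential C W (Cod C tru) E P p q ev" by blast
  have P: "is_product C E W P p q" and ev: "ev \<in> Arr C" "Dom C ev = P" "Cod C ev = Cod C tru"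
    and cur: "\<And>Z Q r s h. is_product C Z W Q r s \<Longrightarrow> h \<in> Hom C Q (Cod C tru) \<Longrightarrow>
      \<exists>!k. k \<in> Hom C Z E \<and> (\<exists>l. l \<in> Hom C Q P \<and> p \<cdot> l = k \<cdot> r \<and> q \<cdot> l = s \<and> ev \<cdot> l = h)"
    using X by (auto simp: is_exponential_def Hom_def)
  note pa = product_arr[OF P]
  \<comment> \<open>Membership says that evaluation is true on the pair of \<open>s\<close> and
    \<open>w\<close>, the pair being the unique arrow \<open>l\<close> into the product.\<close>
  define mem where "mem s w \<longleftrightarrow> (\<exists>l. l \<in> Arr C \<and> Dom C l = Dom C s \<and> Cod C l = P \<and> p \<cdot> l = s \<and> q \<cdot> l = w \<and> ev \<cdot> l = tr (Dom C s))" for s w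
  have mem_iff: "mem s w \<longleftrightarrow> ev \<cdot> l = tr (Dom C s)"
    if "l \<in> Arr C" "Dom C l = Dom C s" "Cod C l = P" "p \<cdot> l = s" "q \<cdot> l = w" for s w l
  proof
    assume "mem s w"
    then obtain k where k: "k \<in> Arr C" "Dom C k = Dom C s" "Cod C k = P" "p \<cdot> k = s" "q \<cdot> k = w" "ev \<cdot> k = tr (Dom C s)"
      unfolding mem_def by blast
    have "k = l" by (rule product_eq[OF P]) (use k that in simp_all)
    then show "ev \<cdot> l = tr (Dom C s)" using k by simp
  qed (use that in \<open>auto simp: mem_def\<close>)
  \<comment> \<open>Uncurrying: the map \<open>ev \<cdot> l\<close> on the product of
    \<open>A\<close> and \<open>W\<close> is true exactly on the pairs that \<open>\<phi>\<close>
    relates. It serves both uniqueness and the recovery of a relation from an arrow.\<close>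
  have trans: "\<exists>l. l \<in> Arr C \<and> Dom C l = Q \<and> Cod C l = P \<and> p \<cdot> l = \<phi> \<cdot> r \<and> q \<cdot> l = s \<and>
      (\<forall>z. z \<in> Arr C \<and> Cod C z = Q \<longrightarrow> (mem (\<phi> \<cdot> (r \<cdot> z)) (s \<cdot> z) \<longleftrightarrow> (ev \<cdot> l) \<cdot> z = tr (Dom C z)))"
    if \<phi>: "\<phi> \<in> Hom C A E" and Q: "is_product C A W Q r s" for A \<phi> Q r s
  proof -
    note qa = product_arr[OF Q]
    have ph: "\<phi> \<in> Arr C" "Dom C \<phi> = A" "Cod C \<phi> = E" using \<phi> by (auto simp: Hom_def)
    obtain l where l: "l \<in> Arr C" "Dom C l = Q" "Cod C l = P" "p \<cdot> l = \<phi> \<cdot> r" "q \<cdot> l = s"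
      using product_pair[OF P, of "\<phi> \<cdot> r" s] ph qa by auto
    have "mem (\<phi> \<cdot> (r \<cdot> z)) (s \<cdot> z) \<longleftrightarrow> (ev \<cdot> l) \<cdot> z = tr (Dom C z)" if z: "z \<in> Arr C" "Cod C z = Q" for z
      using mem_iff[of "l \<cdot> z" "\<phi> \<cdot> (r \<cdot> z)" "s \<cdot> z"] z l ph qa pa ev comp_eq_comp[OF l(4), of z] comp_eq_comp[OF l(5), of z]
      by simp
    then show ?thesis using l by blast
  qed
  have "power W E mem"
    unfolding power_def
  proof (intro conjI allI ballI impI)
    fix r s A assume R: "rel r s A W"
    note ra = relD[OF R]
    have A: "A \<in> Obj C" using ra by auto
    obtain Q qa qb where Q: "is_product C A W Q qa qb" using product_ex[OF A W] by blast
    note qarr = product_arr[OF Q]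
    obtain j where j: "j \<in> Arr C" "Dom C j = Dom C r" "Cod C j = Q" "qa \<cdot> j = r" "qb \<cdot> j = s"
      using product_pair[OF Q, of r s] ra by auto
    have mj: "mono_arrow C j"
    proof (rule monoI[OF j(1)])
      fix h k assume h: "h \<in> Arr C" "k \<in> Arr C" "Dom C h = Dom C k" "Cod C h = Dom C j" "Cod C k = Dom C j" "j \<cdot> h = j \<cdot> k"
      show "h = k"
        by (rule rel_eq[OF R])
          (use h j qarr comp_eq_comp[OF j(4), of h] comp_eq_comp[OF j(4), of k] comp_eq_comp[OF j(5), of h] comp_eq_comp[OF j(5), of k] in simp_all)
    qed
    obtain \<chi> where \<chi>: "\<chi> \<in> Arr C" "Dom C \<chi> = Cod C j" "Cod C \<chi> = Cod C tru"
      and tj: "\<And>h. h \<in> Arr C \<Longrightarrow> Cod C h = Cod C j \<Longrightarrow> thru j h \<longleftrightarrow> \<chi> \<cdot> h = tr (Dom C h)"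
      using classify[OF mj] by blast
    have "\<chi> \<in> Hom C Q (Cod C tru)" using \<chi> j by (simp add: Hom_def)
    from cur[OF Q this] obtain \<phi> l where \<phi>: "\<phi> \<in> Hom C A E" and l: "l \<in> Hom C Q P" "p \<cdot> l = \<phi> \<cdot> qa" "q \<cdot> l = qb" "ev \<cdot> l = \<chi>"
      by blast
    have la: "l \<in> Arr C" "Dom C l = Q" "Cod C l = P" "\<phi> \<in> Arr C" "Dom C \<phi> = A" "Cod C \<phi> = E" using l \<phi> by (auto simp: Hom_def)
    have "mem (\<phi> \<cdot> x) w \<longleftrightarrow> inr r s x w"
      if x: "x \<in> Arr C" "w \<in> Arr C" "Dom C w = Dom C x" "Cod C x = A" "Cod C w = W" for x w
    proof -
      obtain z where z: "z \<in> Arr C" "Dom C z = Dom C x" "Cod C z = Q" "qa \<cdot> z = x" "qb \<cdot> z = w"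
        by (rule product_pair[OF Q x])
      have "mem (\<phi> \<cdot> x) w \<longleftrightarrow> ev \<cdot> (l \<cdot> z) = tr (Dom C x)"
        using mem_iff[of "l \<cdot> z" "\<phi> \<cdot> x" w] z la pa qarr x comp_eq_comp[OF l(2), of z] comp_eq_comp[OF l(3), of z] by simp
      also have "\<dots> \<longleftrightarrow> thru j z" using tj[of z] z j la ev comp_eq_comp[OF l(4), of z] by simp
      also have "\<dots> \<longleftrightarrow> inr r s x w"
      proof
        assume "thru j z"
        then obtain k where k: "k \<in> Arr C" "Dom C k = Dom C z" "Cod C k = Dom C j" "j \<cdot> k = z" by (rule thruE)
        show "inr r s x w"
          by (rule inrI[of k]) (use k z j qarr comp_eq_comp[OF j(4), of k] comp_eq_comp[OF j(5), of k] in simp_all)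
      next
        assume "inr r s x w"
        then obtain k where k: "k \<in> Arr C" "Dom C k = Dom C x" "Cod C k = Dom C r" "r \<cdot> k = x" "s \<cdot> k = w" by (rule inrE)
        have "j \<cdot> k = z"
          by (rule product_eq[OF Q]) (use k z j qarr comp_eq_comp[OF j(4), of k] comp_eq_comp[OF j(5), of k] in simp_all)
        then show "thru j z" by (intro thruI[of k]) (use k j z in simp_all)
      qed
      finally show ?thesis .
    qed
    then show "\<exists>\<phi>\<in>Hom C A E. represents W mem A \<phi> r s" using \<phi> unfolding represents_def by blast
  next
    fix A \<phi> \<psi> assume \<phi>: "\<phi> \<in> Hom C A E" and \<psi>: "\<psi> \<in> Hom C A E"
      and eq: "\<forall>x w. x \<in> Arr C \<longrightarrow> w \<in> Arr C \<longrightarrow> Dom C w = Dom C x \<longrightarrow> Cod C x = A \<longrightarrow> Cod C w = W \<longrightarrow>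
        mem (\<phi> \<cdot> x) w = mem (\<psi> \<cdot> x) w"
    have A: "A \<in> Obj C" using \<phi> by (auto simp: Hom_def)
    obtain Q r s where Q: "is_product C A W Q r s" using product_ex[OF A W] by blast
    note qa = product_arr[OF Q]
    obtain l where l: "l \<in> Arr C" "Dom C l = Q" "Cod C l = P" "p \<cdot> l = \<phi> \<cdot> r" "q \<cdot> l = s"
      and lm: "\<And>z. z \<in> Arr C \<Longrightarrow> Cod C z = Q \<Longrightarrow> (mem (\<phi> \<cdot> (r \<cdot> z)) (s \<cdot> z) \<longleftrightarrow> (ev \<cdot> l) \<cdot> z = tr (Dom C z))"
      using trans[OF \<phi> Q] by blast
    obtain l' where l': "l' \<in> Arr C" "Dom C l' = Q" "Cod C l' = P" "p \<cdot> l' = \<psi> \<cdot> r" "q \<cdot> l' = s"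
      and lm': "\<And>z. z \<in> Arr C \<Longrightarrow> Cod C z = Q \<Longrightarrow> (mem (\<psi> \<cdot> (r \<cdot> z)) (s \<cdot> z) \<longleftrightarrow> (ev \<cdot> l') \<cdot> z = tr (Dom C z))"
      using trans[OF \<psi> Q] by blast
    have e: "ev \<cdot> l = ev \<cdot> l'"
    proof (rule truth_eq)
      fix z assume z: "z \<in> Arr C" "Cod C z = Dom C (ev \<cdot> l)"
      then have "Cod C z = Q" using l ev by simp
      then show "(ev \<cdot> l) \<cdot> z = tr (Dom C z) \<longleftrightarrow> (ev \<cdot> l') \<cdot> z = tr (Dom C z)"
        using lm[of z] lm'[of z] eq[rule_format, of "r \<cdot> z" "s \<cdot> z"] z qa by simp
    qed (use l l' ev in simp_all)
    have "ev \<cdot> l \<in> Hom C Q (Cod C tru)" using l ev by (simp add: Hom_def)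
    from cur[OF Q this] show "\<phi> = \<psi>" using \<phi> \<psi> l l' e by (auto simp: Hom_def)
  next
    fix A \<phi> assume \<phi>: "\<phi> \<in> Hom C A E"
    have A: "A \<in> Obj C" using \<phi> by (auto simp: Hom_def)
    obtain Q r s where Q: "is_product C A W Q r s" using product_ex[OF A W] by blast
    note qa = product_arr[OF Q]
    obtain l where l: "l \<in> Arr C" "Dom C l = Q" "Cod C l = P" "p \<cdot> l = \<phi> \<cdot> r" "q \<cdot> l = s"
      and lm: "\<And>z. z \<in> Arr C \<Longrightarrow> Cod C z = Q \<Longrightarrow> (mem (\<phi> \<cdot> (r \<cdot> z)) (s \<cdot> z) \<longleftrightarrow> (ev \<cdot> l) \<cdot> z = tr (Dom C z))"
      using trans[OF \<phi> Q] by blast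
    obtain j where j: "mono_arrow C j" "Cod C j = Q"
      and tj: "\<And>h. h \<in> Arr C \<Longrightarrow> Cod C h = Q \<Longrightarrow> thru j h \<longleftrightarrow> (ev \<cdot> l) \<cdot> h = tr (Dom C h)"
      using comprehension[of "ev \<cdot> l"] l ev by (auto simp del: assoc)
    note ja = mono_arr[OF j(1)]
    have R: "rel (r \<cdot> j) (s \<cdot> j) A W"
    proof (rule relI)
      fix h k assume h: "h \<in> Arr C" "k \<in> Arr C" "Dom C h = Dom C k" "Cod C h = Dom C (r \<cdot> j)" "Cod C k = Dom C (r \<cdot> j)"
        "(r \<cdot> j) \<cdot> h = (r \<cdot> j) \<cdot> k" "(s \<cdot> j) \<cdot> h = (s \<cdot> j) \<cdot> k"
      have d: "Cod C h = Dom C j" "Cod C k = Dom C j" using h qa ja j by simp_all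
      have "j \<cdot> h = j \<cdot> k" by (rule product_eq[OF Q]) (use h d qa ja j in simp_all)
      then show "h = k" by (rule monoD[OF j(1)]) (use h d in simp_all)
    qed (use qa ja j in simp_all)
    have "mem (\<phi> \<cdot> x) w \<longleftrightarrow> inr (r \<cdot> j) (s \<cdot> j) x w"
      if x: "x \<in> Arr C" "w \<in> Arr C" "Dom C w = Dom C x" "Cod C x = A" "Cod C w = W" for x w
    proof -
      obtain z where z: "z \<in> Arr C" "Dom C z = Dom C x" "Cod C z = Q" "r \<cdot> z = x" "s \<cdot> z = w"
        by (rule product_pair[OF Q x])
      have "mem (\<phi> \<cdot> x) w \<longleftrightarrow> thru j z" using lm[of z] tj[of z] z by simp
      also have "\<dots> \<longleftrightarrow> inr (r \<cdot> j) (s \<cdot> j) x w"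
      proof
        assume "thru j z"
        then obtain k where k: "k \<in> Arr C" "Dom C k = Dom C z" "Cod C k = Dom C j" "j \<cdot> k = z" by (rule thruE)
        show "inr (r \<cdot> j) (s \<cdot> j) x w" by (rule inrI[of k]) (use k z j ja qa in simp_all)
      next
        assume "inr (r \<cdot> j) (s \<cdot> j) x w"
        then obtain k where k: "k \<in> Arr C" "Dom C k = Dom C x" "Cod C k = Dom C (r \<cdot> j)" "(r \<cdot> j) \<cdot> k = x" "(s \<cdot> j) \<cdot> k = w"
          by (rule inrE)
        have d: "Cod C k = Dom C j" using k qa ja j by simp
        have "j \<cdot> k = z" by (rule product_eq[OF Q]) (use k d z j ja qa in simp_all)
        then show "thru j z" by (intro thruI[of k]) (use k d z in simp_all)
      qed
      finally show ?thesis .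
    qed
    then show "\<exists>r s. rel r s A W \<and> represents W mem A \<phi> r s" using R unfolding represents_def by blast
  qed
  then show ?thesis by (rule that)
qed

end

section \<open>Pushouts along monomorphisms in a topos are van Kampen\<close>

context elementary_topos
begin

text \<open>Relations from the final corner to \<open>W\<close> are arrows into a power object, and
  arrows out of a pushout are determined by their restrictions to the legs.\<close>

lemma relation_ext:
  assumes p: "is_pushout C m f g n" and q: "rel q1 q2 (Cod C g) W" and r: "rel r1 r2 (Cod C g) W"
    and g: "\<And>x w. x \<in> Arr C \<Longrightarrow> w \<in> Arr C \<Longrightarrow> Dom C w = Dom C x \<Longrightarrow> Cod C x = Dom C g \<Longrightarrow> Cod C w = W \<Longrightarrow>
      inr q1 q2 (g \<cdot> x) w \<longleftrightarrow> inr r1 r2 (g \<cdot> x) w"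
    and n: "\<And>x w. x \<in> Arr C \<Longrightarrow> w \<in> Arr C \<Longrightarrow> Dom C w = Dom C x \<Longrightarrow> Cod C x = Dom C n \<Longrightarrow> Cod C w = W \<Longrightarrow>
      inr q1 q2 (n \<cdot> x) w \<longleftrightarrow> inr r1 r2 (n \<cdot> x) w"
    and x: "x \<in> Arr C" "w \<in> Arr C" "Dom C w = Dom C x" "Cod C x = Cod C g" "Cod C w = W"
  shows "inr q1 q2 x w \<longleftrightarrow> inr r1 r2 x w"
proof -
  note S = comm_squareD[OF pushout_square[OF p]]
  have "W \<in> Obj C" using x by auto
  then obtain E mem where E: "power W E mem" by (rule power_ex)
  obtain \<phi> where \<phi>: "\<phi> \<in> Arr C" "Dom C \<phi> = Cod C g" "Cod C \<phi> = E" "represents W mem (Cod C g) \<phi> q1 q2"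
    by (rule power_represent[OF E q])
  obtain \<psi> where \<psi>: "\<psi> \<in> Arr C" "Dom C \<psi> = Cod C g" "Cod C \<psi> = E" "represents W mem (Cod C g) \<psi> r1 r2"
    by (rule power_represent[OF E r])
  note m\<phi> = representsD[OF \<phi>(4)] and m\<psi> = representsD[OF \<psi>(4)]
  have restrict: "\<phi> \<cdot> k = \<psi> \<cdot> k" if k: "k \<in> Arr C" "Cod C k = Cod C g"
    and e: "\<And>x w. x \<in> Arr C \<Longrightarrow> w \<in> Arr C \<Longrightarrow> Dom C w = Dom C x \<Longrightarrow> Cod C x = Dom C k \<Longrightarrow> Cod C w = W \<Longrightarrow>
      inr q1 q2 (k \<cdot> x) w \<longleftrightarrow> inr r1 r2 (k \<cdot> x) w" for k
  proof (rule power_eq[OF E])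
    show "\<phi> \<cdot> k \<in> Hom C (Dom C k) E" "\<psi> \<cdot> k \<in> Hom C (Dom C k) E" using \<phi> \<psi> k by (simp_all add: Hom_def)
    fix x w assume x: "x \<in> Arr C" "w \<in> Arr C" "Dom C w = Dom C x" "Cod C x = Dom C k" "Cod C w = W"
    show "mem ((\<phi> \<cdot> k) \<cdot> x) w \<longleftrightarrow> mem ((\<psi> \<cdot> k) \<cdot> x) w"
      using m\<phi>[of "k \<cdot> x" w] m\<psi>[of "k \<cdot> x" w] e[OF x] x k \<phi> \<psi> by simp
  qed
  have "\<phi> = \<psi>"
    by (rule pushout_eq[OF p restrict restrict]) (use g n S \<phi> \<psi> in simp_all)
  then show ?thesis using m\<phi>[OF x] m\<psi>[OF x] by simp
qed

text \<open>The existence half: agreement over the initial corner makes the two arrows into the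
  power object a cocone, and the induced arrow names the glued relation.\<close>

lemma relation_glue:
  assumes p: "is_pushout C m f g n" and r: "rel r1 r2 (Dom C g) W" and s: "rel s1 s2 (Dom C n) W"
    and e: "\<And>c w. c \<in> Arr C \<Longrightarrow> w \<in> Arr C \<Longrightarrow> Dom C w = Dom C c \<Longrightarrow> Cod C c = Dom C m \<Longrightarrow> Cod C w = W \<Longrightarrow>
      inr r1 r2 (m \<cdot> c) w \<longleftrightarrow> inr s1 s2 (f \<cdot> c) w"
  obtains q1 q2 where "rel q1 q2 (Cod C g) W"
    "\<And>x w. x \<in> Arr C \<Longrightarrow> w \<in> Arr C \<Longrightarrow> Dom C w = Dom C x \<Longrightarrow> Cod C x = Dom C g \<Longrightarrow> Cod C w = W \<Longrightarrow>
      inr q1 q2 (g \<cdot> x) w \<longleftrightarrow> inr r1 r2 x w"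
    "\<And>y w. y \<in> Arr C \<Longrightarrow> w \<in> Arr C \<Longrightarrow> Dom C w = Dom C y \<Longrightarrow> Cod C y = Dom C n \<Longrightarrow> Cod C w = W \<Longrightarrow>
      inr q1 q2 (n \<cdot> y) w \<longleftrightarrow> inr s1 s2 y w"
proof -
  note S = comm_squareD[OF pushout_square[OF p]]
  have "W \<in> Obj C" using relD[OF r] by auto
  then obtain E mem where E: "power W E mem" by (rule power_ex)
  obtain \<phi> where \<phi>: "\<phi> \<in> Arr C" "Dom C \<phi> = Dom C g" "Cod C \<phi> = E" "represents W mem (Dom C g) \<phi> r1 r2"
    by (rule power_represent[OF E r])
  obtain \<psi> where \<psi>: "\<psi> \<in> Arr C" "Dom C \<psi> = Dom C n" "Cod C \<psi> = E" "represents W mem (Dom C n) \<psi> s1 s2"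
    by (rule power_represent[OF E s])
  note m\<phi> = representsD[OF \<phi>(4)] and m\<psi> = representsD[OF \<psi>(4)]
  have "\<phi> \<cdot> m = \<psi> \<cdot> f"
  proof (rule power_eq[OF E])
    show "\<phi> \<cdot> m \<in> Hom C (Dom C m) E" "\<psi> \<cdot> f \<in> Hom C (Dom C m) E" using \<phi> \<psi> S by (simp_all add: Hom_def)
    fix c w assume c: "c \<in> Arr C" "w \<in> Arr C" "Dom C w = Dom C c" "Cod C c = Dom C m" "Cod C w = W"
    show "mem ((\<phi> \<cdot> m) \<cdot> c) w \<longleftrightarrow> mem ((\<psi> \<cdot> f) \<cdot> c) w"
      using m\<phi>[of "m \<cdot> c" w] m\<psi>[of "f \<cdot> c" w] e[OF c] c \<phi> \<psi> S by simp
  qed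
  then have "comm_square C m f \<phi> \<psi>" using \<phi> \<psi> S by (simp add: comm_square_def)
  then obtain \<theta> where \<theta>: "\<theta> \<in> Arr C" "Dom C \<theta> = Cod C g" "Cod C \<theta> = Cod C \<phi>" "\<theta> \<cdot> g = \<phi>" "\<theta> \<cdot> n = \<psi>"
    by (rule pushout_factor[OF p])
  have "\<theta> \<in> Hom C (Cod C g) E" using \<theta> \<phi> by (simp add: Hom_def)
  then obtain q1 q2 where q: "rel q1 q2 (Cod C g) W" and rq: "represents W mem (Cod C g) \<theta> q1 q2"
    by (rule power_relation[OF E])
  note mq = representsD[OF rq]
  show ?thesis
  proof (rule that[OF q])
    show "inr q1 q2 (g \<cdot> x) w \<longleftrightarrow> inr r1 r2 x w"
      if "x \<in> Arr C" "w \<in> Arr C" "Dom C w = Dom C x" "Cod C x = Dom C g" "Cod C w = W" for x w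
      using mq[of "g \<cdot> x" w] m\<phi>[OF that] comp_eq_comp[OF \<theta>(4), of x] that S \<theta> by simp
    show "inr q1 q2 (n \<cdot> x) w \<longleftrightarrow> inr s1 s2 x w"
      if "x \<in> Arr C" "w \<in> Arr C" "Dom C w = Dom C x" "Cod C x = Dom C n" "Cod C w = W" for x w
      using mq[of "n \<cdot> x" w] m\<psi>[OF that] comp_eq_comp[OF \<theta>(5), of x] that S \<theta> by simp
  qed
qed

text \<open>This is the graph of \<open>w\<close> restricted to the subobject \<open>e\<close>, read
  backwards. As a relation out of the codomain of \<open>w\<close> it can be compared and glued over
  a pushout there.\<close>

lemma rel_graph:
  assumes e: "mono_arrow C e" and w: "w \<in> Arr C" "Dom C w = Cod C e"
  shows "rel (w \<cdot> e) e (Cod C w) (Cod C e)"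
  by (rule relI) (use w mono_arr[OF e] in \<open>simp_all add: monoD[OF e]\<close>)

lemma inr_graph:
  assumes e: "e \<in> Arr C" and w: "w \<in> Arr C" "Dom C w = Cod C e"
    and x: "x \<in> Arr C" "z \<in> Arr C" "Dom C z = Dom C x" "Cod C z = Cod C e"
  shows "inr (w \<cdot> e) e x z \<longleftrightarrow> thru e z \<and> w \<cdot> z = x"
proof
  assume "inr (w \<cdot> e) e x z"
  then obtain k where k: "k \<in> Arr C" "Dom C k = Dom C x" "Cod C k = Dom C (w \<cdot> e)" "(w \<cdot> e) \<cdot> k = x" "e \<cdot> k = z"
    by (rule inrE)
  have d: "Cod C k = Dom C e" using k e w by simp
  have "thru e z" by (rule thruI[of k]) (use k d x in simp_all)
  moreover have "w \<cdot> z = x" using k d e w by simp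
  ultimately show "thru e z \<and> w \<cdot> z = x" by simp
next
  assume a: "thru e z \<and> w \<cdot> z = x"
  then have "thru e z" by simp
  then obtain k where k: "k \<in> Arr C" "Dom C k = Dom C z" "Cod C k = Dom C e" "e \<cdot> k = z" by (rule thruE)
  show "inr (w \<cdot> e) e x z" by (rule inrI[of k]) (use k a e w x in simp_all)
qed

lemma thru_Id: "z \<in> Arr C \<Longrightarrow> Cod C z = X \<Longrightarrow> thru (Id C X) z"
  by (rule thruI[of z]) auto

text \<open>The two legs of a pushout are jointly covering, stably under pullback along any \<open>w\<close>.\<close>

lemma pushout_cover:
  assumes p: "is_pushout C m f g n" and w: "w \<in> Arr C" "Cod C w = Cod C g"
    and e: "mono_arrow C e" "Cod C e = Dom C w"
    and g: "\<And>z x. z \<in> Arr C \<Longrightarrow> Cod C z = Dom C w \<Longrightarrow> x \<in> Arr C \<Longrightarrow> Dom C x = Dom C z \<Longrightarrow> Cod C x = Dom C g \<Longrightarrow>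
      w \<cdot> z = g \<cdot> x \<Longrightarrow> thru e z"
    and n: "\<And>z x. z \<in> Arr C \<Longrightarrow> Cod C z = Dom C w \<Longrightarrow> x \<in> Arr C \<Longrightarrow> Dom C x = Dom C z \<Longrightarrow> Cod C x = Dom C n \<Longrightarrow>
      w \<cdot> z = n \<cdot> x \<Longrightarrow> thru e z"
  shows "thru e (Id C (Dom C w))"
proof -
  note S = comm_squareD[OF pushout_square[OF p]]
  note ea = mono_arr[OF e(1)]
  define i where "i = Id C (Dom C w)"
  have i: "i \<in> Arr C" "Dom C i = Dom C w" "Cod C i = Dom C w" using w by (simp_all add: i_def)
  have mi: "mono_arrow C i" unfolding i_def by (rule monoI) (use w in simp_all)
  have wi: "w \<cdot> i = w" using w by (simp add: i_def)
  have r: "rel (w \<cdot> e) e (Cod C g) (Dom C w)" using rel_graph[OF e(1) w(1)] e w by simp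
  have q: "rel (w \<cdot> i) i (Cod C g) (Dom C w)" using rel_graph[OF mi w(1)] i w by simp
  note ir = inr_graph[OF ea w(1) e(2)[symmetric]] and iq = inr_graph[OF i(1) w(1) i(3)[symmetric]]
  have ti: "thru i z" if "z \<in> Arr C" "Cod C z = Dom C w" for z using thru_Id that by (simp add: i_def)
  \<comment> \<open>The graph of \<open>w\<close> is compared with its restriction to
    \<open>e\<close>. The hypotheses remove any difference above either leg, so the relations
    coincide and the pair of \<open>w\<close> and the identity belongs to the restricted
    graph.\<close>
  have "inr (w \<cdot> e) e w i \<longleftrightarrow> inr (w \<cdot> i) i w i"
  proof (rule relation_ext[OF p r q])
    fix x z assume x: "x \<in> Arr C" "z \<in> Arr C" "Dom C z = Dom C x" "Cod C x = Dom C g" "Cod C z = Dom C w"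
    show "inr (w \<cdot> e) e (g \<cdot> x) z \<longleftrightarrow> inr (w \<cdot> i) i (g \<cdot> x) z"
      using ir[of "g \<cdot> x" z] iq[of "g \<cdot> x" z] g[of z x] ti[of z] x S e i by auto
  next
    fix x z assume x: "x \<in> Arr C" "z \<in> Arr C" "Dom C z = Dom C x" "Cod C x = Dom C n" "Cod C z = Dom C w"
    show "inr (w \<cdot> e) e (n \<cdot> x) z \<longleftrightarrow> inr (w \<cdot> i) i (n \<cdot> x) z"
      using ir[of "n \<cdot> x" z] iq[of "n \<cdot> x" z] n[of z x] ti[of z] x S e i by auto
  qed (use i w in simp_all)
  moreover have "inr (w \<cdot> i) i w i" using iq[of w i] ti[of i] wi i w by simp
  ultimately show ?thesis using ir[of w i] i w e by (simp add: i_def)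
qed

text \<open>The cover is applied to the equalizer of \<open>u\<close> and \<open>v\<close>.\<close>

lemma pushout_cover_eq:
  assumes p: "is_pushout C m f g n" and w: "w \<in> Arr C" "Cod C w = Cod C g"
    and u: "u \<in> Arr C" "v \<in> Arr C" "Dom C u = Dom C w" "Dom C v = Dom C w" "Cod C v = Cod C u"
    and g: "\<And>z x. z \<in> Arr C \<Longrightarrow> Cod C z = Dom C w \<Longrightarrow> x \<in> Arr C \<Longrightarrow> Dom C x = Dom C z \<Longrightarrow> Cod C x = Dom C g \<Longrightarrow>
      w \<cdot> z = g \<cdot> x \<Longrightarrow> u \<cdot> z = v \<cdot> z"
    and n: "\<And>z x. z \<in> Arr C \<Longrightarrow> Cod C z = Dom C w \<Longrightarrow> x \<in> Arr C \<Longrightarrow> Dom C x = Dom C z \<Longrightarrow> Cod C x = Dom C n \<Longrightarrow>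
      w \<cdot> z = n \<cdot> x \<Longrightarrow> u \<cdot> z = v \<cdot> z"
  shows "u = v"
proof -
  obtain e where e: "mono_arrow C e" "Cod C e = Dom C u"
    "\<And>h. h \<in> Arr C \<Longrightarrow> Cod C h = Dom C u \<Longrightarrow> thru e h \<longleftrightarrow> u \<cdot> h = v \<cdot> h"
    using equalizer_ex[of u v] u by auto
  have "thru e (Id C (Dom C w))"
  proof (rule pushout_cover[OF p w e(1)])
    show "thru e z" if "z \<in> Arr C" "Cod C z = Dom C w" "x \<in> Arr C" "Dom C x = Dom C z" "Cod C x = Dom C g" "w \<cdot> z = g \<cdot> x" for z x
      using g[OF that] e(3)[of z] that u by simp
    show "thru e z" if "z \<in> Arr C" "Cod C z = Dom C w" "x \<in> Arr C" "Dom C x = Dom C z" "Cod C x = Dom C n" "w \<cdot> z = n \<cdot> x" for z x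
      using n[OF that] e(3)[of z] that u by simp
  qed (use e u in simp)
  then show ?thesis using e(3)[of "Id C (Dom C w)"] u w by simp
qed

text \<open>
  An arrow out of the top corner is found by gluing the graphs of its two restrictions to a relation
  \<open>(q1, q2)\<close>; covering arguments show that this relation is again a graph.
\<close>

lemma pushout_stable:
  assumes p: "is_pushout C m f g n" and top: "comm_square C m' f' g' n'"
    and L: "is_pullback C m' c a m" and K: "is_pullback C f' c b f"
    and F: "is_pullback C g' a d g" and R: "is_pullback C n' b d n"
  shows "is_pushout C m' f' g' n'"
proof (rule pushoutI[OF top])
  note S = comm_squareD[OF pushout_square[OF p]] and T = comm_squareD[OF top]
    and LS = comm_squareD[OF pullback_square[OF L]] and KS = comm_squareD[OF pullback_square[OF K]]
    and FS = comm_squareD[OF pullback_square[OF F]] and RS = comm_squareD[OF pullback_square[OF R]]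
  have arr [simp]: "m \<in> Arr C" "f \<in> Arr C" "g \<in> Arr C" "n \<in> Arr C" "m' \<in> Arr C" "f' \<in> Arr C" "g' \<in> Arr C" "n' \<in> Arr C"
    "a \<in> Arr C" "b \<in> Arr C" "c \<in> Arr C" "d \<in> Arr C"
    using S T FS RS LS by auto
  have d [simp]: "Dom C f = Dom C m" "Cod C m = Dom C g" "Cod C f = Dom C n" "Cod C n = Cod C g"
    "Dom C f' = Dom C m'" "Cod C m' = Dom C g'" "Cod C f' = Dom C n'"
    "Cod C g' = Dom C d" "Cod C n' = Dom C d" "Dom C a = Dom C g'" "Dom C b = Dom C n'" "Dom C c = Dom C m'"
    "Cod C a = Dom C g" "Cod C b = Dom C n" "Cod C c = Dom C m" "Cod C d = Cod C g"
    using S T FS RS LS by auto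
  have lift_g: "\<exists>x'. x' \<in> Arr C \<and> Dom C x' = Dom C z \<and> Cod C x' = Dom C g' \<and> g' \<cdot> x' = z \<and> a \<cdot> x' = x"
    if "z \<in> Arr C" "Cod C z = Dom C d" "x \<in> Arr C" "Dom C x = Dom C z" "Cod C x = Dom C g" "d \<cdot> z = g \<cdot> x" for z x
  proof -
    have "comm_square C z x d g" using that by (simp add: comm_square_def)
    then show ?thesis by (rule pullback_factor[OF F]) blast
  qed
  have lift_n: "\<exists>x'. x' \<in> Arr C \<and> Dom C x' = Dom C z \<and> Cod C x' = Dom C n' \<and> n' \<cdot> x' = z \<and> b \<cdot> x' = x"
    if "z \<in> Arr C" "Cod C z = Dom C d" "x \<in> Arr C" "Dom C x = Dom C z" "Cod C x = Dom C n" "d \<cdot> z = n \<cdot> x" for z x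
  proof -
    have "comm_square C z x d n" using that by (simp add: comm_square_def)
    then show ?thesis by (rule pullback_factor[OF R]) blast
  qed
  \<comment> \<open>Whatever lies over a leg of the bottom pushout factors through \<open>g'\<close>
    or \<open>n'\<close> by the front and right pullbacks, and there \<open>u\<close> and
    \<open>v\<close> agree.\<close>
  show "u = v" if uv: "u \<in> Arr C" "v \<in> Arr C" "Cod C u = Cod C v" "Dom C u = Cod C g'" "Dom C v = Cod C g'"
    "u \<cdot> g' = v \<cdot> g'" "u \<cdot> n' = v \<cdot> n'" for u v
  proof (rule pushout_cover_eq[OF p, of d])
    fix z x assume z: "z \<in> Arr C" "Cod C z = Dom C d" "x \<in> Arr C" "Dom C x = Dom C z" "Cod C x = Dom C g" "d \<cdot> z = g \<cdot> x"
    obtain x' where "x' \<in> Arr C" "Cod C x' = Dom C g'" "g' \<cdot> x' = z" using lift_g[OF z] by blast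
    then show "u \<cdot> z = v \<cdot> z" using comp_eq_comp[OF uv(6), of x'] uv by simp
  next
    fix z x assume z: "z \<in> Arr C" "Cod C z = Dom C d" "x \<in> Arr C" "Dom C x = Dom C z" "Cod C x = Dom C n" "d \<cdot> z = n \<cdot> x"
    obtain x' where "x' \<in> Arr C" "Cod C x' = Dom C n'" "n' \<cdot> x' = z" using lift_n[OF z] by blast
    then show "u \<cdot> z = v \<cdot> z" using comp_eq_comp[OF uv(7), of x'] uv by simp
  qed (use uv in simp_all)
  fix h k assume hk: "comm_square C m' f' h k"
  define X where "X = Cod C h"
  have h [simp]: "h \<in> Arr C" "k \<in> Arr C" "Dom C h = Dom C g'" "Dom C k = Dom C n'" "Cod C h = X" "Cod C k = X"
    and hm: "h \<cdot> m' = k \<cdot> f'"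
    using comm_squareD[OF hk] by (auto simp: X_def)
  have X [simp]: "X \<in> Obj C" using Cod_in_Obj[OF h(1)] by simp
  have D' [simp]: "Dom C d \<in> Obj C" by simp
  \<comment> \<open>The relation takes values in the product of the top corner and \<open>X\<close>:
    the first component records the position in the top corner, so that one relation over the bottom
    corner can describe an arrow on everything above it.\<close>
  obtain W p1 p2 where P: "is_product C (Dom C d) X W p1 p2" using product_ex[OF D' X] by blast
  note pa [simp] = product_arr[OF P]
  obtain r where r [simp]: "r \<in> Arr C" "Dom C r = Dom C g'" "Cod C r = W" and rp: "p1 \<cdot> r = g'" "p2 \<cdot> r = h"
    using product_pair[OF P, of g' h] by auto
  obtain s where s [simp]: "s \<in> Arr C" "Dom C s = Dom C n'" "Cod C s = W" and sp: "p1 \<cdot> s = n'" "p2 \<cdot> s = k"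
    using product_pair[OF P, of n' k] by auto
  have rp': "p1 \<cdot> (r \<cdot> x) = g' \<cdot> x" "p2 \<cdot> (r \<cdot> x) = h \<cdot> x" if "x \<in> Arr C" "Cod C x = Dom C g'" for x
    using comp_eq_comp[OF rp(1), of x] comp_eq_comp[OF rp(2), of x] that by simp_all
  have sp': "p1 \<cdot> (s \<cdot> x) = n' \<cdot> x" "p2 \<cdot> (s \<cdot> x) = k \<cdot> x" if "x \<in> Arr C" "Cod C x = Dom C n'" for x
    using comp_eq_comp[OF sp(1), of x] comp_eq_comp[OF sp(2), of x] that by simp_all
  \<comment> \<open>Here \<open>r\<close> pairs \<open>g'\<close> with \<open>h\<close>. Joint
    monicity comes from the front pullback, already from \<open>a\<close> and the component
    \<open>g'\<close>.\<close>
  have ra: "rel a r (Dom C g) W"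
  proof (rule relI)
    fix x y assume x: "x \<in> Arr C" "y \<in> Arr C" "Dom C x = Dom C y" "Cod C x = Dom C a" "Cod C y = Dom C a" "a \<cdot> x = a \<cdot> y" "r \<cdot> x = r \<cdot> y"
    have "g' \<cdot> x = g' \<cdot> y" using rp'(1)[of x] rp'(1)[of y] x by simp
    then show "x = y" by (rule pullback_eq[OF F]) (use x in simp_all)
  qed simp_all
  have sb: "rel b s (Dom C n) W"
  proof (rule relI)
    fix x y assume x: "x \<in> Arr C" "y \<in> Arr C" "Dom C x = Dom C y" "Cod C x = Dom C b" "Cod C y = Dom C b" "b \<cdot> x = b \<cdot> y" "s \<cdot> x = s \<cdot> y"
    have "n' \<cdot> x = n' \<cdot> y" using sp'(1)[of x] sp'(1)[of y] x by simp
    then show "x = y" by (rule pullback_eq[OF R]) (use x in simp_all)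
  qed simp_all
  have rs: "r \<cdot> m' = s \<cdot> f'"
    by (rule product_eq[OF P]) (use rp'[of m'] sp'[of f'] T(9) hm in simp_all)
  \<comment> \<open>The left and back pullbacks lift both sides to the top corner of the cube, where
    \<open>r\<close> and \<open>s\<close> agree because \<open>h\<close> and \<open>k\<close> form a
    cocone.\<close>
  have compat: "inr a r (m \<cdot> x) w \<longleftrightarrow> inr b s (f \<cdot> x) w"
    if x: "x \<in> Arr C" "w \<in> Arr C" "Dom C w = Dom C x" "Cod C x = Dom C m" "Cod C w = W" for x w
  proof
    assume "inr a r (m \<cdot> x) w"
    then obtain y where y: "y \<in> Arr C" "Dom C y = Dom C (m \<cdot> x)" "Cod C y = Dom C a" "a \<cdot> y = m \<cdot> x" "r \<cdot> y = w" by (rule inrE)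
    have "comm_square C y x a m" using x y by (simp add: comm_square_def)
    then obtain x' where x': "x' \<in> Arr C" "Dom C x' = Dom C y" "Cod C x' = Dom C m'" "m' \<cdot> x' = y" "c \<cdot> x' = x"
      by (rule pullback_factor[OF L])
    show "inr b s (f \<cdot> x) w"
      by (rule inrI[of "f' \<cdot> x'"])
        (use x' x y comm_square_ext[OF pullback_square[OF K], of x'] comp_eq_comp[OF rs, of x'] in simp_all)
  next
    assume "inr b s (f \<cdot> x) w"
    then obtain y where y: "y \<in> Arr C" "Dom C y = Dom C (f \<cdot> x)" "Cod C y = Dom C b" "b \<cdot> y = f \<cdot> x" "s \<cdot> y = w" by (rule inrE)
    have "comm_square C y x b f" using x y by (simp add: comm_square_def)
    then obtain x' where x': "x' \<in> Arr C" "Dom C x' = Dom C y" "Cod C x' = Dom C f'" "f' \<cdot> x' = y" "c \<cdot> x' = x"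
      by (rule pullback_factor[OF K])
    show "inr a r (m \<cdot> x) w"
      by (rule inrI[of "m' \<cdot> x'"])
        (use x' x y comm_square_ext[OF pullback_square[OF L], of x'] comp_eq_comp[OF rs, of x'] in simp_all)
  qed
  obtain q1 q2 where q: "rel q1 q2 (Cod C g) W"
    and qg: "\<And>x w. x \<in> Arr C \<Longrightarrow> w \<in> Arr C \<Longrightarrow> Dom C w = Dom C x \<Longrightarrow> Cod C x = Dom C g \<Longrightarrow> Cod C w = W \<Longrightarrow>
      inr q1 q2 (g \<cdot> x) w \<longleftrightarrow> inr a r x w"
    and qn: "\<And>y w. y \<in> Arr C \<Longrightarrow> w \<in> Arr C \<Longrightarrow> Dom C w = Dom C y \<Longrightarrow> Cod C y = Dom C n \<Longrightarrow> Cod C w = W \<Longrightarrow>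
      inr q1 q2 (n \<cdot> y) w \<longleftrightarrow> inr b s y w"
    using relation_glue[OF p ra sb compat] by blast
  note qa [simp] = relD[OF q]
  have at_g: "\<exists>x'. x' \<in> Arr C \<and> Dom C x' = Dom C z \<and> Cod C x' = Dom C g' \<and> a \<cdot> x' = x \<and> r \<cdot> x' = q2 \<cdot> z"
    if "z \<in> Arr C" "Cod C z = Dom C q1" "x \<in> Arr C" "Dom C x = Dom C z" "Cod C x = Dom C g" "q1 \<cdot> z = g \<cdot> x" for z x
  proof -
    have "inr q1 q2 (g \<cdot> x) (q2 \<cdot> z)" by (rule inrI[of z]) (use that in simp_all)
    then have "inr a r x (q2 \<cdot> z)" using qg[of x "q2 \<cdot> z"] that by simp
    then show ?thesis by (rule inrE) (use that in auto)
  qed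
  have at_n: "\<exists>x'. x' \<in> Arr C \<and> Dom C x' = Dom C z \<and> Cod C x' = Dom C n' \<and> b \<cdot> x' = x \<and> s \<cdot> x' = q2 \<cdot> z"
    if "z \<in> Arr C" "Cod C z = Dom C q1" "x \<in> Arr C" "Dom C x = Dom C z" "Cod C x = Dom C n" "q1 \<cdot> z = n \<cdot> x" for z x
  proof -
    have "inr q1 q2 (n \<cdot> x) (q2 \<cdot> z)" by (rule inrI[of z]) (use that in simp_all)
    then have "inr b s x (q2 \<cdot> z)" using qn[of x "q2 \<cdot> z"] that by simp
    then show ?thesis by (rule inrE) (use that in auto)
  qed
  \<comment> \<open>The relation is a graph over the top corner exactly if the position
    \<open>r2\<close> is invertible; \<open>r3\<close> is then the value. Invertibility is shown as
    single-valuedness, that is \<open>r2\<close> mono, together with totality.\<close>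
  define r2 where "r2 = p1 \<cdot> q2"
  define r3 where "r3 = p2 \<cdot> q2"
  have r23 [simp]: "r2 \<in> Arr C" "Dom C r2 = Dom C q1" "Cod C r2 = Dom C d" "r3 \<in> Arr C" "Dom C r3 = Dom C q1" "Cod C r3 = X"
    by (simp_all add: r2_def r3_def)
  have r2z: "r2 \<cdot> z = p1 \<cdot> (q2 \<cdot> z)" "r3 \<cdot> z = p2 \<cdot> (q2 \<cdot> z)" if "z \<in> Arr C" "Cod C z = Dom C q1" for z
    using that by (simp_all add: r2_def r3_def)
  \<comment> \<open>The recorded position lies above the point of the bottom corner from which the
    relation starts. This is clear over each leg, hence everywhere.\<close>
  have over: "d \<cdot> r2 = q1"
  proof (rule pushout_cover_eq[OF p, of q1])
    fix z x assume z: "z \<in> Arr C" "Cod C z = Dom C q1" "x \<in> Arr C" "Dom C x = Dom C z" "Cod C x = Dom C g" "q1 \<cdot> z = g \<cdot> x"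
    obtain x' where x': "x' \<in> Arr C" "Cod C x' = Dom C g'" "a \<cdot> x' = x" "r \<cdot> x' = q2 \<cdot> z" using at_g[OF z] by blast
    have "r2 \<cdot> z = g' \<cdot> x'" using r2z(1)[OF z(1,2)] rp'(1)[OF x'(1,2)] x'(4) by simp
    then show "(d \<cdot> r2) \<cdot> z = q1 \<cdot> z" using z x' comm_square_ext[OF pullback_square[OF F], of x'] by simp
  next
    fix z x assume z: "z \<in> Arr C" "Cod C z = Dom C q1" "x \<in> Arr C" "Dom C x = Dom C z" "Cod C x = Dom C n" "q1 \<cdot> z = n \<cdot> x"
    obtain x' where x': "x' \<in> Arr C" "Cod C x' = Dom C n'" "b \<cdot> x' = x" "s \<cdot> x' = q2 \<cdot> z" using at_n[OF z] by blast
    have "r2 \<cdot> z = n' \<cdot> x'" using r2z(1)[OF z(1,2)] sp'(1)[OF x'(1,2)] x'(4) by simp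
    then show "(d \<cdot> r2) \<cdot> z = q1 \<cdot> z" using z x' comm_square_ext[OF pullback_square[OF R], of x'] by simp
  qed simp_all
  have over': "q1 \<cdot> z = d \<cdot> (r2 \<cdot> z)" if "z \<in> Arr C" "Cod C z = Dom C q1" for z
    using comp_eq_comp[OF over, of z] that by simp
  have mono: "mono_arrow C r2"
  proof (rule monoI)
    fix y y' assume y: "y \<in> Arr C" "y' \<in> Arr C" "Dom C y = Dom C y'" "Cod C y = Dom C r2" "Cod C y' = Dom C r2"
      and e: "r2 \<cdot> y = r2 \<cdot> y'"
    have y'' [simp]: "y \<in> Arr C" "y' \<in> Arr C" "Dom C y = Dom C y'" "Cod C y = Dom C q1" "Cod C y' = Dom C q1"
      using y by simp_all
    have ez: "r2 \<cdot> (y \<cdot> z) = r2 \<cdot> (y' \<cdot> z)" if "z \<in> Arr C" "Cod C z = Dom C y'" for z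
      using comp_eq_comp[OF e, of z] that by simp
    \<comment> \<open>Equal positions force equal values. Over a leg both elements come from arrows
      into the domain of \<open>g'\<close> or \<open>n'\<close>, and these coincide by the face
      pullback.\<close>
    have e3: "r3 \<cdot> y = r3 \<cdot> y'"
    proof (rule pushout_cover_eq[OF p, of "q1 \<cdot> y'"])
      fix z x assume z: "z \<in> Arr C" "Cod C z = Dom C (q1 \<cdot> y')" "x \<in> Arr C" "Dom C x = Dom C z" "Cod C x = Dom C g"
        and qz: "(q1 \<cdot> y') \<cdot> z = g \<cdot> x"
      have z' [simp]: "z \<in> Arr C" "Cod C z = Dom C y'" using z by simp_all
      have q': "q1 \<cdot> (y' \<cdot> z) = g \<cdot> x" using qz by simp
      then have q: "q1 \<cdot> (y \<cdot> z) = g \<cdot> x" using ez[OF z'] over'[of "y \<cdot> z"] over'[of "y' \<cdot> z"] by simp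
      obtain x1 where x1: "x1 \<in> Arr C" "Dom C x1 = Dom C z" "Cod C x1 = Dom C g'" "a \<cdot> x1 = x" "r \<cdot> x1 = q2 \<cdot> (y \<cdot> z)"
        using at_g[OF _ _ _ _ _ q] z by auto
      obtain x2 where x2: "x2 \<in> Arr C" "Dom C x2 = Dom C z" "Cod C x2 = Dom C g'" "a \<cdot> x2 = x" "r \<cdot> x2 = q2 \<cdot> (y' \<cdot> z)"
        using at_g[OF _ _ _ _ _ q'] z by auto
      have "x1 = x2"
      proof (rule pullback_eq[OF F])
        show "g' \<cdot> x1 = g' \<cdot> x2"
          using rp'(1)[OF x1(1,3)] rp'(1)[OF x2(1,3)] x1(5) x2(5) ez[OF z'] r2z(1)[of "y \<cdot> z"] r2z(1)[of "y' \<cdot> z"] by simp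
      qed (use x1 x2 in simp_all)
      then have "r3 \<cdot> (y \<cdot> z) = r3 \<cdot> (y' \<cdot> z)" using x1(5) x2(5) r2z(2)[of "y \<cdot> z"] r2z(2)[of "y' \<cdot> z"] by simp
      then show "(r3 \<cdot> y) \<cdot> z = (r3 \<cdot> y') \<cdot> z" by simp
    next
      fix z x assume z: "z \<in> Arr C" "Cod C z = Dom C (q1 \<cdot> y')" "x \<in> Arr C" "Dom C x = Dom C z" "Cod C x = Dom C n"
        and qz: "(q1 \<cdot> y') \<cdot> z = n \<cdot> x"
      have z' [simp]: "z \<in> Arr C" "Cod C z = Dom C y'" using z by simp_all
      have q': "q1 \<cdot> (y' \<cdot> z) = n \<cdot> x" using qz by simp
      then have q: "q1 \<cdot> (y \<cdot> z) = n \<cdot> x" using ez[OF z'] over'[of "y \<cdot> z"] over'[of "y' \<cdot> z"] by simp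
      obtain x1 where x1: "x1 \<in> Arr C" "Dom C x1 = Dom C z" "Cod C x1 = Dom C n'" "b \<cdot> x1 = x" "s \<cdot> x1 = q2 \<cdot> (y \<cdot> z)"
        using at_n[OF _ _ _ _ _ q] z by auto
      obtain x2 where x2: "x2 \<in> Arr C" "Dom C x2 = Dom C z" "Cod C x2 = Dom C n'" "b \<cdot> x2 = x" "s \<cdot> x2 = q2 \<cdot> (y' \<cdot> z)"
        using at_n[OF _ _ _ _ _ q'] z by auto
      have "x1 = x2"
      proof (rule pullback_eq[OF R])
        show "n' \<cdot> x1 = n' \<cdot> x2"
          using sp'(1)[OF x1(1,3)] sp'(1)[OF x2(1,3)] x1(5) x2(5) ez[OF z'] r2z(1)[of "y \<cdot> z"] r2z(1)[of "y' \<cdot> z"] by simp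
      qed (use x1 x2 in simp_all)
      then have "r3 \<cdot> (y \<cdot> z) = r3 \<cdot> (y' \<cdot> z)" using x1(5) x2(5) r2z(2)[of "y \<cdot> z"] r2z(2)[of "y' \<cdot> z"] by simp
      then show "(r3 \<cdot> y) \<cdot> z = (r3 \<cdot> y') \<cdot> z" by simp
    qed simp_all
    have e2: "q2 \<cdot> y = q2 \<cdot> y'"
      by (rule product_eq[OF P]) (use e e3 r2z[of y] r2z[of y'] in simp_all)
    have e1: "q1 \<cdot> y = q1 \<cdot> y'" using e over'[of y] over'[of y'] by simp
    show "y = y'" by (rule rel_eq[OF q e1 e2]) simp_all
  qed simp
  have back_g: "\<exists>y. y \<in> Arr C \<and> Dom C y = Dom C x \<and> Cod C y = Dom C q1 \<and> r2 \<cdot> y = g' \<cdot> x \<and> r3 \<cdot> y = h \<cdot> x"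
    if x: "x \<in> Arr C" "Cod C x = Dom C g'" for x
  proof -
    have "inr a r (a \<cdot> x) (r \<cdot> x)" by (rule inrI[of x]) (use x in simp_all)
    then have "inr q1 q2 (g \<cdot> (a \<cdot> x)) (r \<cdot> x)" using qg[of "a \<cdot> x" "r \<cdot> x"] x by simp
    then obtain y where y: "y \<in> Arr C" "Dom C y = Dom C (g \<cdot> (a \<cdot> x))" "Cod C y = Dom C q1" "q1 \<cdot> y = g \<cdot> (a \<cdot> x)" "q2 \<cdot> y = r \<cdot> x"
      by (rule inrE)
    then show ?thesis using r2z[of y] rp'[OF x] x by (intro exI[of _ y]) simp
  qed
  have back_n: "\<exists>y. y \<in> Arr C \<and> Dom C y = Dom C x \<and> Cod C y = Dom C q1 \<and> r2 \<cdot> y = n' \<cdot> x \<and> r3 \<cdot> y = k \<cdot> x"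
    if x: "x \<in> Arr C" "Cod C x = Dom C n'" for x
  proof -
    have "inr b s (b \<cdot> x) (s \<cdot> x)" by (rule inrI[of x]) (use x in simp_all)
    then have "inr q1 q2 (n \<cdot> (b \<cdot> x)) (s \<cdot> x)" using qn[of "b \<cdot> x" "s \<cdot> x"] x by simp
    then obtain y where y: "y \<in> Arr C" "Dom C y = Dom C (n \<cdot> (b \<cdot> x))" "Cod C y = Dom C q1" "q1 \<cdot> y = n \<cdot> (b \<cdot> x)" "q2 \<cdot> y = s \<cdot> x"
      by (rule inrE)
    then show ?thesis using r2z[of y] sp'[OF x] x by (intro exI[of _ y]) simp
  qed
  \<comment> \<open>Totality: over either leg every position carries the value prescribed by
    \<open>h\<close> or \<open>k\<close>, so the mono \<open>r2\<close> covers the whole top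
    corner.\<close>
  have "thru r2 (Id C (Dom C d))"
  proof (rule pushout_cover[OF p _ _ mono])
    fix z x assume z: "z \<in> Arr C" "Cod C z = Dom C d" "x \<in> Arr C" "Dom C x = Dom C z" "Cod C x = Dom C g" "d \<cdot> z = g \<cdot> x"
    obtain x' where x': "x' \<in> Arr C" "Dom C x' = Dom C z" "Cod C x' = Dom C g'" "g' \<cdot> x' = z" using lift_g[OF z] by blast
    obtain y where "y \<in> Arr C" "Dom C y = Dom C x'" "Cod C y = Dom C q1" "r2 \<cdot> y = g' \<cdot> x'" using back_g[OF x'(1,3)] by blast
    then show "thru r2 z" using x' by (intro thruI[of y]) simp_all
  next
    fix z x assume z: "z \<in> Arr C" "Cod C z = Dom C d" "x \<in> Arr C" "Dom C x = Dom C z" "Cod C x = Dom C n" "d \<cdot> z = n \<cdot> x"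
    obtain x' where x': "x' \<in> Arr C" "Dom C x' = Dom C z" "Cod C x' = Dom C n'" "n' \<cdot> x' = z" using lift_n[OF z] by blast
    obtain y where "y \<in> Arr C" "Dom C y = Dom C x'" "Cod C y = Dom C q1" "r2 \<cdot> y = n' \<cdot> x'" using back_n[OF x'(1,3)] by blast
    then show "thru r2 z" using x' by (intro thruI[of y]) simp_all
  qed simp_all
  then obtain t where t [simp]: "t \<in> Arr C" "Dom C t = Dom C d" "Cod C t = Dom C q1" and rt: "r2 \<cdot> t = Id C (Dom C d)"
    by (rule thruE) simp
  have rt': "r2 \<cdot> (t \<cdot> z) = z" if "z \<in> Arr C" "Cod C z = Dom C d" for z
    using comp_eq_comp[OF rt, of z] that by simp
  have "r3 \<cdot> (t \<cdot> g') = h"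
  proof -
    obtain y where y: "y \<in> Arr C" "Dom C y = Dom C g'" "Cod C y = Dom C q1" "r2 \<cdot> y = g'" "r3 \<cdot> y = h"
      using back_g[of "Id C (Dom C g')"] by auto
    have "t \<cdot> g' = y" by (rule monoD[OF mono]) (use y rt'[of g'] in simp_all)
    then show ?thesis using y by simp
  qed
  moreover have "r3 \<cdot> (t \<cdot> n') = k"
  proof -
    obtain y where y: "y \<in> Arr C" "Dom C y = Dom C n'" "Cod C y = Dom C q1" "r2 \<cdot> y = n'" "r3 \<cdot> y = k"
      using back_n[of "Id C (Dom C n')"] by auto
    have "t \<cdot> n' = y" by (rule monoD[OF mono]) (use y rt'[of n'] in simp_all)
    then show ?thesis using y by simp
  qed
  ultimately show "\<exists>l. l \<in> Arr C \<and> Dom C l = Cod C g' \<and> Cod C l = Cod C h \<and> l \<cdot> g' = h \<and> l \<cdot> n' = k"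
    by (intro exI[of _ "r3 \<cdot> t"]) simp
qed

text \<open>The relation given by \<open>m\<close> and \<open>f\<close> is glued with the identity
  relation on the domain of \<open>n\<close>; they agree over the corner because \<open>m\<close> is
  mono. In the glued relation \<open>n \<cdot> y\<close> is related to \<open>y\<close> alone, which
  makes \<open>n\<close> mono, and \<open>g \<cdot> x\<close> only to elements coming from the
  corner, which makes the square a pullback.\<close>

lemma pushout_mono:
  assumes p: "is_pushout C m f g n" and m: "mono_arrow C m"
  shows "is_pullback C m f g n" "mono_arrow C n"
proof -
  note S = comm_squareD[OF pushout_square[OF p]]
  have arr [simp]: "m \<in> Arr C" "f \<in> Arr C" "g \<in> Arr C" "n \<in> Arr C" "Dom C f = Dom C m" "Cod C m = Dom C g"
    "Cod C f = Dom C n" "Cod C n = Cod C g" "Dom C n \<in> Obj C"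
    using S by auto
  define i where "i = Id C (Dom C n)"
  have i [simp]: "i \<in> Arr C" "Dom C i = Dom C n" "Cod C i = Dom C n" by (simp_all add: i_def)
  have ix [simp]: "i \<cdot> x = x" if "x \<in> Arr C" "Cod C x = Dom C n" for x using that by (simp add: i_def)
  have 1: "rel m f (Dom C g) (Dom C n)" by (rule relI) (auto intro: monoD[OF m])
  have 2: "rel i i (Dom C n) (Dom C n)" by (rule relI) auto
  have ii: "inr i i y w \<longleftrightarrow> y = w" if "y \<in> Arr C" "Cod C y = Dom C n" for y w
    using that by (auto intro: inrI[of y] elim!: inrE)
  have compat: "inr m f (m \<cdot> c) w \<longleftrightarrow> inr i i (f \<cdot> c) w"
    if c: "c \<in> Arr C" "w \<in> Arr C" "Dom C w = Dom C c" "Cod C c = Dom C m" "Cod C w = Dom C n" for c w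
  proof
    assume "inr m f (m \<cdot> c) w"
    then obtain k where k: "k \<in> Arr C" "Dom C k = Dom C (m \<cdot> c)" "Cod C k = Dom C m" "m \<cdot> k = m \<cdot> c" "f \<cdot> k = w"
      by (rule inrE)
    have "k = c" by (rule monoD[OF m]) (use k c in simp_all)
    then show "inr i i (f \<cdot> c) w" using k c ii[of "f \<cdot> c" w] by simp
  next
    assume "inr i i (f \<cdot> c) w"
    then have "f \<cdot> c = w" using c ii[of "f \<cdot> c" w] by simp
    then show "inr m f (m \<cdot> c) w" using c by (intro inrI[of c]) simp_all
  qed
  obtain q1 q2 where q: "rel q1 q2 (Cod C g) (Dom C n)"
    and qg: "\<And>x w. x \<in> Arr C \<Longrightarrow> w \<in> Arr C \<Longrightarrow> Dom C w = Dom C x \<Longrightarrow> Cod C x = Dom C g \<Longrightarrow> Cod C w = Dom C n \<Longrightarrow>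
      inr q1 q2 (g \<cdot> x) w \<longleftrightarrow> inr m f x w"
    and qn: "\<And>y w. y \<in> Arr C \<Longrightarrow> w \<in> Arr C \<Longrightarrow> Dom C w = Dom C y \<Longrightarrow> Cod C y = Dom C n \<Longrightarrow> Cod C w = Dom C n \<Longrightarrow>
      inr q1 q2 (n \<cdot> y) w \<longleftrightarrow> inr i i y w"
    using relation_glue[OF p 1 2 compat] by blast
  have refl: "inr q1 q2 (n \<cdot> y) y" if "y \<in> Arr C" "Cod C y = Dom C n" for y
    using qn[of y y] ii[of y y] that by simp
  show "mono_arrow C n"
  proof (rule monoI)
    fix h k assume h: "h \<in> Arr C" "k \<in> Arr C" "Dom C h = Dom C k" "Cod C h = Dom C n" "Cod C k = Dom C n" "n \<cdot> h = n \<cdot> k"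
    have "inr q1 q2 (n \<cdot> h) k" unfolding h(6) using refl[of k] h by simp
    then show "h = k" using qn[of h k] ii[of h k] h by simp
  qed simp
  show "is_pullback C m f g n"
  proof (rule pullbackI[OF pushout_square[OF p]])
    fix x y assume xy: "comm_square C x y g n"
    note s = comm_squareD[OF xy]
    have y: "y \<in> Arr C" "Cod C y = Dom C n" "x \<in> Arr C" "Cod C x = Dom C g" "Dom C y = Dom C x" using s by auto
    have "inr q1 q2 (g \<cdot> x) y" unfolding s(9) using refl y by simp
    then have "inr m f x y" using qg[of x y] y by simp
    then show "\<exists>k. k \<in> Arr C \<and> Dom C k = Dom C x \<and> Cod C k = Dom C m \<and> m \<cdot> k = x \<and> f \<cdot> k = y"
      by (rule inrE) blast
  next
    show "h = k" if "h \<in> Arr C" "k \<in> Arr C" "Dom C h = Dom C k" "Cod C h = Dom C m" "Cod C k = Dom C m" "m \<cdot> h = m \<cdot> k" for h k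
      by (rule monoD[OF m]) (use that in simp_all)
  qed
qed

text \<open>
  The diagonal and the kernel pair of \<open>f\<close> cover the kernel pair of \<open>g\<close>, because \<open>(u1, u2)\<close> can be
  glued to the relation \<open>(f, m)\<close>.
\<close>

lemma kernel_pair_cover:
  assumes p: "is_pushout C m f g n" and m: "mono_arrow C m"
    and u: "rel u1 u2 (Dom C g) (Dom C g)" and ug: "g \<cdot> u1 = g \<cdot> u2"
    and diag: "\<And>x. x \<in> Arr C \<Longrightarrow> Cod C x = Dom C g \<Longrightarrow> inr u1 u2 x x"
    and ker: "\<And>c c'. c \<in> Arr C \<Longrightarrow> c' \<in> Arr C \<Longrightarrow> Dom C c' = Dom C c \<Longrightarrow> Cod C c = Dom C m \<Longrightarrow> Cod C c' = Dom C m \<Longrightarrow>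
      f \<cdot> c = f \<cdot> c' \<Longrightarrow> inr u1 u2 (m \<cdot> c) (m \<cdot> c')"
    and x: "x \<in> Arr C" "y \<in> Arr C" "Dom C y = Dom C x" "Cod C x = Dom C g" "Cod C y = Dom C g" "g \<cdot> x = g \<cdot> y"
  shows "inr u1 u2 x y"
proof -
  note S = comm_squareD[OF pushout_square[OF p]]
  have [simp]: "m \<in> Arr C" "f \<in> Arr C" "g \<in> Arr C" "n \<in> Arr C" "Dom C f = Dom C m" "Cod C m = Dom C g"
    "Cod C f = Dom C n" "Cod C n = Cod C g"
    using S by auto
  note ua = relD[OF u]
  have 2: "rel f m (Dom C n) (Dom C g)" by (rule relI) (auto intro: monoD[OF m])
  have compat: "inr u1 u2 (m \<cdot> c) w \<longleftrightarrow> inr f m (f \<cdot> c) w"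
    if c: "c \<in> Arr C" "w \<in> Arr C" "Dom C w = Dom C c" "Cod C c = Dom C m" "Cod C w = Dom C g" for c w
  proof
    assume "inr u1 u2 (m \<cdot> c) w"
    then obtain k where k: "k \<in> Arr C" "Dom C k = Dom C (m \<cdot> c)" "Cod C k = Dom C u1" "u1 \<cdot> k = m \<cdot> c" "u2 \<cdot> k = w"
      by (rule inrE)
    \<comment> \<open>Whatever is related to \<open>m \<cdot> c\<close> has the same image under
      \<open>g\<close>; since the square is a pullback, it is \<open>m \<cdot> l\<close> with
      \<open>f \<cdot> l = f \<cdot> c\<close>.\<close>
    have "g \<cdot> w = g \<cdot> (m \<cdot> c)" using comp_eq_comp[OF ug, of k] k ua c by simp
    also have "\<dots> = n \<cdot> (f \<cdot> c)" using comm_square_ext[OF pushout_square[OF p], of c] c by simp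
    finally have "comm_square C w (f \<cdot> c) g n" using c by (simp add: comm_square_def)
    then obtain l where l: "l \<in> Arr C" "Dom C l = Dom C w" "Cod C l = Dom C m" "m \<cdot> l = w" "f \<cdot> l = f \<cdot> c"
      by (rule pullback_factor[OF pushout_mono(1)[OF p m]])
    show "inr f m (f \<cdot> c) w" by (rule inrI[of l]) (use l c in simp_all)
  next
    assume "inr f m (f \<cdot> c) w"
    then obtain k where k: "k \<in> Arr C" "Dom C k = Dom C (f \<cdot> c)" "Cod C k = Dom C f" "f \<cdot> k = f \<cdot> c" "m \<cdot> k = w"
      by (rule inrE)
    have "inr u1 u2 (m \<cdot> c) (m \<cdot> k)" by (rule ker) (use k c in simp_all)
    then show "inr u1 u2 (m \<cdot> c) w" using k(5) by simp
  qed
  obtain q1 q2 where "rel q1 q2 (Cod C g) (Dom C g)" and qg: "\<And>x w. x \<in> Arr C \<Longrightarrow> w \<in> Arr C \<Longrightarrow> Dom C w = Dom C x \<Longrightarrow> Cod C x = Dom C g \<Longrightarrow> Cod C w = Dom C g \<Longrightarrow>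
      inr q1 q2 (g \<cdot> x) w \<longleftrightarrow> inr u1 u2 x w"
    and "\<And>y w. y \<in> Arr C \<Longrightarrow> w \<in> Arr C \<Longrightarrow> Dom C w = Dom C y \<Longrightarrow> Cod C y = Dom C n \<Longrightarrow> Cod C w = Dom C g \<Longrightarrow>
      inr q1 q2 (n \<cdot> y) w \<longleftrightarrow> inr f m y w"
    using relation_glue[OF p u 2 compat] by blast
  \<comment> \<open>The glued relation sees only \<open>g \<cdot> x\<close>, which equals
    \<open>g \<cdot> y\<close>, and \<open>y\<close> is related to itself.\<close>
  have "inr q1 q2 (g \<cdot> x) y" unfolding x(6) using qg[of y y] diag[of y] x by simp
  then show ?thesis using qg[of x y] x by simp
qed

text \<open>One direction is stability. For the other, the right face is obtained from covering by
  the top pushout; the front face is obtained by showing that \<open>g'\<close> and \<open>a\<close>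
  are jointly monic and then that the comparison with the true pullback is invertible.\<close>

theorem mono_pushout_van_kampen:
  assumes p: "is_pushout C m f g n" and m: "mono_arrow C m"
  shows "van_kampen C m f g n"
  unfolding van_kampen_def
proof (intro allI impI, elim conjE)
  fix m' f' g' n' a b c d
  assume top: "comm_square C m' f' g' n'" and fr: "comm_square C g' a d g" and ri: "comm_square C n' b d n"
    and L: "is_pullback C m' c a m" and K: "is_pullback C f' c b f"
  note S = comm_squareD[OF pushout_square[OF p]] and T = comm_squareD[OF top]
    and LS = comm_squareD[OF pullback_square[OF L]] and KS = comm_squareD[OF pullback_square[OF K]]
    and FS = comm_squareD[OF fr] and RS = comm_squareD[OF ri]
  have arr [simp]: "m \<in> Arr C" "f \<in> Arr C" "g \<in> Arr C" "n \<in> Arr C" "m' \<in> Arr C" "f' \<in> Arr C" "g' \<in> Arr C" "n' \<in> Arr C"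
    "a \<in> Arr C" "b \<in> Arr C" "c \<in> Arr C" "d \<in> Arr C"
    using S T FS RS LS by auto
  have dom [simp]: "Dom C f = Dom C m" "Cod C m = Dom C g" "Cod C f = Dom C n" "Cod C n = Cod C g"
    "Dom C f' = Dom C m'" "Cod C m' = Dom C g'" "Cod C f' = Dom C n'"
    "Cod C g' = Dom C d" "Cod C n' = Dom C d" "Dom C a = Dom C g'" "Dom C b = Dom C n'" "Dom C c = Dom C m'"
    "Cod C a = Dom C g" "Cod C b = Dom C n" "Cod C c = Dom C m" "Cod C d = Cod C g"
    using S T FS RS LS by auto
  show "is_pushout C m' f' g' n' \<longleftrightarrow> is_pullback C g' a d g \<and> is_pullback C n' b d n"
  proof
    assume "is_pullback C g' a d g \<and> is_pullback C n' b d n"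
    then show "is_pushout C m' f' g' n'" using pushout_stable[OF p top L K] by blast
  next
    assume p': "is_pushout C m' f' g' n'"
    note m' = pullback_mono[OF L m]
    note n = pushout_mono[OF p m] and n' = pushout_mono[OF p' m']
    have right: "is_pullback C n' b d n"
    proof (rule pullbackI[OF ri])
      fix x y assume xy: "comm_square C x y d n"
      note s = comm_squareD[OF xy]
      have x [simp]: "x \<in> Arr C" "y \<in> Arr C" "Dom C y = Dom C x" "Cod C x = Dom C d" "Cod C y = Dom C n" using s by auto
      \<comment> \<open>The subobject of the domain of \<open>x\<close> on which \<open>x\<close>
        factors through \<open>n'\<close>. If it is everything, the factorisation is the arrow
        sought.\<close>
      obtain e l where E: "is_pullback C e l x n'" using pullback_ex[of x n'] by auto
      note ES = comm_squareD[OF pullback_square[OF E]]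
      have te: "thru e z" if z: "z \<in> Arr C" "Cod C z = Dom C x" "v \<in> Arr C" "Dom C v = Dom C z" "Cod C v = Dom C n'" "x \<cdot> z = n' \<cdot> v" for z v
      proof -
        have "comm_square C z v x n'" using z by (simp add: comm_square_def)
        then obtain k where "k \<in> Arr C" "Dom C k = Dom C z" "Cod C k = Dom C e" "e \<cdot> k = z" by (rule pullback_factor[OF E])
        then show ?thesis by (rule thruI)
      qed
      have "thru e (Id C (Dom C x))"
      proof (rule pushout_cover[OF p'])
        show "mono_arrow C e" by (rule pullback_mono[OF E n'(2)])
        show "Cod C e = Dom C x" using ES by simp
        fix z v assume z: "z \<in> Arr C" "Cod C z = Dom C x" "v \<in> Arr C" "Dom C v = Dom C z" "Cod C v = Dom C g'" "x \<cdot> z = g' \<cdot> v"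
        \<comment> \<open>A part of \<open>x\<close> coming through \<open>g'\<close> also comes
          from the corner: first in the bottom square, which is a pullback, then in the top by the
          left face. Hence it too factors through \<open>n'\<close>.\<close>
        have "g \<cdot> (a \<cdot> v) = d \<cdot> (x \<cdot> z)" using comm_square_ext[OF fr, of v] z by simp
        also have "\<dots> = n \<cdot> (y \<cdot> z)" using comm_square_ext[OF xy, of z] z by simp
        finally have "comm_square C (a \<cdot> v) (y \<cdot> z) g n" using z by (simp add: comm_square_def)
        then obtain k where k: "k \<in> Arr C" "Dom C k = Dom C (a \<cdot> v)" "Cod C k = Dom C m" "m \<cdot> k = a \<cdot> v" "f \<cdot> k = y \<cdot> z"
          by (rule pullback_factor[OF n(1)])
        have "comm_square C v k a m" using z k by (simp add: comm_square_def)
        then obtain k' where k': "k' \<in> Arr C" "Dom C k' = Dom C v" "Cod C k' = Dom C m'" "m' \<cdot> k' = v" "c \<cdot> k' = k"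
          by (rule pullback_factor[OF L])
        have "x \<cdot> z = n' \<cdot> (f' \<cdot> k')" using comm_square_ext[OF top, of k'] k' z by simp
        then show "thru e z" by (intro te[of z "f' \<cdot> k'"]) (use z k' in simp_all)
      qed (use te in simp_all)
      then obtain k where k: "k \<in> Arr C" "Dom C k = Dom C x" "Cod C k = Dom C e" "e \<cdot> k = Id C (Dom C x)" by (rule thruE) simp
      define z where "z = l \<cdot> k"
      have z: "z \<in> Arr C" "Dom C z = Dom C x" "Cod C z = Dom C n'" using k ES by (auto simp: z_def)
      have nz: "n' \<cdot> z = x"
        using comm_square_ext[OF pullback_square[OF E], of k] k ES by (simp add: z_def)
      have "b \<cdot> z = y"
        by (rule monoD[OF n(2)]) (use comm_square_ext[OF ri, of z] z nz s(9) in simp_all)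
      then show "\<exists>k. k \<in> Arr C \<and> Dom C k = Dom C x \<and> Cod C k = Dom C n' \<and> n' \<cdot> k = x \<and> b \<cdot> k = y"
        using z nz by (intro exI[of _ z]) simp
    next
      show "h = k" if "h \<in> Arr C" "k \<in> Arr C" "Dom C h = Dom C k" "Cod C h = Dom C n'" "Cod C k = Dom C n'" "n' \<cdot> h = n' \<cdot> k" for h k
        by (rule monoD[OF n'(2)]) (use that in simp_all)
    qed
    have joint: "a1 = a2" if a12: "a1 \<in> Arr C" "a2 \<in> Arr C" "Dom C a2 = Dom C a1" "Cod C a1 = Dom C g'" "Cod C a2 = Dom C g'"
      "g' \<cdot> a1 = g' \<cdot> a2" "a \<cdot> a1 = a \<cdot> a2" for a1 a2
    proof -
      obtain \<kappa>1 \<kappa>2 where Q: "is_pullback C \<kappa>1 \<kappa>2 g' g'" using pullback_ex[of g' g'] by auto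
      note QS = comm_squareD[OF pullback_square[OF Q]]
      have [simp]: "\<kappa>1 \<in> Arr C" "\<kappa>2 \<in> Arr C" "Dom C \<kappa>2 = Dom C \<kappa>1" "Cod C \<kappa>1 = Dom C g'" "Cod C \<kappa>2 = Dom C g'" using QS by auto
      obtain s where s: "mono_arrow C s" "Cod C s = Dom C \<kappa>1"
        "\<And>h. h \<in> Arr C \<Longrightarrow> Cod C h = Dom C \<kappa>1 \<Longrightarrow> thru s h \<longleftrightarrow> \<kappa>1 \<cdot> h = \<kappa>2 \<cdot> h"
        using equalizer_ex[of \<kappa>1 \<kappa>2] by auto
      obtain s' where s': "mono_arrow C s'" "Cod C s' = Dom C \<kappa>1"
        "\<And>h. h \<in> Arr C \<Longrightarrow> Cod C h = Dom C \<kappa>1 \<Longrightarrow> thru s' h \<longleftrightarrow> (a \<cdot> \<kappa>1) \<cdot> h = (a \<cdot> \<kappa>2) \<cdot> h"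
        using equalizer_ex[of "a \<cdot> \<kappa>1" "a \<cdot> \<kappa>2"] by (auto simp del: assoc)
      have ss: "Cod C s' = Cod C s" using s s' by simp
      \<comment> \<open>On the kernel pair of \<open>g'\<close>, this is the subobject on which
        equality of the \<open>a\<close>-images is equivalent to equality. It is a biconditional in
        form, with one trivial half. By \<open>kernel_pair_cover\<close> it is everything once it
        contains the diagonal and the pairs arising from the kernel pair of
        \<open>f'\<close>.\<close>
      obtain e where e: "mono_arrow C e" "Cod C e = Cod C s"
        and te0: "\<And>h. h \<in> Arr C \<Longrightarrow> Cod C h = Cod C s \<Longrightarrow>
          thru e h \<longleftrightarrow> (\<forall>k. k \<in> Arr C \<and> Cod C k = Dom C h \<longrightarrow> (thru s (h \<cdot> k) \<longleftrightarrow> thru s' (h \<cdot> k)))"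
        by (rule iff_comprehension[OF s(1) s'(1) ss]) blast
      note ea [simp] = mono_arr[OF e(1)]
      have ec [simp]: "Cod C e = Dom C \<kappa>1" using e s by simp
      have te: "thru e h \<longleftrightarrow> (\<forall>k. k \<in> Arr C \<and> Cod C k = Dom C h \<longrightarrow>
          (\<kappa>1 \<cdot> (h \<cdot> k) = \<kappa>2 \<cdot> (h \<cdot> k) \<longleftrightarrow> a \<cdot> (\<kappa>1 \<cdot> (h \<cdot> k)) = a \<cdot> (\<kappa>2 \<cdot> (h \<cdot> k))))"
        if h: "h \<in> Arr C" "Cod C h = Dom C \<kappa>1" for h
      proof -
        have "thru s (h \<cdot> k) \<longleftrightarrow> \<kappa>1 \<cdot> (h \<cdot> k) = \<kappa>2 \<cdot> (h \<cdot> k)"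
          "thru s' (h \<cdot> k) \<longleftrightarrow> a \<cdot> (\<kappa>1 \<cdot> (h \<cdot> k)) = a \<cdot> (\<kappa>2 \<cdot> (h \<cdot> k))" if "k \<in> Arr C" "Cod C k = Dom C h" for k
          using s(3)[of "h \<cdot> k"] s'(3)[of "h \<cdot> k"] h that by simp_all
        then show ?thesis using te0[of h] h s(2) by auto
      qed
      have u: "rel (\<kappa>1 \<cdot> e) (\<kappa>2 \<cdot> e) (Dom C g') (Dom C g')"
      proof (rule relI)
        fix h k assume h: "h \<in> Arr C" "k \<in> Arr C" "Dom C h = Dom C k" "Cod C h = Dom C (\<kappa>1 \<cdot> e)" "Cod C k = Dom C (\<kappa>1 \<cdot> e)"
          "(\<kappa>1 \<cdot> e) \<cdot> h = (\<kappa>1 \<cdot> e) \<cdot> k" "(\<kappa>2 \<cdot> e) \<cdot> h = (\<kappa>2 \<cdot> e) \<cdot> k"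
        have h' [simp]: "Cod C h = Dom C e" "Cod C k = Dom C e" using h by simp_all
        have "e \<cdot> h = e \<cdot> k" by (rule pullback_eq[OF Q]) (use h in simp_all)
        then show "h = k" by (rule monoD[OF e(1)]) (use h in simp_all)
      qed simp_all
      have pair: "inr (\<kappa>1 \<cdot> e) (\<kappa>2 \<cdot> e) x y"
        if x: "x \<in> Arr C" "y \<in> Arr C" "Dom C y = Dom C x" "Cod C x = Dom C g'" "Cod C y = Dom C g'" "g' \<cdot> x = g' \<cdot> y"
          and k: "\<And>k. k \<in> Arr C \<Longrightarrow> Cod C k = Dom C x \<Longrightarrow> a \<cdot> (x \<cdot> k) = a \<cdot> (y \<cdot> k) \<Longrightarrow> x \<cdot> k = y \<cdot> k" for x y
      proof -
        have "comm_square C x y g' g'" using x by (simp add: comm_square_def)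
        then obtain h where h: "h \<in> Arr C" "Dom C h = Dom C x" "Cod C h = Dom C \<kappa>1" "\<kappa>1 \<cdot> h = x" "\<kappa>2 \<cdot> h = y"
          by (rule pullback_factor[OF Q])
        have hk: "\<kappa>1 \<cdot> (h \<cdot> k) = x \<cdot> k" "\<kappa>2 \<cdot> (h \<cdot> k) = y \<cdot> k" if "k \<in> Arr C" "Cod C k = Dom C x" for k
          using comp_eq_comp[OF h(4), of k] comp_eq_comp[OF h(5), of k] that h by simp_all
        have "thru e h" unfolding te[OF h(1,3)] using k hk h(2) by auto
        then obtain l where l: "l \<in> Arr C" "Dom C l = Dom C h" "Cod C l = Dom C e" "e \<cdot> l = h" by (rule thruE)
        show ?thesis by (rule inrI[of l]) (use l h in simp_all)
      qed
      have "inr (\<kappa>1 \<cdot> e) (\<kappa>2 \<cdot> e) a1 a2"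
      proof (rule kernel_pair_cover[OF p' m' u])
        show "g' \<cdot> (\<kappa>1 \<cdot> e) = g' \<cdot> (\<kappa>2 \<cdot> e)" using comm_square_ext[OF pullback_square[OF Q], of e] by simp
        show "inr (\<kappa>1 \<cdot> e) (\<kappa>2 \<cdot> e) x x" if "x \<in> Arr C" "Cod C x = Dom C g'" for x
          by (rule pair) (use that in simp_all)
        fix c1 c2 assume c12: "c1 \<in> Arr C" "c2 \<in> Arr C" "Dom C c2 = Dom C c1" "Cod C c1 = Dom C m'" "Cod C c2 = Dom C m'"
          and fc: "f' \<cdot> c1 = f' \<cdot> c2"
        show "inr (\<kappa>1 \<cdot> e) (\<kappa>2 \<cdot> e) (m' \<cdot> c1) (m' \<cdot> c2)"
        proof (rule pair)
          show "g' \<cdot> (m' \<cdot> c1) = g' \<cdot> (m' \<cdot> c2)"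
            using comm_square_ext[OF top, of c1] comm_square_ext[OF top, of c2] c12 fc by simp
          fix k assume k: "k \<in> Arr C" "Cod C k = Dom C (m' \<cdot> c1)" and eq: "a \<cdot> ((m' \<cdot> c1) \<cdot> k) = a \<cdot> ((m' \<cdot> c2) \<cdot> k)"
          have k' [simp]: "k \<in> Arr C" "Cod C k = Dom C c1" using k c12 by simp_all
          \<comment> \<open>If the \<open>a\<close>-images agree at a later stage, the mono
            \<open>m\<close> makes the \<open>c\<close>-images agree; together with equal
            \<open>f'\<close>-images the back pullback identifies the elements.\<close>
          have "m \<cdot> (c \<cdot> (c1 \<cdot> k)) = m \<cdot> (c \<cdot> (c2 \<cdot> k))"
            using comm_square_ext[OF pullback_square[OF L], of "c1 \<cdot> k"]
              comm_square_ext[OF pullback_square[OF L], of "c2 \<cdot> k"] eq c12 by simp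
          then have cc: "c \<cdot> (c1 \<cdot> k) = c \<cdot> (c2 \<cdot> k)" by (rule monoD[OF m]) (use c12 in simp_all)
          have "c1 \<cdot> k = c2 \<cdot> k"
            by (rule pullback_eq[OF K _ cc]) (use c12 comp_eq_comp[OF fc, of k] in simp_all)
          then show "(m' \<cdot> c1) \<cdot> k = (m' \<cdot> c2) \<cdot> k" using c12 by simp
        qed (use c12 in simp_all)
      qed (use a12 in simp_all)
      then obtain k where k: "k \<in> Arr C" "Dom C k = Dom C a1" "Cod C k = Dom C (\<kappa>1 \<cdot> e)" "(\<kappa>1 \<cdot> e) \<cdot> k = a1" "(\<kappa>2 \<cdot> e) \<cdot> k = a2"
        by (rule inrE)
      have kc: "Cod C k = Dom C e" using k by simp
      have ek: "\<kappa>1 \<cdot> (e \<cdot> k) = a1" "\<kappa>2 \<cdot> (e \<cdot> k) = a2" using k kc by simp_all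
      have te1: "thru e (e \<cdot> k)" by (rule thruI[of k]) (use k kc in simp_all)
      have ekd: "e \<cdot> k \<in> Arr C" "Cod C (e \<cdot> k) = Dom C \<kappa>1" "Dom C (e \<cdot> k) = Dom C a1" using k kc by simp_all
      define i where "i = Id C (Dom C a1)"
      have i: "i \<in> Arr C \<and> Cod C i = Dom C (e \<cdot> k)" "(e \<cdot> k) \<cdot> i = e \<cdot> k"
        using a12(1) ekd by (simp_all add: i_def del: assoc)
      have "a1 = a2 \<longleftrightarrow> a \<cdot> a1 = a \<cdot> a2"
        using te[OF ekd(1,2), THEN iffD1, OF te1, THEN spec, THEN mp, OF i(1)] unfolding i(2) ek .
      then show "a1 = a2" using a12(7) by blast
    qed
    have front: "is_pullback C g' a d g"
    proof -
      \<comment> \<open>The true pullback of \<open>d\<close> and \<open>g\<close>, with comparison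
        arrow \<open>e\<close> from the domain of \<open>g'\<close>. Joint monicity makes
        \<open>e\<close> mono.\<close>
      obtain g'' a'' where G: "is_pullback C g'' a'' d g" using pullback_ex[of d g] by auto
      note GS = comm_squareD[OF pullback_square[OF G]]
      have [simp]: "g'' \<in> Arr C" "a'' \<in> Arr C" "Dom C a'' = Dom C g''" "Cod C g'' = Dom C d" "Cod C a'' = Dom C g" using GS by auto
      obtain e where e: "e \<in> Arr C" "Dom C e = Dom C g'" "Cod C e = Dom C g''" "g'' \<cdot> e = g'" "a'' \<cdot> e = a"
        by (rule pullback_factor[OF G fr])
      have [simp]: "e \<in> Arr C" "Dom C e = Dom C g'" "Cod C e = Dom C g''" using e by auto
      have em: "mono_arrow C e"
      proof (rule monoI)
        fix h k assume h: "h \<in> Arr C" "k \<in> Arr C" "Dom C h = Dom C k" "Cod C h = Dom C e" "Cod C k = Dom C e" "e \<cdot> h = e \<cdot> k"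
        show "h = k"
          by (rule joint)
            (use h comp_eq_comp[OF e(4), of h] comp_eq_comp[OF e(4), of k] comp_eq_comp[OF e(5), of h] comp_eq_comp[OF e(5), of k] in simp_all)
      qed simp
      have ext: "g'' \<cdot> (e \<cdot> m') = n' \<cdot> f'" using comp_eq_comp[OF e(4), of m'] T(9) by simp
      have L': "is_pullback C (e \<cdot> m') c a'' m"
      proof (rule pullback_cancel[OF _ G])
        show "is_pullback C (g'' \<cdot> (e \<cdot> m')) c d (g \<cdot> m)"
          unfolding ext S(9) by (rule pullback_paste[OF K right])
        show "comm_square C (e \<cdot> m') c a'' m" using comp_eq_comp[OF e(5), of m'] LS(9) by (simp add: comm_square_def)
      qed
      have "comm_square C (e \<cdot> m') f' g'' n'" using ext by (simp add: comm_square_def)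
      \<comment> \<open>With the true pullback in front, stability gives a second pushout with the
        same final corner. Cancelling the original top face presents \<open>e\<close> as pushed out
        along \<open>g'\<close> to an identity; as \<open>e\<close> is mono, this square is also a
        pullback, and the identity yields a section of \<open>e\<close>.\<close>
      then have "is_pushout C (e \<cdot> m') f' g'' n'" by (rule pushout_stable[OF p _ L' K G right])
      then have "is_pushout C f' (e \<cdot> m') (Id C (Dom C d) \<cdot> n') g''" using pushout_swap by simp
      then have "is_pushout C g' e (Id C (Dom C d)) g''"
        by (rule pushout_cancel[OF _ pushout_swap[OF p']]) (use e in \<open>simp add: comm_square_def\<close>)
      then have po: "is_pullback C e g' g'' (Id C (Dom C d))" using pushout_mono(1)[OF pushout_swap em] by blast
      have "comm_square C (Id C (Dom C g'')) g'' g'' (Id C (Dom C d))" by (simp add: comm_square_def)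
      then obtain k where k: "k \<in> Arr C" "Dom C k = Dom C (Id C (Dom C g''))" "Cod C k = Dom C e" "e \<cdot> k = Id C (Dom C g'')" "g' \<cdot> k = g''"
        by (rule pullback_factor[OF po])
      have [simp]: "k \<in> Arr C" "Dom C k = Dom C g''" "Cod C k = Dom C g'" using k by auto
      have ak: "a \<cdot> k = a''" using comp_eq_comp[OF e(5), of k] k by simp
      show ?thesis
      proof (rule pullbackI[OF fr])
        fix x y assume "comm_square C x y d g"
        then obtain w where w: "w \<in> Arr C" "Dom C w = Dom C x" "Cod C w = Dom C g''" "g'' \<cdot> w = x" "a'' \<cdot> w = y"
          by (rule pullback_factor[OF G])
        then show "\<exists>l. l \<in> Arr C \<and> Dom C l = Dom C x \<and> Cod C l = Dom C g' \<and> g' \<cdot> l = x \<and> a \<cdot> l = y"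
          using comp_eq_comp[OF k(5), of w] comp_eq_comp[OF ak, of w] by (intro exI[of _ "k \<cdot> w"]) simp
      next
        show "h = k" if "h \<in> Arr C" "k \<in> Arr C" "Dom C h = Dom C k" "Cod C h = Dom C g'" "Cod C k = Dom C g'"
          "g' \<cdot> h = g' \<cdot> k" "a \<cdot> h = a \<cdot> k" for h k
          by (rule joint) (use that in simp_all)
      qed
    qed
    show "is_pullback C g' a d g \<and> is_pullback C n' b d n" using front right by simp
  qed
qed

end

section \<open>Full embeddings\<close>

locale full_functor =
  C: category C + D: category D
  for C :: "('o, 'a) cat" and D :: "('p, 'b) cat" and Fo Fa +
  assumes emb: "full_embedding C D Fo Fa"
begin

lemma Fa_arr [simp]: "f \<in> Arr C \<Longrightarrow> Fa f \<in> Arr D" "f \<in> Arr C \<Longrightarrow> Dom D (Fa f) = Fo (Dom C f)"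
  "f \<in> Arr C \<Longrightarrow> Cod D (Fa f) = Fo (Cod C f)"
  using emb by (auto simp: full_embedding_def is_functor_def Hom_def)

lemma Fo_inject [simp]: "A \<in> Obj C \<Longrightarrow> B \<in> Obj C \<Longrightarrow> Fo A = Fo B \<longleftrightarrow> A = B"
  using emb by (auto simp: full_embedding_def dest: inj_onD)

lemma Fa_comp: "f \<in> Arr C \<Longrightarrow> g \<in> Arr C \<Longrightarrow> Cod C f = Dom C g \<Longrightarrow> Fa (g \<cdot>\<^bsub>C\<^esub> f) = Fa g \<cdot>\<^bsub>D\<^esub> Fa f"
  using emb by (auto simp: full_embedding_def is_functor_def)

lemma Fa_bij: "A \<in> Obj C \<Longrightarrow> B \<in> Obj C \<Longrightarrow> bij_betw Fa (Hom C A B) (Hom D (Fo A) (Fo B))"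
  using emb by (auto simp: full_embedding_def)

lemma Fa_eq:
  assumes "Fa f = Fa g" "f \<in> Arr C" "g \<in> Arr C" "Dom C f = Dom C g" "Cod C f = Cod C g"
  shows "f = g"
  using Fa_bij[of "Dom C g" "Cod C g"] assms by (auto simp: bij_betw_def Hom_def dest!: inj_onD)

lemma Fa_full:
  assumes "k \<in> Arr D" "Dom D k = Fo A" "Cod D k = Fo B" "A \<in> Obj C" "B \<in> Obj C"
  obtains f where "f \<in> Arr C" "Dom C f = A" "Cod C f = B" "Fa f = k"
proof -
  have "k \<in> Fa ` Hom C A B" using Fa_bij[of A B] assms by (auto simp: bij_betw_def Hom_def)
  then show ?thesis using that by (auto simp: Hom_def)
qed

lemma Fa_comp_eq_iff:
  assumes "f \<in> Arr C" "g \<in> Arr C" "h \<in> Arr C" "k \<in> Arr C" "Cod C f = Dom C g" "Cod C h = Dom C k"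
    "Dom C f = Dom C h" "Cod C g = Cod C k"
  shows "Fa g \<cdot>\<^bsub>D\<^esub> Fa f = Fa k \<cdot>\<^bsub>D\<^esub> Fa h \<longleftrightarrow> g \<cdot>\<^bsub>C\<^esub> f = k \<cdot>\<^bsub>C\<^esub> h"
  using Fa_eq[of "g \<cdot>\<^bsub>C\<^esub> f" "k \<cdot>\<^bsub>C\<^esub> h"] assms by (auto simp: Fa_comp[symmetric])

lemma square: "comm_square C m f g n \<Longrightarrow> comm_square D (Fa m) (Fa f) (Fa g) (Fa n)"
  by (auto simp: comm_square_def Fa_comp[symmetric])

lemma reflect_square:
  assumes "comm_square D (Fa m) (Fa f) (Fa g) (Fa n)" "m \<in> Arr C" "f \<in> Arr C" "g \<in> Arr C" "n \<in> Arr C"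
  shows "comm_square C m f g n"
proof -
  have d: "Dom C m = Dom C f" "Cod C m = Dom C g" "Cod C f = Dom C n" "Cod C g = Cod C n"
    and e: "Fa g \<cdot>\<^bsub>D\<^esub> Fa m = Fa n \<cdot>\<^bsub>D\<^esub> Fa f"
    using assms by (auto simp: comm_square_def)
  then show ?thesis using Fa_comp_eq_iff[of m g f n] assms by (auto simp: comm_square_def)
qed

lemma reflect_pullback:
  assumes p: "is_pullback D (Fa m) (Fa f) (Fa g) (Fa n)" and a: "m \<in> Arr C" "f \<in> Arr C" "g \<in> Arr C" "n \<in> Arr C"
  shows "is_pullback C m f g n"
proof (rule C.pullbackI)
  show sq: "comm_square C m f g n" by (rule reflect_square[OF D.pullback_square[OF p] a])
  note S = C.comm_squareD[OF sq]
  show "\<exists>k. k \<in> Arr C \<and> Dom C k = Dom C x \<and> Cod C k = Dom C m \<and> m \<cdot>\<^bsub>C\<^esub> k = x \<and> f \<cdot>\<^bsub>C\<^esub> k = y"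
    if xy: "comm_square C x y g n" for x y
  proof -
    note X = C.comm_squareD[OF xy]
    obtain l where l: "l \<in> Arr D" "Dom D l = Dom D (Fa x)" "Cod D l = Dom D (Fa m)" "Fa m \<cdot>\<^bsub>D\<^esub> l = Fa x" "Fa f \<cdot>\<^bsub>D\<^esub> l = Fa y"
      by (rule D.pullback_factor[OF p square[OF xy]])
    obtain k where k: "k \<in> Arr C" "Dom C k = Dom C x" "Cod C k = Dom C m" "Fa k = l"
      by (rule Fa_full[OF l(1), of "Dom C x" "Dom C m"]) (use l S X in simp_all)
    have "m \<cdot>\<^bsub>C\<^esub> k = x" by (rule Fa_eq) (use k l S X in \<open>simp_all add: Fa_comp\<close>)
    moreover have "f \<cdot>\<^bsub>C\<^esub> k = y" by (rule Fa_eq) (use k l S X in \<open>simp_all add: Fa_comp\<close>)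
    ultimately show ?thesis using k by blast
  qed
  show "h = k" if h: "h \<in> Arr C" "k \<in> Arr C" "Dom C h = Dom C k" "Cod C h = Dom C m" "Cod C k = Dom C m"
    "m \<cdot>\<^bsub>C\<^esub> h = m \<cdot>\<^bsub>C\<^esub> k" "f \<cdot>\<^bsub>C\<^esub> h = f \<cdot>\<^bsub>C\<^esub> k" for h k
  proof -
    have "Fa h = Fa k"
      by (rule D.pullback_eq[OF p]) (use h S in \<open>simp_all add: Fa_comp[symmetric]\<close>)
    then show ?thesis by (rule Fa_eq) (use h in simp_all)
  qed
qed

lemma reflect_pushout:
  assumes p: "is_pushout D (Fa m) (Fa f) (Fa g) (Fa n)" and a: "m \<in> Arr C" "f \<in> Arr C" "g \<in> Arr C" "n \<in> Arr C"
  shows "is_pushout C m f g n"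
proof (rule C.pushoutI)
  show sq: "comm_square C m f g n" by (rule reflect_square[OF D.pushout_square[OF p] a])
  note S = C.comm_squareD[OF sq]
  show "\<exists>k. k \<in> Arr C \<and> Dom C k = Cod C g \<and> Cod C k = Cod C x \<and> k \<cdot>\<^bsub>C\<^esub> g = x \<and> k \<cdot>\<^bsub>C\<^esub> n = y"
    if xy: "comm_square C m f x y" for x y
  proof -
    note X = C.comm_squareD[OF xy]
    obtain l where l: "l \<in> Arr D" "Dom D l = Cod D (Fa g)" "Cod D l = Cod D (Fa x)" "l \<cdot>\<^bsub>D\<^esub> Fa g = Fa x" "l \<cdot>\<^bsub>D\<^esub> Fa n = Fa y"
      by (rule D.pushout_factor[OF p square[OF xy]])
    obtain k where k: "k \<in> Arr C" "Dom C k = Cod C g" "Cod C k = Cod C x" "Fa k = l"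
      by (rule Fa_full[OF l(1), of "Cod C g" "Cod C x"]) (use l S X in simp_all)
    have "k \<cdot>\<^bsub>C\<^esub> g = x" by (rule Fa_eq) (use k l S X in \<open>simp_all add: Fa_comp\<close>)
    moreover have "k \<cdot>\<^bsub>C\<^esub> n = y" by (rule Fa_eq) (use k l S X in \<open>simp_all add: Fa_comp\<close>)
    ultimately show ?thesis using k by blast
  qed
  show "h = k" if h: "h \<in> Arr C" "k \<in> Arr C" "Cod C h = Cod C k" "Dom C h = Cod C g" "Dom C k = Cod C g"
    "h \<cdot>\<^bsub>C\<^esub> g = k \<cdot>\<^bsub>C\<^esub> g" "h \<cdot>\<^bsub>C\<^esub> n = k \<cdot>\<^bsub>C\<^esub> n" for h k
  proof -
    have "Fa h = Fa k"
      by (rule D.pushout_eq[OF p]) (use h S in \<open>simp_all add: Fa_comp[symmetric]\<close>)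
    then show ?thesis by (rule Fa_eq) (use h in simp_all)
  qed
qed

text \<open>A mono is an arrow whose kernel pair is given by identities, and these are
  preserved.\<close>

lemma preserves_mono:
  assumes pp: "preserves_pullbacks C D Fa" and m: "mono_arrow C m"
  shows "mono_arrow D (Fa m)"
proof -
  have i: "Fa (Id C (Dom C m)) = Id D (Fo (Dom C m))" "Fo (Dom C m) \<in> Obj D"
    using emb C.mono_arr[OF m] by (auto simp: full_embedding_def is_functor_def)
  have "is_pullback C (Id C (Dom C m)) (Id C (Dom C m)) m m"
    using C.pullback_mono_comp[OF m, of "Id C (Dom C m)" "Dom C m"] C.mono_arr[OF m] by simp
  then have "is_pullback D (Id D (Fo (Dom C m))) (Id D (Fo (Dom C m))) (Fa m) (Fa m)"
    using pp i unfolding preserves_pullbacks_def by metis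
  then show ?thesis using D.mono_iff_pullback i by blast
qed

text \<open>Each cube is carried into the topos, where the image of \<open>m\<close> is a mono and
  its pushouts are van Kampen. Fullness and faithfulness reflect pullbacks and pushouts, so the
  conclusion returns to \<open>C\<close>.\<close>

theorem rm_adhesive_subcategory:
  assumes D: "topos D" and pp: "preserves_pullbacks C D Fa" and pr: "preserves_rm_pushouts C D Fa"
    and hp: "has_pullbacks C" "has_rm_pushouts C"
  shows "rm_adhesive C"
  unfolding rm_adhesive_def
proof (intro conjI hp allI impI, unfold_locales, elim conjE)
  interpret E: elementary_topos D by unfold_locales (rule D)
  fix m f g n assume m: "regular_mono C m" and p: "is_pushout C m f g n"
  have "mono_arrow D (Fa m)" by (rule preserves_mono[OF pp C.regular_mono_mono[OF m]])
  moreover have "is_pushout D (Fa m) (Fa f) (Fa g) (Fa n)" using pr m p unfolding preserves_rm_pushouts_def by blast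
  ultimately have vk: "van_kampen D (Fa m) (Fa f) (Fa g) (Fa n)" by (intro E.mono_pushout_van_kampen)
  have P: "is_pullback D (Fa x) (Fa y) (Fa z) (Fa w)" if "is_pullback C x y z w" for x y z w
    using pp that unfolding preserves_pullbacks_def by blast
  show "van_kampen C m f g n"
    unfolding van_kampen_def
  proof (intro allI impI, elim conjE)
    fix m' f' g' n' a b c d
    assume top: "comm_square C m' f' g' n'" and fr: "comm_square C g' a d g" and ri: "comm_square C n' b d n"
      and L: "is_pullback C m' c a m" and K: "is_pullback C f' c b f"
    note T = C.comm_squareD(1-4)[OF top] C.comm_squareD(1-4)[OF fr] C.comm_squareD(1-4)[OF ri]
    show "is_pushout C m' f' g' n' \<longleftrightarrow> is_pullback C g' a d g \<and> is_pullback C n' b d n"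
    proof
      assume "is_pushout C m' f' g' n'"
      \<comment> \<open>The top pushout is preserved because \<open>m'\<close>, as a pullback of
        \<open>m\<close>, is again a regular mono.\<close>
      then have "is_pushout D (Fa m') (Fa f') (Fa g') (Fa n')"
        using pr C.pullback_regular_mono[OF L m] unfolding preserves_rm_pushouts_def by blast
      note V = D.van_kampen_pullback[OF vk this P[OF L] P[OF K] square[OF fr] square[OF ri]]
      show "is_pullback C g' a d g \<and> is_pullback C n' b d n"
        using reflect_pullback[OF V(1)] reflect_pullback[OF V(2)] T by blast
    next
      assume pb: "is_pullback C g' a d g \<and> is_pullback C n' b d n"
      have "is_pushout D (Fa m') (Fa f') (Fa g') (Fa n')"
        by (rule D.van_kampen_pushout[OF vk square[OF top] P[OF L] P[OF K] P[OF conjunct1[OF pb]] P[OF conjunct2[OF pb]]])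
      then show "is_pushout C m' f' g' n'" by (rule reflect_pushout) (use T in simp_all)
    qed
  qed
qed

end

section \<open>The Yoneda embedding into sheaves\<close>

context sheaves
begin

definition yon :: "'a \<Rightarrow> 'u" where
  "yon f = yarr (rep (Cod C f)) (Dom C f) (\<gamma> f)"

lemma \<gamma>_el: "f \<in> Arr C \<Longrightarrow> Dom C f = Y \<Longrightarrow> Cod C f = X \<Longrightarrow> \<gamma> f \<in> el (rep X) Y"
  by (auto simp: Hom_def)

lemma yon_Hom: "f \<in> Arr C \<Longrightarrow> yon f \<in> Hom Sh (rep (Dom C f)) (rep (Cod C f))"
  unfolding yon_def by (intro yarr_Hom sheaf_rep \<gamma>_el) simp_all

lemma ap_yon [simp]:
  assumes "f \<in> Arr C" "k \<in> Arr C" "Cod C k = Dom C f" "Dom C k = Y"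
  shows "ap (yon f) Y (\<gamma> k) = \<gamma> (f \<cdot> k)"
  using assms by (simp add: yon_def)

text \<open>Naturality of the Yoneda correspondence: restriction of elements along \<open>f\<close>
  is precomposition with \<open>yon f\<close>.\<close>

lemma yarr_comp_yon:
  assumes F: "sheaf F" and x: "x \<in> el F (Cod C f)" and f: "f \<in> Arr C"
  shows "yarr F (Cod C f) x \<cdot>\<^bsub>Sh\<^esub> yon f = yarr F (Dom C f) (act F f x)"
proof -
  have "yarr F (Cod C f) x \<in> Hom Sh (rep (Cod C f)) F" using assms by simp
  from comp_yarr[OF this _ \<gamma>_el[OF f refl refl]] show ?thesis using f by (simp add: yon_def)
qed

lemma yon_functor: "is_functor C Sh rep yon"
  unfolding is_functor_def
proof (intro conjI ballI impI)
  show "category C" by unfold_locales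
  show "category Sh" by (rule category_Sh)
  show "rep A \<in> Obj Sh" if "A \<in> Obj C" for A using sheaf_rep that by simp
  show "yon f \<in> Hom Sh (rep (Dom C f)) (rep (Cod C f))" if "f \<in> Arr C" for f using yon_Hom that .
  show "yon (Id C A) = Id Sh (rep A)" if A: "A \<in> Obj C" for A
  proof (rule Sh_ext)
    show "yon (Id C A) \<in> Hom Sh (rep A) (rep A)" using yon_Hom[of "Id C A"] A by simp
    show "Id Sh (rep A) \<in> Hom Sh (rep A) (rep A)" using Sh_Id_Hom sheaf_rep A by simp
    show "ap (yon (Id C A)) X x = ap (Id Sh (rep A)) X x" if "X \<in> Obj C" "x \<in> el (rep A) X" for X x
      using that A by (auto simp: Sh_Id Hom_def)
  qed
  show "yon (g \<cdot> f) = yon g \<cdot>\<^bsub>Sh\<^esub> yon f" if f: "f \<in> Arr C" "g \<in> Arr C" "Cod C f = Dom C g" for f g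
    using yarr_comp_yon[OF sheaf_rep \<gamma>_el, of "Cod C g" g f] f by (simp add: yon_def)
qed

lemma yon_full_embedding: "full_embedding C Sh rep yon"
  unfolding full_embedding_def
proof (intro conjI ballI yon_functor)
  show "inj_on rep (Obj C)"
  proof (rule inj_onI)
    fix A B assume A: "A \<in> Obj C" "B \<in> Obj C" "rep A = rep B"
    \<comment> \<open>Injectivity on objects holds on the nose because the elements of a
      representable are codes of actual arrows, and an arrow knows its codomain.\<close>
    have "\<gamma> (Id C A) \<in> el (rep A) A" by (rule \<gamma>_el) (use A(1) in simp_all)
    then have "\<gamma> (Id C A) \<in> \<gamma> ` Hom C A B" using A(1) unfolding A(3) by simp
    then obtain f where f: "\<gamma> (Id C A) = \<gamma> f" "f \<in> Hom C A B" by (rule imageE)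
    have "Id C A = f" using f A(1) by (simp add: Hom_def)
    then have "Cod C (Id C A) = B" using f(2) by (simp add: Hom_def)
    then show "A = B" using A(1) by simp
  qed
  fix A B assume A: "A \<in> Obj C" "B \<in> Obj C"
  show "bij_betw yon (Hom C A B) (Hom Sh (rep A) (rep B))"
    unfolding bij_betw_def
  proof (intro conjI inj_onI equalityI subsetI)
    fix f g assume fg: "f \<in> Hom C A B" "g \<in> Hom C A B" "yon f = yon g"
    then have "\<gamma> f = \<gamma> g"
      using yarr_inject[OF sheaf_rep[OF A(2)] A(1) \<gamma>_el \<gamma>_el, of f g] by (auto simp: Hom_def yon_def)
    then show "f = g" using fg by (auto simp: Hom_def)
  next
    fix h assume "h \<in> yon ` Hom C A B"
    then show "h \<in> Hom Sh (rep A) (rep B)" using yon_Hom by (auto simp: Hom_def)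
  next
    fix h assume "h \<in> Hom Sh (rep A) (rep B)"
    then obtain x where x: "x \<in> el (rep B) A" "h = yarr (rep B) A x" using yarr_ex A(1) by blast
    then obtain f where "x = \<gamma> f" "f \<in> Hom C A B" using A by auto
    then show "h \<in> yon ` Hom C A B" using x by (auto simp: yon_def Hom_def intro!: image_eqI[of _ _ f])
  qed
qed

lemma yon_preserves_pullbacks: "preserves_pullbacks C Sh yon"
  unfolding preserves_pullbacks_def
proof (intro allI impI)
  fix m f g n assume p: "is_pullback C m f g n"
  note S = comm_squareD[OF pullback_square[OF p]]
  have arr [simp]: "m \<in> Arr C" "f \<in> Arr C" "g \<in> Arr C" "n \<in> Arr C" "Dom C f = Dom C m" "Cod C m = Dom C g"
    "Cod C f = Dom C n" "Cod C n = Cod C g" using S by auto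
  have d: "Dom Sh (yon h) = rep (Dom C h)" if "h \<in> Arr C" for h using yon_Hom[OF that] by (simp add: Hom_def)
  show "is_pullback Sh (yon m) (yon f) (yon g) (yon n)"
  proof (rule pullback_pointwiseI)
    show "comm_square Sh (yon m) (yon f) (yon g) (yon n)"
    proof (rule Sh_squareI)
      show "yon m \<in> Hom Sh (rep (Dom C m)) (rep (Dom C g))" "yon f \<in> Hom Sh (rep (Dom C m)) (rep (Dom C n))"
        "yon g \<in> Hom Sh (rep (Dom C g)) (rep (Cod C g))" "yon n \<in> Hom Sh (rep (Dom C n)) (rep (Cod C g))"
        using yon_Hom[of m] yon_Hom[of f] yon_Hom[of g] yon_Hom[of n] by simp_all
      fix X x assume "X \<in> Obj C" "x \<in> el (rep (Dom C m)) X"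
      then obtain k where "x = \<gamma> k" "k \<in> Arr C" "Dom C k = X" "Cod C k = Dom C m" by (auto simp: Hom_def)
      then show "ap (yon g) X (ap (yon m) X x) = ap (yon n) X (ap (yon f) X x)"
        using comm_square_ext[OF pullback_square[OF p], of k] by simp
    qed
    fix X x y assume X: "X \<in> Obj C" and x: "x \<in> el (Dom Sh (yon g)) X" and y: "y \<in> el (Dom Sh (yon n)) X"
      and e: "ap (yon g) X x = ap (yon n) X y"
    obtain u where u: "x = \<gamma> u" "u \<in> Arr C" "Dom C u = X" "Cod C u = Dom C g" using x X by (auto simp: d Hom_def)
    obtain v where v: "y = \<gamma> v" "v \<in> Arr C" "Dom C v = X" "Cod C v = Dom C n" using y X by (auto simp: d Hom_def)
    have "comm_square C u v g n" using u v e by (simp add: comm_square_def)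
    then obtain k where k: "k \<in> Arr C" "Dom C k = Dom C u" "Cod C k = Dom C m" "m \<cdot> k = u" "f \<cdot> k = v"
      by (rule pullback_factor[OF p])
    show "\<exists>!c. c \<in> el (Dom Sh (yon m)) X \<and> ap (yon m) X c = x \<and> ap (yon f) X c = y"
    proof (rule ex1I[of _ "\<gamma> k"])
      show "\<gamma> k \<in> el (Dom Sh (yon m)) X \<and> ap (yon m) X (\<gamma> k) = x \<and> ap (yon f) X (\<gamma> k) = y"
        using k u v X by (simp add: d Hom_def)
      fix z assume z: "z \<in> el (Dom Sh (yon m)) X \<and> ap (yon m) X z = x \<and> ap (yon f) X z = y"
      then obtain l where l: "z = \<gamma> l" "l \<in> Arr C" "Dom C l = X" "Cod C l = Dom C m" using X by (auto simp: d Hom_def)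
      have "l = k" by (rule pullback_eq[OF p]) (use z l k u v in simp_all)
      then show "z = \<gamma> k" using l by simp
    qed
  qed
qed

text \<open>By the Yoneda lemma a cocone into a sheaf \<open>F\<close> is a pair of elements that
  agree over the corner, and an arrow from the final corner is one element there. The universal
  property is thus the sheaf condition of \<open>F\<close>.\<close>

lemma yon_cov_pushout:
  assumes c: "cov m f g n"
  shows "is_pushout Sh (yon m) (yon f) (yon g) (yon n)"
proof (rule Sh.pushoutI)
  note S = covD[OF c]
  have arr [simp]: "m \<in> Arr C" "f \<in> Arr C" "g \<in> Arr C" "n \<in> Arr C" "Dom C f = Dom C m" "Cod C m = Dom C g"
    "Cod C f = Dom C n" "Cod C n = Cod C g" using S by auto
  have H: "yon m \<in> Hom Sh (rep (Dom C m)) (rep (Dom C g))" "yon f \<in> Hom Sh (rep (Dom C m)) (rep (Dom C n))"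
    "yon g \<in> Hom Sh (rep (Dom C g)) (rep (Cod C g))" "yon n \<in> Hom Sh (rep (Dom C n)) (rep (Cod C g))"
    using yon_Hom[of m] yon_Hom[of f] yon_Hom[of g] yon_Hom[of n] by simp_all
  have cg: "Cod Sh (yon g) = rep (Cod C g)" using H by (simp add: Hom_def)
  show "comm_square Sh (yon m) (yon f) (yon g) (yon n)"
  proof (rule Sh_squareI[OF H])
    fix X x assume "X \<in> Obj C" "x \<in> el (rep (Dom C m)) X"
    then obtain k where "x = \<gamma> k" "k \<in> Arr C" "Dom C k = X" "Cod C k = Dom C m" by (auto simp: Hom_def)
    then show "ap (yon g) X (ap (yon m) X x) = ap (yon n) X (ap (yon f) X x)"
      using comm_square_ext[OF pushout_square[OF cov_pushout[OF c]], of k] by simp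
  qed
  show "\<exists>k. k \<in> Arr Sh \<and> Dom Sh k = Cod Sh (yon g) \<and> Cod Sh k = Cod Sh h \<and> k \<cdot>\<^bsub>Sh\<^esub> yon g = h \<and> k \<cdot>\<^bsub>Sh\<^esub> yon n = l"
    if hl: "comm_square Sh (yon m) (yon f) h l" for h l
  proof -
    define F where "F = Cod Sh h"
    note Q = Sh.comm_squareD[OF hl]
    have h: "h \<in> Hom Sh (rep (Dom C g)) F" and l: "l \<in> Hom Sh (rep (Dom C n)) F"
      using Q H by (auto simp: F_def Hom_def)
    note F = Hom_natural(2)[OF h]
    obtain x where x: "x \<in> el F (Dom C g)" "h = yarr F (Dom C g) x" by (rule yarr_ex[OF h]) simp_all
    obtain y where y: "y \<in> el F (Dom C n)" "l = yarr F (Dom C n) y" by (rule yarr_ex[OF l]) simp_all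
    have "yarr F (Dom C m) (act F m x) = yarr F (Dom C m) (act F f y)"
      using Q(9) yarr_comp_yon[OF F, of x m] yarr_comp_yon[OF F, of y f] x y by simp
    then have e: "act F m x = act F f y" by (rule yarr_inject[OF F, rotated 3]) (use x y F in simp_all)
    obtain z where z: "z \<in> el F (Cod C g)" "act F g z = x" "act F n z = y" by (rule sheaf_glue[OF F c x(1) y(1) e])
    have k: "yarr F (Cod C g) z \<in> Hom Sh (rep (Cod C g)) F" using F z by simp
    have "yarr F (Cod C g) z \<cdot>\<^bsub>Sh\<^esub> yon g = h" using yarr_comp_yon[OF F z(1)] z(2) x(2) by simp
    moreover have "yarr F (Cod C g) z \<cdot>\<^bsub>Sh\<^esub> yon n = l" using yarr_comp_yon[OF F, of z n] z(1,3) y(2) by simp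
    moreover have "yarr F (Cod C g) z \<in> Arr Sh" "Dom Sh (yarr F (Cod C g) z) = Cod Sh (yon g)"
      "Cod Sh (yarr F (Cod C g) z) = Cod Sh h"
      using k cg by (simp_all add: Hom_def flip: F_def)
    ultimately show ?thesis by blast
  qed
  show "h = l" if hl: "h \<in> Arr Sh" "l \<in> Arr Sh" "Cod Sh h = Cod Sh l" "Dom Sh h = Cod Sh (yon g)" "Dom Sh l = Cod Sh (yon g)"
    "h \<cdot>\<^bsub>Sh\<^esub> yon g = l \<cdot>\<^bsub>Sh\<^esub> yon g" "h \<cdot>\<^bsub>Sh\<^esub> yon n = l \<cdot>\<^bsub>Sh\<^esub> yon n" for h l
  proof -
    define F where "F = Cod Sh l"
    have h: "h \<in> Hom Sh (rep (Cod C g)) F" and l: "l \<in> Hom Sh (rep (Cod C g)) F"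
      using hl cg by (auto simp: F_def Hom_def)
    note F = Hom_natural(2)[OF h]
    obtain x where x: "x \<in> el F (Cod C g)" "h = yarr F (Cod C g) x" by (rule yarr_ex[OF h]) simp_all
    obtain y where y: "y \<in> el F (Cod C g)" "l = yarr F (Cod C g) y" by (rule yarr_ex[OF l]) simp_all
    have eg: "yarr F (Dom C g) (act F g x) = yarr F (Dom C g) (act F g y)"
      using hl(6) yarr_comp_yon[OF F, of x g] yarr_comp_yon[OF F, of y g] x y by simp
    have en: "yarr F (Dom C n) (act F n x) = yarr F (Dom C n) (act F n y)"
      using hl(7) yarr_comp_yon[OF F, of x n] yarr_comp_yon[OF F, of y n] x y by simp
    have "x = y"
    proof (rule sheaf_eq[OF F c])
      show "act F g x = act F g y" by (rule yarr_inject[OF F _ _ _ eg]) (use x y F in simp_all)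
      show "act F n x = act F n y" by (rule yarr_inject[OF F _ _ _ en]) (use x y F in simp_all)
    qed (use x y in simp_all)
    then show ?thesis using x y by simp
  qed
qed

end

theorem theoremC:
  fixes elts :: "'u \<Rightarrow> 'u set" and C :: "('o, 'a) cat"
  assumes "set_universe elts"
    and "small_category elts C"
    and "has_pullbacks C"
    and "has_rm_pushouts C"
  shows "rm_adhesive C \<longleftrightarrow>
    (\<exists>(T :: ('u, 'u) cat) Fo Fa.
       topos T \<and> full_embedding C T Fo Fa \<and>
       preserves_pullbacks C T Fa \<and> preserves_rm_pushouts C T Fa)"
proof
  assume rm: "rm_adhesive C"
  let ?cov = "\<lambda>m f g n. regular_mono C m \<and> is_pushout C m f g n"
  interpret set_universe elts by fact
  \<comment> \<open>Smallness of the set of arrows provides the enumeration by which presheaves on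
    \<open>C\<close> are coded inside the universe.\<close>
  obtain U \<gamma> where \<gamma>: "bij_betw \<gamma> (Arr C) (elts U)"
    using assms(2) unfolding small_category_def small_def eqpoll_def by blast
  interpret category C using assms(2) by (simp add: small_category_def)
  interpret square_site C ?cov by (rule rm_adhesive_site[OF rm])
  interpret sheaves C ?cov elts \<gamma> U by unfold_locales (rule \<gamma>)
  have "preserves_rm_pushouts C Sh yon"
    using yon_cov_pushout unfolding preserves_rm_pushouts_def by blast
  then show "\<exists>(T :: ('u, 'u) cat) Fo Fa. topos T \<and> full_embedding C T Fo Fa \<and>
       preserves_pullbacks C T Fa \<and> preserves_rm_pushouts C T Fa"
    using topos_Sh yon_full_embedding yon_preserves_pullbacks by blast
next
  assume "\<exists>(T :: ('u, 'u) cat) Fo Fa. topos T \<and> full_embedding C T Fo Fa \<and>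
       preserves_pullbacks C T Fa \<and> preserves_rm_pushouts C T Fa"
  then obtain T :: "('u, 'u) cat" and Fo Fa where T: "topos T" "full_embedding C T Fo Fa"
    "preserves_pullbacks C T Fa" "preserves_rm_pushouts C T Fa" by blast
  interpret C: category C using assms(2) by (simp add: small_category_def)
  interpret T: category T using T(1) by (simp add: topos_def)
  interpret full_functor C T Fo Fa by unfold_locales (rule T(2))
  show "rm_adhesive C" by (rule rm_adhesive_subcategory[OF T(1,3,4) assms(3,4)])
qed

end
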